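(* Let $(A_i)_i$ be a partition of $\mathbb N$ such that for every $n\in\mathbb N$ there exist $n$ sets in the family $(A_i)$ whose cardinality is at least $n$. Let $\Omega:\ell_2^0\to\ell_2$ be the Kalton-Peck map $$\Omega(x)=x\,\log\frac{\|x\|_2}{|x|}$$ and let $\widetilde\Omega:\ell_2^0\to\ell_2$ be the map $$\widetilde\Omega(x)=\sum_i x_i\,\log\frac{\|x\|_2}{\|x_i\|_2},\qquad x_i=x1_{A_i}.$$ Then $\widetilde\Omega\,\Omega\nsim 0$, that is, the four-term exact sequence $$0\to\ell_2\to Z(\widetilde\Omega)\to Z(\Omega)\to\ell_2\to0$$ obtained by splicing the short exact sequences induced by $\widetilde\Omega$ and by $\Omega$ is not trivial in $\operatorname{Ext}^2(\ell_2,\ell_2)$. In particular, $\operatorname{Ext}^2(\ell_2,\ell_2)\neq0$ (in the category of quasi Banach spaces).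
   Context: Scalars are $\mathbb K=\mathbb R$ or $\mathbb C$. A quasinorm is a function $\|\cdot\|:X\to[0,\infty)$ with $\|\lambda x\|=|\lambda|\|x\|$, $\|x\|=0$ iff $x=0$, and $\|x+y\|\le C(\|x\|+\|y\|)$ for some constant $C$. A quasi Banach space is a complete quasinormed space; operators are bounded linear maps. A sequence of spaces and operators is exact if the kernel of each operator equals the image of the preceding one. $\operatorname{Ext}^2(X,Y)$. Consider four-term exact sequences $\mathscr E:\ 0\to Y\to E_1\to E_2\to X\to0$ of quasi Banach spaces and operators. Write $\mathscr E\to\mathscr F$ if there are operators $u_1:E_1\to F_1$, $u_2:E_2\to F_2$ that, together with the identities of $Y$ and $X$, make the obvious diagram commute. $\operatorname{Ext}^2(X,Y)$ is the set of classes for the equivalence relation generated by $\to$; its zero element is the class of $0\to Y\xrightarrow{\mathbf I}Y\xrightarrow{0}X\xrightarrow{\mathbf I}X\to0$. A sequence is trivial if it is equivalent to this one. Quasilinear maps. A homogeneous map $\Phi:X\to Y$ between quasinormed spaces is quasilinear if $\|\Phi(x+y)-\Phi(x)-\Phi(y)\|\le Q(\|x\|+\|y\|)$ for some constant $Q$ and all $x,y$. If $X,Y$ are quasi Banach, $X_0$ is dense in $X$ and $\Phi:X_0\to Y$ is quasilinear, let $Z(\Phi)$ be the completion of $Y\oplus_\Phi X_0$, which is $Y\times X_0$ with the quasinorm $\|(y,x)\|_\Phi=\|y-\Phi(x)\|+\|x\|$. The induced exact sequence is $0\to Y\xrightarrow{\imath}Z(\Phi)\xrightarrow{\pi}X\to0$,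 where $\imath(y)=(y,0)$ and $\pi$ extends $(y,x)\mapsto x$. Splicing. For quasilinear $\Psi:X_0\to E$ and $\Phi:E_0\to Y$ ($X_0$, $E_0$ dense in $X$, $E$), $\Phi\,\Psi$ denotes the four-term sequence $0\to Y\to Z(\Phi)\to Z(\Psi)\to X\to0$ whose middle arrow is the composition $Z(\Phi)\to E\to Z(\Psi)$ of the quotient map and the inclusion. $\Phi\,\Psi\sim0$ means that it is trivial in $\operatorname{Ext}^2(X,Y)$. $\ell_2^0$ is the subspace of finitely supported sequences in $\ell_2$. The formulas for $\Omega$, $\widetilde\Omega$ are understood with the convention that a zero coordinate (respectively a zero piece $x_i$) contributes $0$. Both $\Omega$ and $\widetilde\Omega$ are quasilinear. *)

theory Defs
  imports
    "HOL-Analysis.Analysis"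
    "HOL-Algebra.Module"
begin

section \<open>Quasi Banach spaces\<close>

text \<open>
  A space is a module record (whose fields \<open>mult\<close> and \<open>one\<close> are irrelevant) together with a
  function on it.  Carriers are sets, so that one can quantify over all spaces inside a formula.
  The scalar field is the type \<open>'k\<close>, to be instantiated by \<open>real\<close> or \<open>complex\<close>.
\<close>

record ('k, 'a) qspace = "('k, 'a) module" +
  qnorm :: "'a \<Rightarrow> real"

definition scalar_ring :: "'k::field ring" where
  "scalar_ring = \<lparr>carrier = UNIV, mult = (*), one = 1, zero = 0, add = (+)\<rparr>"

definition quasinormed_space :: "('k::real_normed_field, 'a) qspace \<Rightarrow> bool" where
  "quasinormed_space V \<longleftrightarrow>
     Module.module (scalar_ring :: 'k ring) V \<and>
     (\<forall>x\<in>carrier V. 0 \<le> qnorm V x) \<and>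
     (\<forall>c. \<forall>x\<in>carrier V. qnorm V (c \<odot>\<^bsub>V\<^esub> x) = norm c * qnorm V x) \<and>
     (\<forall>x\<in>carrier V. qnorm V x = 0 \<longleftrightarrow> x = \<zero>\<^bsub>V\<^esub>) \<and>
     (\<exists>C. \<forall>x\<in>carrier V. \<forall>y\<in>carrier V.
        qnorm V (x \<oplus>\<^bsub>V\<^esub> y) \<le> C * (qnorm V x + qnorm V y))"

definition qconverges :: "('k, 'a) qspace \<Rightarrow> (nat \<Rightarrow> 'a) \<Rightarrow> 'a \<Rightarrow> bool" where
  "qconverges V s x \<longleftrightarrow> (\<lambda>n. qnorm V (s n \<ominus>\<^bsub>V\<^esub> x)) \<longlonglongrightarrow> 0"

definition qCauchy :: "('k, 'a) qspace \<Rightarrow> (nat \<Rightarrow> 'a) set" where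
  "qCauchy V = {s. (\<forall>n. s n \<in> carrier V) \<and>
     (\<forall>e>0. \<exists>N. \<forall>m\<ge>N. \<forall>n\<ge>N. qnorm V (s m \<ominus>\<^bsub>V\<^esub> s n) < e)}"

definition quasi_banach :: "('k::real_normed_field, 'a) qspace \<Rightarrow> bool" where
  "quasi_banach V \<longleftrightarrow> quasinormed_space V \<and>
     (\<forall>s\<in>qCauchy V. \<exists>x\<in>carrier V. qconverges V s x)"

definition operator ::
  "('k, 'a) qspace \<Rightarrow> ('k, 'b) qspace \<Rightarrow> ('a \<Rightarrow> 'b) \<Rightarrow> bool" where
  "operator V W T \<longleftrightarrow>
     T \<in> carrier V \<rightarrow> carrier W \<and>
     (\<forall>x\<in>carrier V. \<forall>y\<in>carrier V. T (x \<oplus>\<^bsub>V\<^esub> y) = T x \<oplus>\<^bsub>W\<^esub> T y) \<and>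
     (\<forall>c. \<forall>x\<in>carrier V. T (c \<odot>\<^bsub>V\<^esub> x) = c \<odot>\<^bsub>W\<^esub> T x) \<and>
     (\<exists>C. \<forall>x\<in>carrier V. qnorm W (T x) \<le> C * qnorm V x)"

definition op_kernel ::
  "('k, 'a) qspace \<Rightarrow> ('k, 'b) qspace \<Rightarrow> ('a \<Rightarrow> 'b) \<Rightarrow> 'a set" where
  "op_kernel V W T = {x \<in> carrier V. T x = \<zero>\<^bsub>W\<^esub>}"

text \<open>The copy of a space under a function that is injective on the carrier.\<close>

definition copy_space :: "('a \<Rightarrow> 'b) \<Rightarrow> ('k, 'a) qspace \<Rightarrow> ('k, 'b) qspace" where
  "copy_space f V = (let g = the_inv_into (carrier V) f in
     \<lparr>carrier = f ` carrier V, mult = undefined, one = undefined,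
      zero = f \<zero>\<^bsub>V\<^esub>, add = (\<lambda>a b. f (g a \<oplus>\<^bsub>V\<^esub> g b)),
      smult = (\<lambda>c a. f (c \<odot>\<^bsub>V\<^esub> g a)), qnorm = (\<lambda>a. qnorm V (g a))\<rparr>)"


section \<open>Four-term exact sequences and \<open>Ext\<^sup>2\<close>\<close>

record ('k, 'y, 'x, 'u) four_seq =
  mid1 :: "('k, 'u) qspace"
  mid2 :: "('k, 'u) qspace"
  arr1 :: "'y \<Rightarrow> 'u"
  arr2 :: "'u \<Rightarrow> 'u"
  arr3 :: "'u \<Rightarrow> 'x"

definition four_term_seqs ::
  "('k::real_normed_field, 'x) qspace \<Rightarrow> ('k, 'y) qspace \<Rightarrow> ('k, 'y, 'x, 'u) four_seq set" where
  "four_term_seqs X Y = {S.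
     quasi_banach Y \<and> quasi_banach (mid1 S) \<and> quasi_banach (mid2 S) \<and> quasi_banach X \<and>
     operator Y (mid1 S) (arr1 S) \<and>
     operator (mid1 S) (mid2 S) (arr2 S) \<and>
     operator (mid2 S) X (arr3 S) \<and>
     op_kernel Y (mid1 S) (arr1 S) = {\<zero>\<^bsub>Y\<^esub>} \<and>
     op_kernel (mid1 S) (mid2 S) (arr2 S) = arr1 S ` carrier Y \<and>
     op_kernel (mid2 S) X (arr3 S) = arr2 S ` carrier (mid1 S) \<and>
     carrier X = arr3 S ` carrier (mid2 S)}"

definition four_seq_arrow ::
  "('k::real_normed_field, 'x) qspace \<Rightarrow> ('k, 'y) qspace
    \<Rightarrow> ('k, 'y, 'x, 'u) four_seq \<Rightarrow> ('k, 'y, 'x, 'u) four_seq \<Rightarrow> bool" where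
  "four_seq_arrow X Y S T \<longleftrightarrow>
     S \<in> four_term_seqs X Y \<and> T \<in> four_term_seqs X Y \<and>
     (\<exists>u1 u2. operator (mid1 S) (mid1 T) u1 \<and> operator (mid2 S) (mid2 T) u2 \<and>
        (\<forall>y\<in>carrier Y. u1 (arr1 S y) = arr1 T y) \<and>
        (\<forall>e\<in>carrier (mid1 S). u2 (arr2 S e) = arr2 T (u1 e)) \<and>
        (\<forall>e\<in>carrier (mid2 S). arr3 T (u2 e) = arr3 S e))"

definition ext2_rel ::
  "('k::real_normed_field, 'x) qspace \<Rightarrow> ('k, 'y) qspace \<Rightarrow> ('k, 'y, 'x, 'u) four_seq rel" where
  "ext2_rel X Y = {(S, T). S \<in> four_term_seqs X Y \<and> T \<in> four_term_seqs X Y \<and>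
     equivclp (four_seq_arrow X Y) S T}"

text \<open>
  The middle spaces of the four-term sequences live on subsets of a universe type.  The universe
  \<open>'y + 'x + 'u\<close> contains copies of \<open>Y\<close> and \<open>X\<close>, which the zero sequence requires; as
  \<open>'u\<close> is arbitrary, a statement that is polymorphic in \<open>'u\<close> covers chains of
  sequences whose middle spaces have arbitrarily large cardinality.
\<close>

definition zero_seq ::
  "('k::real_normed_field, 'x) qspace \<Rightarrow> ('k, 'y) qspace
    \<Rightarrow> ('k, 'y, 'x, 'y + 'x + 'u) four_seq" where
  "zero_seq X Y =
     \<lparr>mid1 = copy_space Inl Y, mid2 = copy_space (Inr \<circ> Inl) X,
      arr1 = Inl, arr2 = (\<lambda>_. Inr (Inl \<zero>\<^bsub>X\<^esub>)), arr3 = projl \<circ> projr\<rparr>"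

definition Ext2 ::
  "('k::real_normed_field, 'x) qspace \<Rightarrow> ('k, 'y) qspace
    \<Rightarrow> ('k, 'y, 'x, 'y + 'x + 'u) four_seq set set" where
  "Ext2 X Y = four_term_seqs X Y // ext2_rel X Y"

definition ext2_zero ::
  "('k::real_normed_field, 'x) qspace \<Rightarrow> ('k, 'y) qspace
    \<Rightarrow> ('k, 'y, 'x, 'y + 'x + 'u) four_seq set" where
  "ext2_zero X Y = ext2_rel X Y `` {zero_seq X Y}"

definition ext2_trivial ::
  "('k::real_normed_field, 'x) qspace \<Rightarrow> ('k, 'y) qspace
    \<Rightarrow> ('k, 'y, 'x, 'y + 'x + 'u) four_seq \<Rightarrow> bool" where
  "ext2_trivial X Y S \<longleftrightarrow> (S, zero_seq X Y) \<in> ext2_rel X Y"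


section \<open>Completions, twisted sums and splicing\<close>

definition null_rel :: "('k, 'a) qspace \<Rightarrow> (nat \<Rightarrow> 'a) rel" where
  "null_rel V = {(s, t). s \<in> qCauchy V \<and> t \<in> qCauchy V \<and>
     (\<lambda>n. qnorm V (s n \<ominus>\<^bsub>V\<^esub> t n)) \<longlonglongrightarrow> 0}"

text \<open>
  The completion of a quasinormed space, by classes of Cauchy sequences.  Since a quasinorm need
  not be continuous, \<open>qnorm V (s n)\<close> need not converge for a Cauchy sequence \<open>s\<close>, and the
  quasinorm of the completion is only determined up to equivalence.  We take the gauge of the
  closure of the unit ball of \<open>V\<close>; on \<open>V\<close> it is equivalent to the given quasinorm (and equal
  to it if the latter is continuous).
\<close>

definition qcompletion :: "('k, 'a) qspace \<Rightarrow> ('k, (nat \<Rightarrow> 'a) set) qspace" where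
  "qcompletion V =
     \<lparr>carrier = qCauchy V // null_rel V, mult = undefined, one = undefined,
      zero = null_rel V `` {\<lambda>_. \<zero>\<^bsub>V\<^esub>},
      add = (\<lambda>a b. \<Union>s\<in>a. \<Union>t\<in>b. null_rel V `` {\<lambda>n. s n \<oplus>\<^bsub>V\<^esub> t n}),
      smult = (\<lambda>c a. \<Union>s\<in>a. null_rel V `` {\<lambda>n. c \<odot>\<^bsub>V\<^esub> s n}),
      qnorm = (\<lambda>a. Inf {r. \<exists>s\<in>a. \<forall>n. qnorm V (s n) \<le> r})\<rparr>"

text \<open>\<open>Y \<oplus>\<^sub>\<Phi> X\<^sub>0\<close>, for a linear subspace \<open>X\<^sub>0\<close> of \<open>X\<close>.\<close>

definition twisted_sum ::
  "('k, 'y) qspace \<Rightarrow> ('k, 'x) qspace \<Rightarrow> 'x set \<Rightarrow> ('x \<Rightarrow> 'y) \<Rightarrow> ('k, 'y \<times> 'x) qspace" where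
  "twisted_sum Y X X0 \<Phi> =
     \<lparr>carrier = carrier Y \<times> X0, mult = undefined, one = undefined,
      zero = (\<zero>\<^bsub>Y\<^esub>, \<zero>\<^bsub>X\<^esub>),
      add = (\<lambda>(y, x) (y', x'). (y \<oplus>\<^bsub>Y\<^esub> y', x \<oplus>\<^bsub>X\<^esub> x')),
      smult = (\<lambda>c (y, x). (c \<odot>\<^bsub>Y\<^esub> y, c \<odot>\<^bsub>X\<^esub> x)),
      qnorm = (\<lambda>(y, x). qnorm Y (y \<ominus>\<^bsub>Y\<^esub> \<Phi> x) + qnorm X x)\<rparr>"

definition Z_space ::
  "('k, 'y) qspace \<Rightarrow> ('k, 'x) qspace \<Rightarrow> 'x set \<Rightarrow> ('x \<Rightarrow> 'y)
    \<Rightarrow> ('k, (nat \<Rightarrow> 'y \<times> 'x) set) qspace" where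
  "Z_space Y X X0 \<Phi> = qcompletion (twisted_sum Y X X0 \<Phi>)"

definition Z_incl ::
  "('k, 'y) qspace \<Rightarrow> ('k, 'x) qspace \<Rightarrow> 'x set \<Rightarrow> ('x \<Rightarrow> 'y)
    \<Rightarrow> 'y \<Rightarrow> (nat \<Rightarrow> 'y \<times> 'x) set" where
  "Z_incl Y X X0 \<Phi> y = null_rel (twisted_sum Y X X0 \<Phi>) `` {\<lambda>_. (y, \<zero>\<^bsub>X\<^esub>)}"

text \<open>The continuous extension of \<open>(y, x) \<mapsto> x\<close>.\<close>

definition Z_quot :: "('k, 'x) qspace \<Rightarrow> (nat \<Rightarrow> 'y \<times> 'x) set \<Rightarrow> 'x" where
  "Z_quot X z = (THE x. x \<in> carrier X \<and> (\<forall>s\<in>z. qconverges X (\<lambda>n. snd (s n)) x))"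

text \<open>
  The sequence \<open>\<Phi> \<Psi>\<close>, for \<open>\<Psi>\<close> from \<open>X\<^sub>0\<close> (dense in \<open>X\<close>) to \<open>E\<close> and
  \<open>\<Phi>\<close> from \<open>E\<^sub>0\<close> (dense in \<open>E\<close>) to \<open>Y\<close>, in a universe large enough for
  \<open>Z(\<Phi>)\<close> and \<open>Z(\<Psi>)\<close>.
\<close>

type_synonym ('y, 'e, 'x, 'w) splice_univ =
  "'y + 'x + (nat \<Rightarrow> 'y \<times> 'e) set + (nat \<Rightarrow> 'e \<times> 'x) set + 'w"

definition emb_Z1 :: "(nat \<Rightarrow> 'y \<times> 'e) set \<Rightarrow> ('y, 'e, 'x, 'w) splice_univ" where
  "emb_Z1 z = Inr (Inr (Inl z))"

definition emb_Z2 :: "(nat \<Rightarrow> 'e \<times> 'x) set \<Rightarrow> ('y, 'e, 'x, 'w) splice_univ" where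
  "emb_Z2 z = Inr (Inr (Inr (Inl z)))"

definition yoneda_splice ::
  "('k, 'y) qspace \<Rightarrow> ('k, 'e) qspace \<Rightarrow> 'e set \<Rightarrow> ('k, 'x) qspace \<Rightarrow> 'x set
    \<Rightarrow> ('e \<Rightarrow> 'y) \<Rightarrow> ('x \<Rightarrow> 'e) \<Rightarrow> ('k, 'y, 'x, ('y, 'e, 'x, 'w) splice_univ) four_seq" where
  "yoneda_splice Y E E0 X X0 \<Phi> \<Psi> =
     \<lparr>mid1 = copy_space emb_Z1 (Z_space Y E E0 \<Phi>),
      mid2 = copy_space emb_Z2 (Z_space E X X0 \<Psi>),
      arr1 = (\<lambda>y. emb_Z1 (Z_incl Y E E0 \<Phi> y)),
      arr2 = (\<lambda>u. emb_Z2 (Z_incl E X X0 \<Psi> (Z_quot E (the_inv emb_Z1 u)))),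
      arr3 = (\<lambda>u. Z_quot X (the_inv emb_Z2 u))\<rparr>"


section \<open>The space \<open>\<ell>\<^sub>2\<close> and the Kalton--Peck maps\<close>

definition norm2 :: "(nat \<Rightarrow> 'k::real_normed_field) \<Rightarrow> real" where
  "norm2 x = sqrt (\<Sum>n. (norm (x n))\<^sup>2)"

definition l2 :: "('k::real_normed_field, nat \<Rightarrow> 'k) qspace" where
  "l2 = \<lparr>carrier = {x. summable (\<lambda>n. (norm (x n))\<^sup>2)}, mult = undefined, one = undefined,
     zero = (\<lambda>_. 0), add = (\<lambda>x y n. x n + y n), smult = (\<lambda>c x n. c * x n), qnorm = norm2\<rparr>"

type_synonym ('k, 'w) l2_four_seq =
  "('k, nat \<Rightarrow> 'k, nat \<Rightarrow> 'k, (nat \<Rightarrow> 'k, nat \<Rightarrow> 'k, nat \<Rightarrow> 'k, 'w) splice_univ) four_seq"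

definition l2_fin :: "(nat \<Rightarrow> 'k::real_normed_field) set" where
  "l2_fin = {x. finite {n. x n \<noteq> 0}}"

text \<open>A coordinate with \<open>x n = 0\<close> contributes 0, because of the factor \<open>x n\<close>.\<close>

definition kalton_peck :: "(nat \<Rightarrow> 'k::real_normed_field) \<Rightarrow> nat \<Rightarrow> 'k" where
  "kalton_peck x = (\<lambda>n. x n * of_real (ln (norm2 x / norm (x n))))"

definition restrict_to :: "(nat \<Rightarrow> 'k::real_normed_field) \<Rightarrow> nat set \<Rightarrow> nat \<Rightarrow> 'k" where
  "restrict_to x B = (\<lambda>n. x n * indicator B n)"

text \<open>
  The family of sets is given by the set \<open>P\<close> of its members; for finitely supported \<open>x\<close>, only
  finitely many blocks meet the support, and all the others contribute 0.
\<close>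

definition kalton_peck_blocks ::
  "nat set set \<Rightarrow> (nat \<Rightarrow> 'k::real_normed_field) \<Rightarrow> nat \<Rightarrow> 'k" where
  "kalton_peck_blocks P x = (\<lambda>n. \<Sum>B | B \<in> P \<and> restrict_to x B \<noteq> (\<lambda>_. 0).
     restrict_to x B n * of_real (ln (norm2 x / norm2 (restrict_to x B))))"

end

theory Submission
  imports Defs
begin

text \<open>
  A four-term sequence is trivial only if its middle arrow factors through an extension of the
  last space by the first middle space; the property \<open>liftable\<close> below expresses this, and the
  open mapping theorem shows that arrows preserve it in both directions.  For the spliced sequence it
  yields a map \<open>\<Theta>\<close> such that, with \<open>\<Delta>f(x, y) = f(x + y) - f(x) - f(y)\<close>, the norm of
  \<open>\<Delta>\<Theta>(x, y) - \<Omega>~(\<Delta>\<Omega>(x, y))\<close> is at most \<open>Q (\<parallel>x\<parallel> + \<parallel>y\<parallel>)\<close>, where \<open>\<Omega>\<close> and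
  \<open>\<Omega>~\<close> are the Kalton--Peck map and its block version.

  Let \<open>\<phi>(F)\<close> be the average of \<open>\<langle>\<Theta>(\<epsilon> 1\<^sub>F), \<epsilon> 1\<^sub>F\<rangle>\<close> over all signs \<open>\<epsilon>\<close>.  If \<open>F\<close> and
  \<open>F'\<close> are disjoint, the cross terms average to 0; so if they have the same size and
  \<open>F \<union> F'\<close> meets \<open>p\<close> blocks in equally many points, then \<open>\<phi>(F \<union> F')\<close> is
  \<open>\<phi>(F) + \<phi>(F') + |F \<union> F'| (ln 2 / 2) (ln p / 2)\<close> up to \<open>O(|F|)\<close>.  Thus for
  \<open>p\<close> blocks of \<open>q\<close> points, \<open>\<phi>(F) / |F|\<close> changes like the form
  \<open>u du + u dv\<close>, with \<open>u = ln p / 2\<close> and \<open>v = ln q / 2\<close>, which is not closed: from one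
  point to \<open>2\<^sup>m\<close> blocks of \<open>2\<^sup>m\<close> points, doubling \<open>p\<close> first or \<open>q\<close> first
  gives values that differ by a multiple of \<open>m\<^sup>2\<close>, whereas the errors are \<open>O(m)\<close>.
\<close>

subsection \<open>Quasinormed spaces and operators\<close>

text \<open>All that a lift yields about \<open>\<Theta>\<close> is an estimate for its Cauchy
  difference; nothing bounds \<open>\<Theta>\<close> itself or makes it homogeneous. So only
  increments of \<phi> can be used, and its unknown values at single points have to be removed
  before two routes are compared. Sign vectors are the test vectors because both maps act on them as
  scalars: \<Omega> as ln sqrt |F|, and \<Omega>~ as ln sqrt p when F is spread evenly over p
  blocks. Doubling F changes the first scalar by ln 2 / 2, and \<Omega>~ multiplies this by ln p /
  2; that is the product in the increment of \<phi>. On the homological side every correction is of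
  one of two kinds, both of which preserve quasi-additivity: linear lifts, which exist because
  \<open>l2_fin\<close> has an algebraic basis, and bounded lifts, which come from the open mapping
  theorem. A recurrent obstacle is that a quasinorm need not be continuous and that its triangle
  constant compounds under iteration, so passing to a limit costs an additional factor.\<close>

lemma scalar_ring_simps [simp]:
  "carrier (scalar_ring :: 'k::field ring) = UNIV"
  "x \<otimes>\<^bsub>scalar_ring\<^esub> y = x * y" "\<one>\<^bsub>scalar_ring\<^esub> = (1::'k)"
  "\<zero>\<^bsub>scalar_ring\<^esub> = (0::'k)" "x \<oplus>\<^bsub>scalar_ring\<^esub> y = x + y"
  by (simp_all add: scalar_ring_def)

lemma cring_scalar_ring: "cring (scalar_ring :: 'k::field ring)"
proof (rule cringI)
  show "abelian_group (scalar_ring :: 'k ring)"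
  proof (rule abelian_groupI)
    show "\<exists>y\<in>carrier scalar_ring. y \<oplus>\<^bsub>scalar_ring\<^esub> x = \<zero>\<^bsub>scalar_ring\<^esub>" for x :: 'k
      by (rule bexI[of _ "- x"]) auto
  qed (auto simp: algebra_simps)
  show "comm_monoid (scalar_ring :: 'k ring)"
    by (rule comm_monoidI) (auto simp: algebra_simps)
qed (auto simp: algebra_simps)

text \<open>Additive inverses come from the scalar -1, which is why
  \<open>0 \<odot> x = \<zero>\<close> stands among the premises in place of an inverse law.\<close>

lemma module_scalarI:
  fixes V :: "('k::field, 'a, 'm) module_scheme" (structure)
  assumes "\<zero> \<in> carrier V"
    and "\<And>x y. x \<in> carrier V \<Longrightarrow> y \<in> carrier V \<Longrightarrow> x \<oplus> y \<in> carrier V"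
    and smult: "\<And>c x. x \<in> carrier V \<Longrightarrow> c \<odot> x \<in> carrier V"
    and "\<And>x y z. x \<in> carrier V \<Longrightarrow> y \<in> carrier V \<Longrightarrow> z \<in> carrier V \<Longrightarrow> (x \<oplus> y) \<oplus> z = x \<oplus> (y \<oplus> z)"
    and "\<And>x y. x \<in> carrier V \<Longrightarrow> y \<in> carrier V \<Longrightarrow> x \<oplus> y = y \<oplus> x"
    and "\<And>x. x \<in> carrier V \<Longrightarrow> \<zero> \<oplus> x = x"
    and dist: "\<And>c d x. x \<in> carrier V \<Longrightarrow> (c + d) \<odot> x = c \<odot> x \<oplus> d \<odot> x"
    and "\<And>c x y. x \<in> carrier V \<Longrightarrow> y \<in> carrier V \<Longrightarrow> c \<odot> (x \<oplus> y) = c \<odot> x \<oplus> c \<odot> y"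
    and "\<And>c d x. x \<in> carrier V \<Longrightarrow> (c * d) \<odot> x = c \<odot> (d \<odot> x)"
    and one: "\<And>x. x \<in> carrier V \<Longrightarrow> 1 \<odot> x = x"
    and zero: "\<And>x. x \<in> carrier V \<Longrightarrow> 0 \<odot> x = \<zero>"
  shows "Module.module (scalar_ring :: 'k ring) V"
proof (rule moduleI[OF cring_scalar_ring])
  show "abelian_group V"
  proof (rule abelian_groupI)
    fix x assume x: "x \<in> carrier V"
    have "(- 1) \<odot> x \<oplus> x = (- 1 + 1) \<odot> x" using x dist[of x "- 1" 1] by (simp add: one)
    then show "\<exists>y\<in>carrier V. y \<oplus> x = \<zero>" using x smult zero by auto
  qed (use assms in auto)
qed (use assms in auto)

section \<open>Quasinormed spaces: algebra, limits and geometric series\<close>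

locale qnormed =
  fixes V :: "('k::real_normed_field, 'a) qspace" (structure)
  assumes quasinormed: "quasinormed_space V"
begin

lemma scalar_module: "Module.module (scalar_ring :: 'k ring) V"
  using quasinormed by (simp add: quasinormed_space_def)

sublocale abelian_group V
  using scalar_module by (rule Module.module.axioms)

lemma smult_closed [simp, intro]: "x \<in> carrier V \<Longrightarrow> c \<odot> x \<in> carrier V"
  using Module.module.smult_closed[OF scalar_module] by simp

lemma smult_add_left: "x \<in> carrier V \<Longrightarrow> (c + d) \<odot> x = c \<odot> x \<oplus> d \<odot> x"
  using Module.module.smult_l_distr[OF scalar_module] by simp

lemma smult_add_right:
  "x \<in> carrier V \<Longrightarrow> y \<in> carrier V \<Longrightarrow> c \<odot> (x \<oplus> y) = c \<odot> x \<oplus> c \<odot> y"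
  using Module.module.smult_r_distr[OF scalar_module] by simp

lemma smult_smult: "x \<in> carrier V \<Longrightarrow> c \<odot> (d \<odot> x) = (c * d) \<odot> x"
  using Module.module.smult_assoc1[OF scalar_module] by simp

lemma smult_1 [simp]: "x \<in> carrier V \<Longrightarrow> 1 \<odot> x = x"
  using Module.module.smult_one[OF scalar_module] by simp

lemma smult_0 [simp]: "x \<in> carrier V \<Longrightarrow> 0 \<odot> x = \<zero>"
  using Module.module.smult_l_null[OF scalar_module] by simp

lemma smult_zero [simp]: "c \<odot> \<zero> = \<zero>"
  using Module.module.smult_r_null[OF scalar_module] by simp

lemma smult_uminus: "x \<in> carrier V \<Longrightarrow> c \<odot> (\<ominus> x) = \<ominus> (c \<odot> x)"
  using Module.module.smult_r_minus[OF scalar_module] by simp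

lemma uminus_eq_smult: "x \<in> carrier V \<Longrightarrow> \<ominus> x = (- 1) \<odot> x"
  using smult_add_left[of x "- 1" 1] by (simp add: minus_equality)

lemma smult_minus_right:
  "x \<in> carrier V \<Longrightarrow> y \<in> carrier V \<Longrightarrow> c \<odot> (x \<ominus> y) = c \<odot> x \<ominus> c \<odot> y"
  by (simp add: a_minus_def smult_add_right smult_uminus)

lemma minus_telescope:
  "x \<in> carrier V \<Longrightarrow> y \<in> carrier V \<Longrightarrow> z \<in> carrier V \<Longrightarrow> (x \<ominus> y) \<oplus> (y \<ominus> z) = x \<ominus> z"
  by (simp add: a_minus_def a_assoc r_neg1)

lemma add_minus_cancel:
  "x \<in> carrier V \<Longrightarrow> y \<in> carrier V \<Longrightarrow> x \<oplus> (y \<ominus> x) = y"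
  by (simp add: a_minus_def a_comm[of y] r_neg2)

lemma minus_add_cancel:
  "x \<in> carrier V \<Longrightarrow> y \<in> carrier V \<Longrightarrow> (x \<ominus> y) \<oplus> y = x"
  by (simp add: a_minus_def a_assoc l_neg)

lemma add_minus_add:
  "a \<in> carrier V \<Longrightarrow> b \<in> carrier V \<Longrightarrow> c \<in> carrier V \<Longrightarrow> d \<in> carrier V \<Longrightarrow>
   (a \<oplus> b) \<ominus> (c \<oplus> d) = (a \<ominus> c) \<oplus> (b \<ominus> d)"
  by (simp add: a_minus_def a_ac minus_add)

lemma minus_minus_minus:
  "a \<in> carrier V \<Longrightarrow> b \<in> carrier V \<Longrightarrow> c \<in> carrier V \<Longrightarrow> d \<in> carrier V \<Longrightarrow>
   (a \<ominus> b) \<ominus> (c \<ominus> d) = (a \<ominus> c) \<ominus> (b \<ominus> d)"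
  by (simp add: a_minus_def a_ac minus_add)

lemma add_minus_cancel_left:
  "x \<in> carrier V \<Longrightarrow> y \<in> carrier V \<Longrightarrow> (x \<oplus> y) \<ominus> x = y"
  by (simp add: a_minus_def a_comm[of x] a_assoc r_neg)

lemma uminus_minus: "x \<in> carrier V \<Longrightarrow> y \<in> carrier V \<Longrightarrow> \<ominus> (x \<ominus> y) = y \<ominus> x"
  by (simp add: a_minus_def a_ac minus_add)

lemma minus_self [simp]: "x \<in> carrier V \<Longrightarrow> x \<ominus> x = \<zero>"
  by (simp add: a_minus_def r_neg)

lemma minus_zero [simp]: "x \<in> carrier V \<Longrightarrow> x \<ominus> \<zero> = x"
  by (simp add: a_minus_def)

lemma minus_eq_zeroD: "x \<ominus> y = \<zero> \<Longrightarrow> x \<in> carrier V \<Longrightarrow> y \<in> carrier V \<Longrightarrow> x = y"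
  by (metis add_minus_cancel r_zero)

lemma qnorm_nonneg [simp]: "x \<in> carrier V \<Longrightarrow> 0 \<le> qnorm V x"
  using quasinormed by (simp add: quasinormed_space_def)

lemma qnorm_smult [simp]: "x \<in> carrier V \<Longrightarrow> qnorm V (c \<odot> x) = norm c * qnorm V x"
  using quasinormed by (simp add: quasinormed_space_def)

lemma qnorm_eq_0_iff: "x \<in> carrier V \<Longrightarrow> qnorm V x = 0 \<longleftrightarrow> x = \<zero>"
  using quasinormed by (simp add: quasinormed_space_def)

lemma qnorm_zero [simp]: "qnorm V \<zero> = 0"
  by (simp add: qnorm_eq_0_iff)

lemma qnorm_uminus [simp]: "x \<in> carrier V \<Longrightarrow> qnorm V (\<ominus> x) = qnorm V x"
  by (simp add: uminus_eq_smult)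

lemma qnorm_minus_commute:
  "x \<in> carrier V \<Longrightarrow> y \<in> carrier V \<Longrightarrow> qnorm V (x \<ominus> y) = qnorm V (y \<ominus> x)"
  by (metis minus_closed qnorm_uminus uminus_minus)

text \<open>A constant for the quasi-triangle inequality, fixed once so that later bounds can name
  it. Being at least 1, it keeps the ratio \<open>1 / (2 * qmod)\<close> at most 1/2.\<close>

definition qmod :: real where
  "qmod = (SOME C. 1 \<le> C \<and> (\<forall>x\<in>carrier V. \<forall>y\<in>carrier V.
        qnorm V (x \<oplus> y) \<le> C * (qnorm V x + qnorm V y)))"

lemma qmod: "1 \<le> qmod \<and> (\<forall>x\<in>carrier V. \<forall>y\<in>carrier V.
        qnorm V (x \<oplus> y) \<le> qmod * (qnorm V x + qnorm V y))"
proof -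
  obtain C where C: "\<And>x y. x\<in>carrier V \<Longrightarrow> y\<in>carrier V \<Longrightarrow>
      qnorm V (x \<oplus> y) \<le> C * (qnorm V x + qnorm V y)"
    using quasinormed unfolding quasinormed_space_def by blast
  have "qnorm V (x \<oplus> y) \<le> max 1 C * (qnorm V x + qnorm V y)"
    if "x\<in>carrier V" "y\<in>carrier V" for x y
    by (rule order_trans[OF C[OF that]], rule mult_right_mono) (use that in auto)
  then have "\<exists>C\<ge>1. \<forall>x\<in>carrier V. \<forall>y\<in>carrier V.
        qnorm V (x \<oplus> y) \<le> C * (qnorm V x + qnorm V y)"
    by (intro exI[of _ "max 1 C"]) simp
  from someI_ex[OF this] show ?thesis unfolding qmod_def .
qed

lemma qmod_ge_1: "1 \<le> qmod" and qmod_pos [simp]: "0 < qmod"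
  using qmod by auto

lemma qnorm_triangle:
  "x \<in> carrier V \<Longrightarrow> y \<in> carrier V \<Longrightarrow> qnorm V (x \<oplus> y) \<le> qmod * (qnorm V x + qnorm V y)"
  using qmod by blast

lemma qnorm_triangle_le:
  "x \<in> carrier V \<Longrightarrow> y \<in> carrier V \<Longrightarrow> qnorm V x \<le> a \<Longrightarrow> qnorm V y \<le> b \<Longrightarrow>
   qnorm V (x \<oplus> y) \<le> qmod * (a + b)"
  by (rule order_trans[OF qnorm_triangle]) (auto intro: mult_left_mono simp: less_imp_le)

lemma qnorm_minus_le:
  "x \<in> carrier V \<Longrightarrow> y \<in> carrier V \<Longrightarrow> qnorm V x \<le> a \<Longrightarrow> qnorm V y \<le> b \<Longrightarrow>
   qnorm V (x \<ominus> y) \<le> qmod * (a + b)"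
  unfolding a_minus_def by (rule qnorm_triangle_le) auto

lemma qnorm_via:
  "x \<in> carrier V \<Longrightarrow> y \<in> carrier V \<Longrightarrow> z \<in> carrier V \<Longrightarrow>
   qnorm V (x \<ominus> y) \<le> a \<Longrightarrow> qnorm V (y \<ominus> z) \<le> b \<Longrightarrow> qnorm V (x \<ominus> z) \<le> qmod * (a + b)"
  using qnorm_triangle_le[of "x \<ominus> y" "y \<ominus> z" a b] by (simp add: minus_telescope)

text \<open>The substitute for continuity of the norm: a bound on the terms passes to the limit at
  the price of one factor \<open>qmod\<close>.\<close>

lemma qconverges_bound:
  assumes "qconverges V s x" "\<And>n. s n \<in> carrier V" "x \<in> carrier V" "y \<in> carrier V"
    and "eventually (\<lambda>n. qnorm V (s n \<ominus> y) \<le> r) sequentially"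
  shows "qnorm V (x \<ominus> y) \<le> qmod * r"
proof (rule tendsto_lowerbound)
  show "((\<lambda>n. qmod * (qnorm V (s n \<ominus> x) + r)) \<longlongrightarrow> qmod * r) sequentially"
    using assms(1) unfolding qconverges_def by (auto intro!: tendsto_eq_intros)
  show "\<forall>\<^sub>F n in sequentially. qnorm V (x \<ominus> y) \<le> qmod * (qnorm V (s n \<ominus> x) + r)"
    using assms(5)
  proof eventually_elim
    case (elim n)
    show ?case by (rule qnorm_via[of x "s n"]) (use elim assms in \<open>auto simp: qnorm_minus_commute\<close>)
  qed
qed simp

lemma qconverges_unique:
  assumes "qconverges V s x" "qconverges V s y" "\<And>n. s n \<in> carrier V" "x \<in> carrier V" "y \<in> carrier V"
  shows "x = y"
proof -
  have "qnorm V (x \<ominus> y) \<le> e" if "e > 0" for e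
  proof -
    have "eventually (\<lambda>n. qnorm V (s n \<ominus> y) < e / qmod) sequentially"
      by (rule order_tendstoD(2)[OF assms(2)[unfolded qconverges_def]]) (simp add: that)
    then have "eventually (\<lambda>n. qnorm V (s n \<ominus> y) \<le> e / qmod) sequentially"
      by eventually_elim auto
    from qconverges_bound[OF assms(1,3,4,5) this] show ?thesis
      by (simp add: less_imp_neq[OF qmod_pos, symmetric])
  qed
  then have "qnorm V (x \<ominus> y) \<le> 0" by (rule field_le_epsilon) simp
  then show ?thesis
    by (metis assms(4,5) minus_closed minus_eq_zeroD order_antisym qnorm_eq_0_iff qnorm_nonneg)
qed

lemma qconverges_add:
  assumes "qconverges V s x" "qconverges V t y" "\<And>n. s n \<in> carrier V" "\<And>n. t n \<in> carrier V"
    "x \<in> carrier V" "y \<in> carrier V"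
  shows "qconverges V (\<lambda>n. s n \<oplus> t n) (x \<oplus> y)"
  unfolding qconverges_def
proof (rule tendsto_sandwich[of "\<lambda>_. 0"])
  show "(\<lambda>n. qmod * (qnorm V (s n \<ominus> x) + qnorm V (t n \<ominus> y))) \<longlonglongrightarrow> 0"
    using assms(1,2) unfolding qconverges_def by (auto intro!: tendsto_eq_intros)
qed (use assms in \<open>auto simp: add_minus_add intro!: qnorm_triangle eventuallyI\<close>)

lemma qconverges_smult:
  assumes "qconverges V s x" "\<And>n. s n \<in> carrier V" "x \<in> carrier V"
  shows "qconverges V (\<lambda>n. c \<odot> s n) (c \<odot> x)"
  using assms unfolding qconverges_def
  by (auto simp flip: smult_minus_right intro!: tendsto_eq_intros)

text \<open>Summed naively, p increments would cost \<open>qmod ^ p\<close>. Splitting off the first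
  increment, the induction bound for the rest carries one more factor \<open>1 / (2 * qmod)\<close>;
  the two summands become equal, and the constant does not grow with p.\<close>

lemma geometric_tail:
  assumes "\<And>n. s n \<in> carrier V" "\<And>n. qnorm V (s (Suc n) \<ominus> s n) \<le> c * (1 / (2 * qmod)) ^ n" "0 \<le> c"
  shows "qnorm V (s (m + p) \<ominus> s m) \<le> 2 * qmod * c * (1 / (2 * qmod)) ^ m"
proof (induction p arbitrary: m)
  case 0
  then show ?case using assms by (simp add: less_imp_le)
next
  case (Suc p)
  have "qnorm V (s (m + Suc p) \<ominus> s m) \<le>
     qmod * (2 * qmod * c * (1 / (2 * qmod)) ^ Suc m + c * (1 / (2 * qmod)) ^ m)"
    by (rule qnorm_via[of _ "s (Suc m)"]) (use assms Suc[of "Suc m"] in auto)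
  also have "\<dots> = 2 * qmod * c * (1 / (2 * qmod)) ^ m"
    using qmod_pos by (simp add: field_simps del: qmod_pos)
  finally show ?case .
qed

lemma geometric_qCauchy:
  assumes "\<And>n. s n \<in> carrier V" "\<And>n. qnorm V (s (Suc n) \<ominus> s n) \<le> c * (1 / (2 * qmod)) ^ n" "0 \<le> c"
  shows "s \<in> qCauchy V"
  unfolding qCauchy_def
proof (safe intro!: assms)
  fix e :: real assume e: "e > 0"
  have "(\<lambda>n. 2 * qmod * c * (1 / (2 * qmod)) ^ n) \<longlonglongrightarrow> 2 * qmod * c * 0"
    using qmod_ge_1 by (intro tendsto_intros LIMSEQ_power_zero) auto
  then have "eventually (\<lambda>n. 2 * qmod * c * (1 / (2 * qmod)) ^ n < e) sequentially"
    using e by (auto elim: order_tendstoD(2))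
  then obtain N where N: "\<And>n. n \<ge> N \<Longrightarrow> 2 * qmod * c * (1 / (2 * qmod)) ^ n < e"
    by (auto simp: eventually_sequentially)
  have *: "qnorm V (s n \<ominus> s m) < e" if "m \<ge> N" "n \<ge> m" for m n
    using geometric_tail[OF assms, of m "n - m"] N[OF that(1)] that by simp
  have "qnorm V (s m \<ominus> s n) < e" if "m \<ge> N" "n \<ge> N" for m n
    using *[of m n] *[of n m] that qnorm_minus_commute[of "s m" "s n"] assms(1)
    by (cases "m \<le> n") auto
  then show "\<exists>N. \<forall>m\<ge>N. \<forall>n\<ge>N. qnorm V (s m \<ominus> s n) < e" by blast
qed

end

locale qbanach = qnormed +
  assumes complete: "s \<in> qCauchy V \<Longrightarrow> \<exists>x\<in>carrier V. qconverges V s x"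

lemma quasi_banach_iff_qbanach: "quasi_banach V \<longleftrightarrow> qbanach V"
  by (auto simp: quasi_banach_def qbanach_def qbanach_axioms_def qnormed_def)

lemma quasi_banachD: "quasi_banach V \<Longrightarrow> qbanach V"
  by (simp add: quasi_banach_iff_qbanach)

lemma (in qbanach) geometric_limit:
  assumes "\<And>n. s n \<in> carrier V" "\<And>n. qnorm V (s (Suc n) \<ominus> s n) \<le> c * (1 / (2 * qmod)) ^ n" "0 \<le> c"
  obtains x where "x \<in> carrier V" "qconverges V s x"
    "\<And>m. qnorm V (x \<ominus> s m) \<le> qmod * (2 * qmod * c * (1 / (2 * qmod)) ^ m)"
proof -
  obtain x where x: "x \<in> carrier V" "qconverges V s x"
    using complete geometric_qCauchy[OF assms] by blast
  have "qnorm V (x \<ominus> s m) \<le> qmod * (2 * qmod * c * (1 / (2 * qmod)) ^ m)" for m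
  proof (rule qconverges_bound[OF x(2)])
    show "\<forall>\<^sub>F n in sequentially. qnorm V (s n \<ominus> s m) \<le> 2 * qmod * c * (1 / (2 * qmod)) ^ m"
      using eventually_ge_at_top[of m]
    proof eventually_elim
      case (elim n)
      then show ?case using geometric_tail[OF assms, of m "n - m"] by simp
    qed
  qed (use assms x in auto)
  then show ?thesis using that x by blast
qed

section \<open>Bounded operators\<close>

locale qoperator = V: qnormed V + W: qnormed W
  for V :: "('k::real_normed_field, 'a) qspace" and W :: "('k, 'b) qspace" +
  fixes T assumes operator: "operator V W T"
begin

lemma closed [simp, intro]: "x \<in> carrier V \<Longrightarrow> T x \<in> carrier W"
  using operator by (auto simp: operator_def)

lemma add: "x \<in> carrier V \<Longrightarrow> y \<in> carrier V \<Longrightarrow> T (x \<oplus>\<^bsub>V\<^esub> y) = T x \<oplus>\<^bsub>W\<^esub> T y"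
  using operator by (auto simp: operator_def)

lemma smult: "x \<in> carrier V \<Longrightarrow> T (c \<odot>\<^bsub>V\<^esub> x) = c \<odot>\<^bsub>W\<^esub> T x"
  using operator by (auto simp: operator_def)

lemma zero [simp]: "T \<zero>\<^bsub>V\<^esub> = \<zero>\<^bsub>W\<^esub>"
  using smult[of "\<zero>\<^bsub>V\<^esub>" 0] by simp

lemma uminus: "x \<in> carrier V \<Longrightarrow> T (\<ominus>\<^bsub>V\<^esub> x) = \<ominus>\<^bsub>W\<^esub> T x"
  by (simp add: V.uminus_eq_smult W.uminus_eq_smult smult)

lemma minus: "x \<in> carrier V \<Longrightarrow> y \<in> carrier V \<Longrightarrow> T (x \<ominus>\<^bsub>V\<^esub> y) = T x \<ominus>\<^bsub>W\<^esub> T y"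
  by (simp add: a_minus_def add uminus)

lemma bounded:
  obtains C where "0 < C" "\<And>x. x \<in> carrier V \<Longrightarrow> qnorm W (T x) \<le> C * qnorm V x"
proof -
  obtain C where C: "\<And>x. x \<in> carrier V \<Longrightarrow> qnorm W (T x) \<le> C * qnorm V x"
    using operator unfolding operator_def by blast
  have "qnorm W (T x) \<le> max 1 C * qnorm V x" if "x \<in> carrier V" for x
    by (rule order_trans[OF C[OF that]], rule mult_right_mono) (use that in auto)
  then show ?thesis using that[of "max 1 C"] by auto
qed

lemma qconverges:
  assumes "qconverges V s x" "\<And>n. s n \<in> carrier V" "x \<in> carrier V"
  shows "qconverges W (\<lambda>n. T (s n)) (T x)"
proof -
  obtain C where C: "0 < C" "\<And>x. x \<in> carrier V \<Longrightarrow> qnorm W (T x) \<le> C * qnorm V x"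
    using bounded by metis
  show ?thesis unfolding qconverges_def
  proof (rule tendsto_sandwich[of "\<lambda>_. 0"])
    show "(\<lambda>n. C * qnorm V (s n \<ominus>\<^bsub>V\<^esub> x)) \<longlonglongrightarrow> 0"
      using assms(1) unfolding qconverges_def by (auto intro!: tendsto_eq_intros)
  qed (use assms C in \<open>auto simp flip: minus intro!: eventuallyI\<close>)
qed

end

section \<open>Closed images and the open mapping theorem\<close>

definition qclosed :: "('k, 'a) qspace \<Rightarrow> 'a set \<Rightarrow> bool" where
  "qclosed V R \<longleftrightarrow> (\<forall>s x. (\<forall>n. s n \<in> R) \<longrightarrow> x \<in> carrier V \<longrightarrow> qconverges V s x \<longrightarrow> x \<in> R)"

text \<open>The source of closed range: exactness makes the image of each of the first two arrows of
  a four-term sequence a kernel.\<close>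

lemma (in qoperator) qclosed_op_kernel: "qclosed V (op_kernel V W T)"
  unfolding qclosed_def
proof (intro allI impI)
  fix s x assume *: "\<forall>n. s n \<in> op_kernel V W T" "x \<in> carrier V" "qconverges V s x"
  have "qconverges W (\<lambda>n. T (s n)) (T x)"
    by (rule qconverges) (use * in \<open>auto simp: op_kernel_def\<close>)
  moreover have "qconverges W (\<lambda>n. T (s n)) \<zero>\<^bsub>W\<^esub>"
    using * by (simp add: op_kernel_def qconverges_def)
  ultimately have "T x = \<zero>\<^bsub>W\<^esub>"
    by (rule W.qconverges_unique) (use * in \<open>auto simp: op_kernel_def\<close>)
  then show "x \<in> op_kernel V W T" using * by (simp add: op_kernel_def)
qed

text \<open>
  Both halves of the open mapping theorem are proved with sequences whose increments decrease
  geometrically with ratio \<open>1 / (2 * qmod)\<close>, which absorbs the constant in the quasi-triangle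
  inequality; so no equivalent metric is needed.
\<close>

lemma baire_image:
  fixes V :: "('k::real_normed_field, 'a) qspace" and W :: "('k, 'b) qspace"
  assumes "qnormed V" "qbanach W" "qoperator V W T" and cl: "qclosed W (T ` carrier V)"
  shows "\<exists>k w r. w \<in> T ` carrier V \<and> 0 < r \<and>
    (\<forall>w'\<in>T ` carrier V. qnorm W (w' \<ominus>\<^bsub>W\<^esub> w) < r \<longrightarrow>
      (\<forall>e>0. \<exists>v\<in>carrier V. qnorm V v \<le> real k \<and> qnorm W (T v \<ominus>\<^bsub>W\<^esub> w') < e))"
proof (rule ccontr)
  interpret V: qnormed V by fact
  interpret W: qbanach W by fact
  interpret qoperator V W T by fact
  assume "\<not> ?thesis"
  then have neg: "\<exists>w'\<in>T ` carrier V. qnorm W (w' \<ominus>\<^bsub>W\<^esub> w) < r \<and>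
      (\<exists>e>0. \<forall>v\<in>carrier V. qnorm V v \<le> real k \<longrightarrow> e \<le> qnorm W (T v \<ominus>\<^bsub>W\<^esub> w'))"
    if "w \<in> T ` carrier V" "0 < r" for k w r
    using that by (force simp: not_less)
  define q where "q = 1 / (2 * W.qmod)"
  have q: "0 < q" "q \<le> 1" using W.qmod_ge_1 by (auto simp: q_def field_simps)
  \<comment> \<open>Baire's argument by nested balls with centre \<open>fst (f n)\<close> and radius
    \<open>snd (f n)\<close>, where ball n+1 avoids the images of all vectors of norm at most n. The
    divisor \<open>4 * W.qmod * W.qmod\<close> keeps the limit within half a radius of each centre,
    since \<open>geometric_limit\<close> loses the factor \<open>2 * qmod * qmod\<close>.\<close>
  have "\<exists>f. \<forall>n. (fst (f n) \<in> T ` carrier V \<and> 0 < snd (f n)) \<and>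
     (qnorm W (fst (f (Suc n)) \<ominus>\<^bsub>W\<^esub> fst (f n)) \<le> snd (f n) / (4 * W.qmod * W.qmod) \<and>
      snd (f (Suc n)) \<le> q * snd (f n) \<and>
      (\<forall>v\<in>carrier V. qnorm V v \<le> real n \<longrightarrow> snd (f (Suc n)) \<le> qnorm W (T v \<ominus>\<^bsub>W\<^esub> fst (f (Suc n)))))"
  proof (rule dependent_nat_choice)
    show "\<exists>x. fst x \<in> T ` carrier V \<and> (0::real) < snd x"
      by (rule exI[of _ "(T \<zero>\<^bsub>V\<^esub>, 1)"]) (auto simp del: zero)
  next
    fix x :: "'b \<times> real" and n :: nat
    obtain w r where x: "x = (w, r)" by force
    assume "fst x \<in> T ` carrier V \<and> 0 < snd x"
    then have *: "w \<in> T ` carrier V" "0 < r" by (auto simp: x)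
    from neg[OF *(1), of "r / (4 * W.qmod * W.qmod)" n] *(2) obtain w' e where
      "w' \<in> T ` carrier V" "qnorm W (w' \<ominus>\<^bsub>W\<^esub> w) < r / (4 * W.qmod * W.qmod)" "0 < e"
      "\<forall>v\<in>carrier V. qnorm V v \<le> real n \<longrightarrow> e \<le> qnorm W (T v \<ominus>\<^bsub>W\<^esub> w')"
      by auto
    then show "\<exists>y. (fst y \<in> T ` carrier V \<and> 0 < snd y) \<and>
      qnorm W (fst y \<ominus>\<^bsub>W\<^esub> fst x) \<le> snd x / (4 * W.qmod * W.qmod) \<and> snd y \<le> q * snd x \<and>
      (\<forall>v\<in>carrier V. qnorm V v \<le> real n \<longrightarrow> snd y \<le> qnorm W (T v \<ominus>\<^bsub>W\<^esub> fst y))"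
      using * q by (intro exI[of _ "(w', min e (q * r))"]) (auto simp: x)
  qed
  then obtain f where f: "\<And>n. fst (f n) \<in> T ` carrier V" "\<And>n. 0 < snd (f n)"
     "\<And>n. qnorm W (fst (f (Suc n)) \<ominus>\<^bsub>W\<^esub> fst (f n)) \<le> snd (f n) / (4 * W.qmod * W.qmod)"
     "\<And>n. snd (f (Suc n)) \<le> q * snd (f n)"
     "\<And>n v. v\<in>carrier V \<Longrightarrow> qnorm V v \<le> real n \<Longrightarrow> snd (f (Suc n)) \<le> qnorm W (T v \<ominus>\<^bsub>W\<^esub> fst (f (Suc n)))"
    by metis
  have fc: "fst (f n) \<in> carrier W" for n using f(1)[of n] by auto
  have geo: "snd (f (k + j)) \<le> q ^ j * snd (f k)" for j k
  proof (induction j)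
    case (Suc j)
    have "snd (f (k + Suc j)) \<le> q * snd (f (k + j))" using f(4) by simp
    also have "\<dots> \<le> q * (q ^ j * snd (f k))" using Suc q by (intro mult_left_mono) auto
    finally show ?case by (simp add: mult.assoc)
  qed simp
  have step: "qnorm W (fst (f (k + Suc j)) \<ominus>\<^bsub>W\<^esub> fst (f (k + j))) \<le>
      (snd (f k) / (4 * W.qmod * W.qmod)) * (1 / (2 * W.qmod)) ^ j" for j k
  proof -
    have "qnorm W (fst (f (k + Suc j)) \<ominus>\<^bsub>W\<^esub> fst (f (k + j))) \<le> snd (f (k + j)) / (4 * W.qmod * W.qmod)"
      using f(3) by simp
    also have "\<dots> \<le> (q ^ j * snd (f k)) / (4 * W.qmod * W.qmod)"
      using geo by (intro divide_right_mono) (auto simp: less_imp_le)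
    finally show ?thesis by (simp add: q_def mult.commute)
  qed
  have pos: "0 \<le> snd (f k) / (4 * W.qmod * W.qmod)" for k using f(2)[of k] by simp
  obtain w where w: "w \<in> carrier W" "qconverges W (\<lambda>n. fst (f n)) w"
    using W.geometric_limit[of "\<lambda>n. fst (f n)", OF fc step[of 0, unfolded add_0] pos[of 0]] by blast
  \<comment> \<open>Completeness gives a limit in W only; closedness returns it to the image, so it
    has a preimage, of norm at most some n, which contradicts the choice of ball n+1.\<close>
  have "w \<in> T ` carrier V" using cl[unfolded qclosed_def, rule_format, of "\<lambda>n. fst (f n)" w] f(1) w by blast
  then obtain v where v: "v \<in> carrier V" "w = T v" by auto
  obtain n where n: "qnorm V v \<le> real n" using real_arch_simple by blast
  have "qnorm W (w \<ominus>\<^bsub>W\<^esub> fst (f (Suc n))) \<le> snd (f (Suc n)) / 2"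
  proof -
    obtain w' where w': "w' \<in> carrier W" "qconverges W (\<lambda>j. fst (f (Suc n + j))) w'"
      "\<And>m. qnorm W (w' \<ominus>\<^bsub>W\<^esub> fst (f (Suc n + m))) \<le> W.qmod * (2 * W.qmod *
         (snd (f (Suc n)) / (4 * W.qmod * W.qmod)) * (1 / (2 * W.qmod)) ^ m)"
      using W.geometric_limit[of "\<lambda>j. fst (f (Suc n + j))", OF fc step[of "Suc n"] pos[of "Suc n"]] by blast
    have "qconverges W (\<lambda>j. fst (f (Suc n + j))) w"
      using w(2) LIMSEQ_ignore_initial_segment[of "\<lambda>j. qnorm W (fst (f j) \<ominus>\<^bsub>W\<^esub> w)" 0 "Suc n"]
      unfolding qconverges_def by (simp add: add.commute)
    then have "w' = w" using W.qconverges_unique w'(1,2) w(1) fc by blast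
    then show ?thesis using w'(3)[of 0] W.qmod_pos by (simp add: field_simps del: W.qmod_pos)
  qed
  with f(5)[OF v(1) n] f(2)[of "Suc n"] show False by (simp add: v(2))
qed

text \<open>Moves the ball of \<open>baire_image\<close> to the origin: w and a translate of w by a
  small multiple of u are both approximated by images of vectors of norm at most k, so the
  difference of the two preimages serves for that multiple. Homogeneity then rescales to u.\<close>

lemma almost_open:
  fixes V :: "('k::real_normed_field, 'a) qspace" and W :: "('k, 'b) qspace"
  assumes "qnormed V" "qbanach W" "qoperator V W T" and cl: "qclosed W (T ` carrier V)"
  shows "\<exists>C>0. \<forall>u\<in>T ` carrier V. \<forall>e>0. \<exists>v\<in>carrier V.
    qnorm V v \<le> C * qnorm W u \<and> qnorm W (u \<ominus>\<^bsub>W\<^esub> T v) \<le> e * qnorm W u"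
proof -
  interpret V: qnormed V by fact
  interpret W: qbanach W by fact
  interpret qoperator V W T by fact
  obtain k w r where w: "w \<in> T ` carrier V" and r: "0 < r" and
    wr: "\<And>w' e. w'\<in>T ` carrier V \<Longrightarrow> qnorm W (w' \<ominus>\<^bsub>W\<^esub> w) < r \<Longrightarrow> 0 < e \<Longrightarrow>
       \<exists>v\<in>carrier V. qnorm V v \<le> real k \<and> qnorm W (T v \<ominus>\<^bsub>W\<^esub> w') < e"
    using baire_image[OF assms] by blast
  define c where "c = r / 2"
  have c: "c > 0" "c < r" using r by (auto simp: c_def)
  \<comment> \<open>The summand 1 only keeps C positive when k = 0.\<close>
  define C where "C = V.qmod * (real k + real k) / c + 1"
  have C: "C > 0" unfolding C_def using c by (intro add_nonneg_pos divide_nonneg_pos) (auto simp: less_imp_le)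
  have "\<exists>v\<in>carrier V. qnorm V v \<le> C * qnorm W u \<and> qnorm W (u \<ominus>\<^bsub>W\<^esub> T v) \<le> e * qnorm W u"
    if u: "u \<in> T ` carrier V" and e: "e > 0" for u e
  proof (cases "u = \<zero>\<^bsub>W\<^esub>")
    case True
    then show ?thesis by (intro bexI[of _ "\<zero>\<^bsub>V\<^esub>"]) auto
  next
    case False
    have uc: "u \<in> carrier W" "w \<in> carrier W" using u w by auto
    define a where "a = qnorm W u"
    have a: "a > 0" using False uc unfolding a_def by (metis W.qnorm_eq_0_iff W.qnorm_nonneg less_le)
    define t :: 'k where "t = of_real (c / a)"
    have t: "norm t = c / a" "t \<noteq> 0" unfolding t_def norm_of_real using a c by auto
    define u' where "u' = t \<odot>\<^bsub>W\<^esub> u"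
    have u'c: "u' \<in> carrier W" using uc by (simp add: u'_def)
    have u'n: "qnorm W u' = c" using a t uc by (simp add: u'_def a_def)
    have u'im: "w \<oplus>\<^bsub>W\<^esub> u' \<in> T ` carrier V"
    proof -
      obtain v1 v2 where "v1 \<in> carrier V" "v2 \<in> carrier V" "w = T v1" "u = T v2" using u w by auto
      then have "w \<oplus>\<^bsub>W\<^esub> u' = T (v1 \<oplus>\<^bsub>V\<^esub> t \<odot>\<^bsub>V\<^esub> v2)" by (simp add: u'_def add smult)
      then show ?thesis using \<open>v1 \<in> carrier V\<close> \<open>v2 \<in> carrier V\<close> by auto
    qed
    have d: "(w \<oplus>\<^bsub>W\<^esub> u') \<ominus>\<^bsub>W\<^esub> w = u'"
      using uc u'c by (intro W.add_minus_cancel_left)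
    \<comment> \<open>Two errors e' are combined at the cost of \<open>W.qmod\<close> and then
      rescaled by a / c; this leaves exactly e * a.\<close>
    define e' where "e' = e * c / (2 * W.qmod)"
    have e': "e' > 0" using e c by (simp add: e'_def)
    obtain v1 where v1: "v1 \<in> carrier V" "qnorm V v1 \<le> real k" "qnorm W (T v1 \<ominus>\<^bsub>W\<^esub> (w \<oplus>\<^bsub>W\<^esub> u')) < e'"
      using wr[OF u'im _ e'] d u'n c by auto
    obtain v2 where v2: "v2 \<in> carrier V" "qnorm V v2 \<le> real k" "qnorm W (T v2 \<ominus>\<^bsub>W\<^esub> w) < e'"
      using wr[OF w _ e'] uc r by auto
    define v where "v = inverse t \<odot>\<^bsub>V\<^esub> (v1 \<ominus>\<^bsub>V\<^esub> v2)"
    have vc: "v \<in> carrier V" using v1 v2 by (simp add: v_def)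
    have "qnorm V v = a / c * qnorm V (v1 \<ominus>\<^bsub>V\<^esub> v2)"
      using v1 v2 t by (simp add: v_def norm_inverse)
    also have "\<dots> \<le> a / c * (V.qmod * (real k + real k))"
      using v1 v2 a c by (intro mult_left_mono V.qnorm_minus_le) auto
    also have "\<dots> \<le> C * a" using a by (simp add: C_def algebra_simps)
    finally have 1: "qnorm V v \<le> C * qnorm W u" by (simp add: a_def)
    have eq: "u' \<ominus>\<^bsub>W\<^esub> T (v1 \<ominus>\<^bsub>V\<^esub> v2) = (T v2 \<ominus>\<^bsub>W\<^esub> w) \<ominus>\<^bsub>W\<^esub> (T v1 \<ominus>\<^bsub>W\<^esub> (w \<oplus>\<^bsub>W\<^esub> u'))"
    proof -
      have "(T v2 \<ominus>\<^bsub>W\<^esub> w) \<ominus>\<^bsub>W\<^esub> (T v1 \<ominus>\<^bsub>W\<^esub> (w \<oplus>\<^bsub>W\<^esub> u')) = (T v2 \<ominus>\<^bsub>W\<^esub> T v1) \<ominus>\<^bsub>W\<^esub> (w \<ominus>\<^bsub>W\<^esub> (w \<oplus>\<^bsub>W\<^esub> u'))"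
        using v1 v2 uc u'c by (intro W.minus_minus_minus) auto
      also have "w \<ominus>\<^bsub>W\<^esub> (w \<oplus>\<^bsub>W\<^esub> u') = \<ominus>\<^bsub>W\<^esub> u'"
        using d uc u'c by (metis W.a_closed W.uminus_minus)
      also have "(T v2 \<ominus>\<^bsub>W\<^esub> T v1) \<ominus>\<^bsub>W\<^esub> (\<ominus>\<^bsub>W\<^esub> u') = u' \<ominus>\<^bsub>W\<^esub> T (v1 \<ominus>\<^bsub>V\<^esub> v2)"
        using v1 v2 u'c by (subst minus) (simp_all add: a_minus_def W.a_ac W.minus_add)
      finally show ?thesis by simp
    qed
    have "u \<ominus>\<^bsub>W\<^esub> T v = inverse t \<odot>\<^bsub>W\<^esub> (u' \<ominus>\<^bsub>W\<^esub> T (v1 \<ominus>\<^bsub>V\<^esub> v2))"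
      using v1 v2 uc t(2) by (simp add: W.smult_minus_right smult v_def u'_def W.smult_smult)
    then have "qnorm W (u \<ominus>\<^bsub>W\<^esub> T v) = a / c * qnorm W (u' \<ominus>\<^bsub>W\<^esub> T (v1 \<ominus>\<^bsub>V\<^esub> v2))"
      using v1 v2 u'c t by (simp add: norm_inverse)
    also have "\<dots> \<le> a / c * (W.qmod * (e' + e'))"
      unfolding eq using v1 v2 a c uc u'c by (intro mult_left_mono W.qnorm_minus_le) auto
    also have "\<dots> = e * a" using c W.qmod_pos by (simp add: e'_def field_simps del: W.qmod_pos)
    finally have "qnorm W (u \<ominus>\<^bsub>W\<^esub> T v) \<le> e * qnorm W u" by (simp add: a_def)
    with 1 vc show ?thesis by blast
  qed
  with C show ?thesis by blast
qed

text \<open>Successive approximation: the residual shrinks by a factor q at each step, and its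
  correction costs at most C times the residual. The corrections are summed in V, so it is the
  modulus of V that fixes q.\<close>

theorem open_mapping:
  assumes "quasi_banach V" "quasi_banach W" "operator V W T" and cl: "qclosed W (T ` carrier V)"
  obtains C where "0 < C"
    "\<And>w. w \<in> T ` carrier V \<Longrightarrow> \<exists>v\<in>carrier V. T v = w \<and> qnorm V v \<le> C * qnorm W w"
proof -
  interpret V: qbanach V using assms(1) by (rule quasi_banachD)
  interpret W: qbanach W using assms(2) by (rule quasi_banachD)
  interpret qoperator V W T by unfold_locales fact
  obtain C where C: "C > 0" "\<And>u e. u\<in>T ` carrier V \<Longrightarrow> e > 0 \<Longrightarrow> \<exists>v\<in>carrier V.
    qnorm V v \<le> C * qnorm W u \<and> qnorm W (u \<ominus>\<^bsub>W\<^esub> T v) \<le> e * qnorm W u"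
    using almost_open[OF V.qnormed_axioms W.qbanach_axioms qoperator_axioms cl] by blast
  define q where "q = 1 / (2 * V.qmod)"
  have q: "0 < q" "q < 1" using V.qmod_ge_1 by (auto simp: q_def field_simps)
  have "\<exists>v\<in>carrier V. T v = w \<and> qnorm V v \<le> 2 * V.qmod * V.qmod * C * qnorm W w"
    if w: "w \<in> T ` carrier V" for w
  proof -
    have wc: "w \<in> carrier W" using w by auto
    \<comment> \<open>The clause for n = 0 pins the start to zero, so that the distance from the
      limit to \<open>f 0\<close> is the norm of the limit.\<close>
    have "\<exists>f. \<forall>n. (f n \<in> carrier V \<and> qnorm W (w \<ominus>\<^bsub>W\<^esub> T (f n)) \<le> qnorm W w * q ^ n \<and> (n = 0 \<longrightarrow> f n = \<zero>\<^bsub>V\<^esub>)) \<and>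
      qnorm V (f (Suc n) \<ominus>\<^bsub>V\<^esub> f n) \<le> C * qnorm W w * q ^ n"
    proof (rule dependent_nat_choice)
      show "\<exists>x. x \<in> carrier V \<and> qnorm W (w \<ominus>\<^bsub>W\<^esub> T x) \<le> qnorm W w * q ^ 0 \<and> (0 = (0::nat) \<longrightarrow> x = \<zero>\<^bsub>V\<^esub>)"
        by (rule exI[of _ "\<zero>\<^bsub>V\<^esub>"]) (use wc in auto)
    next
      fix x n assume "x \<in> carrier V \<and> qnorm W (w \<ominus>\<^bsub>W\<^esub> T x) \<le> qnorm W w * q ^ n \<and> (n = 0 \<longrightarrow> x = \<zero>\<^bsub>V\<^esub>)"
      then have x: "x \<in> carrier V" "qnorm W (w \<ominus>\<^bsub>W\<^esub> T x) \<le> qnorm W w * q ^ n" by auto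
      have "w \<ominus>\<^bsub>W\<^esub> T x \<in> T ` carrier V"
        using w x by (auto simp flip: minus)
      from C(2)[OF this q(1)] obtain v where v: "v \<in> carrier V"
        "qnorm V v \<le> C * qnorm W (w \<ominus>\<^bsub>W\<^esub> T x)"
        "qnorm W (w \<ominus>\<^bsub>W\<^esub> T x \<ominus>\<^bsub>W\<^esub> T v) \<le> q * qnorm W (w \<ominus>\<^bsub>W\<^esub> T x)" by blast
      have "w \<ominus>\<^bsub>W\<^esub> T (x \<oplus>\<^bsub>V\<^esub> v) = w \<ominus>\<^bsub>W\<^esub> T x \<ominus>\<^bsub>W\<^esub> T v"
        using wc x v by (simp add: add a_minus_def W.minus_add W.a_ac)
      moreover have "q * qnorm W (w \<ominus>\<^bsub>W\<^esub> T x) \<le> q * (qnorm W w * q ^ n)"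
        using x q by (intro mult_left_mono) auto
      ultimately have 1: "qnorm W (w \<ominus>\<^bsub>W\<^esub> T (x \<oplus>\<^bsub>V\<^esub> v)) \<le> qnorm W w * q ^ Suc n"
        using v(3) by (simp add: algebra_simps)
      have "(x \<oplus>\<^bsub>V\<^esub> v) \<ominus>\<^bsub>V\<^esub> x = v"
        using x v by (intro V.add_minus_cancel_left)
      moreover have "C * qnorm W (w \<ominus>\<^bsub>W\<^esub> T x) \<le> C * (qnorm W w * q ^ n)"
        using x C(1) by (intro mult_left_mono) auto
      ultimately have 2: "qnorm V ((x \<oplus>\<^bsub>V\<^esub> v) \<ominus>\<^bsub>V\<^esub> x) \<le> C * qnorm W w * q ^ n"
        using v(2) by (simp add: algebra_simps)
      show "\<exists>y. (y \<in> carrier V \<and> qnorm W (w \<ominus>\<^bsub>W\<^esub> T y) \<le> qnorm W w * q ^ Suc n \<and>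
          (Suc n = 0 \<longrightarrow> y = \<zero>\<^bsub>V\<^esub>)) \<and> qnorm V (y \<ominus>\<^bsub>V\<^esub> x) \<le> C * qnorm W w * q ^ n"
        using x v 1 2 by (intro exI[of _ "x \<oplus>\<^bsub>V\<^esub> v"]) auto
    qed
    then obtain f where f: "\<And>n. f n \<in> carrier V" "\<And>n. qnorm W (w \<ominus>\<^bsub>W\<^esub> T (f n)) \<le> qnorm W w * q ^ n"
       "f 0 = \<zero>\<^bsub>V\<^esub>" "\<And>n. qnorm V (f (Suc n) \<ominus>\<^bsub>V\<^esub> f n) \<le> C * qnorm W w * (1 / (2 * V.qmod)) ^ n"
      unfolding q_def by metis
    have "0 \<le> C * qnorm W w" using C wc by simp
    then obtain v where v: "v \<in> carrier V" "qconverges V f v"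
      "\<And>m. qnorm V (v \<ominus>\<^bsub>V\<^esub> f m) \<le> V.qmod * (2 * V.qmod * (C * qnorm W w) * (1 / (2 * V.qmod)) ^ m)"
      using V.geometric_limit[of f, OF f(1,4)] by blast
    have "qconverges W (\<lambda>n. T (f n)) (T v)" using qconverges v f(1) by blast
    moreover have "qconverges W (\<lambda>n. T (f n)) w" unfolding qconverges_def
    proof (rule tendsto_sandwich[of "\<lambda>_. 0"])
      show "(\<lambda>n. qnorm W w * q ^ n) \<longlonglongrightarrow> 0"
        using q by (auto intro!: tendsto_eq_intros LIMSEQ_power_zero)
      show "\<forall>\<^sub>F n in sequentially. qnorm W (T (f n) \<ominus>\<^bsub>W\<^esub> w) \<le> qnorm W w * q ^ n"
        using f(1,2) wc by (simp add: W.qnorm_minus_commute)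
    qed (use f wc in auto)
    ultimately have "T v = w" by (rule W.qconverges_unique) (use v f wc in auto)
    moreover have "qnorm V v \<le> 2 * V.qmod * V.qmod * C * qnorm W w"
      using v(3)[of 0] v(1) by (simp add: f(3) algebra_simps)
    ultimately show ?thesis using v(1) by blast
  qed
  then show ?thesis using that[of "2 * V.qmod * V.qmod * C"] C V.qmod_pos by simp
qed

lemma operator_compose:
  assumes "qoperator V W T" "qoperator W U S"
  shows "operator V U (\<lambda>x. S (T x))"
proof -
  interpret T: qoperator V W T by fact
  interpret S: qoperator W U S by fact
  obtain C where C: "0 < C" "\<And>x. x \<in> carrier V \<Longrightarrow> qnorm W (T x) \<le> C * qnorm V x"
    using T.bounded by metis
  obtain D where D: "0 < D" "\<And>x. x \<in> carrier W \<Longrightarrow> qnorm U (S x) \<le> D * qnorm W x"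
    using S.bounded by metis
  have "qnorm U (S (T x)) \<le> (D * C) * qnorm V x" if "x \<in> carrier V" for x
  proof -
    have "qnorm U (S (T x)) \<le> D * qnorm W (T x)" using D(2) that by auto
    also have "\<dots> \<le> D * (C * qnorm V x)" using C D that by (intro mult_left_mono) auto
    finally show ?thesis by simp
  qed
  then show ?thesis unfolding operator_def by (auto simp: T.add S.add T.smult S.smult)
qed

lemma quasinormed_spaceI:
  fixes V :: "('k::real_normed_field, 'a) qspace" (structure)
  assumes "Module.module (scalar_ring :: 'k ring) V"
    and "\<And>x. x \<in> carrier V \<Longrightarrow> 0 \<le> qnorm V x"
    and "\<And>c x. x \<in> carrier V \<Longrightarrow> qnorm V (c \<odot> x) = norm c * qnorm V x"
    and "\<And>x. x \<in> carrier V \<Longrightarrow> qnorm V x = 0 \<Longrightarrow> x = \<zero>"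
    and "qnorm V \<zero> = 0"
    and "\<And>x y. x \<in> carrier V \<Longrightarrow> y \<in> carrier V \<Longrightarrow> qnorm V (x \<oplus> y) \<le> C * (qnorm V x + qnorm V y)"
  shows "quasinormed_space V"
  unfolding quasinormed_space_def using assms by blast

subsection \<open>Copies of spaces\<close>

lemma (in qnormed) copy_space_simps:
  assumes "inj_on f (carrier V)"
  shows "carrier (copy_space f V) = f ` carrier V"
    "\<zero>\<^bsub>copy_space f V\<^esub> = f \<zero>"
    "x \<in> carrier V \<Longrightarrow> y \<in> carrier V \<Longrightarrow> f x \<oplus>\<^bsub>copy_space f V\<^esub> f y = f (x \<oplus> y)"
    "x \<in> carrier V \<Longrightarrow> c \<odot>\<^bsub>copy_space f V\<^esub> f x = f (c \<odot> x)"
    "x \<in> carrier V \<Longrightarrow> qnorm (copy_space f V) (f x) = qnorm V x"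
  using assms by (simp_all add: copy_space_def Let_def the_inv_into_f_f)

lemma (in qnormed) qnormed_copy_space:
  assumes "inj_on f (carrier V)"
  shows "qnormed (copy_space f V)"
proof
  note cs = copy_space_simps[OF assms]
  have "Module.module (scalar_ring :: 'k ring) (copy_space f V)"
    by (rule module_scalarI)
      (auto simp: cs a_assoc smult_add_left smult_add_right smult_smult intro!: arg_cong[of _ _ f] a_comm)
  then show "quasinormed_space (copy_space f V)"
    by (rule quasinormed_spaceI[where C = qmod]) (auto simp: cs qnorm_eq_0_iff intro!: qnorm_triangle)
qed

lemma (in qnormed) copy_space_minus:
  assumes "inj_on f (carrier V)" "x \<in> carrier V" "y \<in> carrier V"
  shows "f x \<ominus>\<^bsub>copy_space f V\<^esub> f y = f (x \<ominus> y)"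
proof -
  interpret C: qnormed "copy_space f V" using assms(1) by (rule qnormed_copy_space)
  show ?thesis using assms
    by (simp add: a_minus_def C.uminus_eq_smult uminus_eq_smult copy_space_simps)
qed

lemma quasi_banach_copy_space:
  assumes "quasi_banach V" "inj_on f (carrier V)"
  shows "quasi_banach (copy_space f V)"
proof -
  interpret V: qbanach V using assms(1) by (rule quasi_banachD)
  note cs = V.copy_space_simps[OF assms(2)] V.copy_space_minus[OF assms(2)]
  interpret C: qnormed "copy_space f V" using assms(2) by (rule V.qnormed_copy_space)
  have "\<exists>x\<in>carrier (copy_space f V). qconverges (copy_space f V) s x"
    if s: "s \<in> qCauchy (copy_space f V)" for s
  proof -
    define t where "t = (\<lambda>n. the_inv_into (carrier V) f (s n))"
    have t: "t n \<in> carrier V" "s n = f (t n)" for n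
      using s assms(2) unfolding qCauchy_def t_def cs
      by (auto simp: f_the_inv_into_f intro!: the_inv_into_into)
    then have seq: "s = (\<lambda>n. f (t n))" by auto
    have "t \<in> qCauchy V" using s t(1) unfolding qCauchy_def seq by (simp add: cs)
    then obtain x where "x \<in> carrier V" "qconverges V t x" using V.complete by blast
    then show ?thesis
      by (intro bexI[of _ "f x"]) (use t(1) in \<open>auto simp: qconverges_def seq cs\<close>)
  qed
  then show ?thesis using C.quasinormed by (simp add: quasi_banach_def)
qed

lemma (in qnormed) operator_into_copy:
  "inj_on f (carrier V) \<Longrightarrow> operator V (copy_space f V) f"
  by (auto simp: operator_def copy_space_simps intro!: exI[of _ 1])

lemma (in qnormed) operator_from_copy:
  assumes "inj_on f (carrier V)" "\<And>x. x \<in> carrier V \<Longrightarrow> g (f x) = x"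
  shows "operator (copy_space f V) V g"
  using assms by (auto simp: operator_def copy_space_simps intro!: exI[of _ 1])

subsection \<open>Completions\<close>

context qnormed
begin

abbreviation cls :: "(nat \<Rightarrow> 'a) \<Rightarrow> (nat \<Rightarrow> 'a) set" where
  "cls s \<equiv> null_rel V `` {s}"

lemma qCauchyD: "s \<in> qCauchy V \<Longrightarrow> s n \<in> carrier V"
  by (simp add: qCauchy_def)

lemma qCauchyE:
  assumes "s \<in> qCauchy V" "0 < e"
  obtains N where "\<And>m n. m \<ge> N \<Longrightarrow> n \<ge> N \<Longrightarrow> qnorm V (s m \<ominus> s n) < e"
  using assms unfolding qCauchy_def by blast

lemma qCauchy_const: "x \<in> carrier V \<Longrightarrow> (\<lambda>_. x) \<in> qCauchy V"
  by (simp add: qCauchy_def)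

lemma null_rel_iff:
  "(s, t) \<in> null_rel V \<longleftrightarrow> s \<in> qCauchy V \<and> t \<in> qCauchy V \<and> (\<lambda>n. qnorm V (s n \<ominus> t n)) \<longlonglongrightarrow> 0"
  by (simp add: null_rel_def)

lemma qnull_sandwich:
  assumes "f \<longlonglongrightarrow> 0" "\<And>n. x n \<in> carrier V" "\<And>n. qnorm V (x n) \<le> f n"
  shows "(\<lambda>n. qnorm V (x n)) \<longlonglongrightarrow> 0"
  by (rule tendsto_sandwich[of "\<lambda>_. 0", OF _ _ _ assms(1)]) (use assms in auto)

lemma equiv_null_rel: "equiv (qCauchy V) (null_rel V)"
proof (rule equivI)
  show "null_rel V \<subseteq> qCauchy V \<times> qCauchy V" by (auto simp: null_rel_def)
  show "refl_on (qCauchy V) (null_rel V)"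
    by (auto simp: refl_on_def null_rel_def qCauchyD)
  show "sym (null_rel V)"
  proof (rule symI)
    fix s t assume *: "(s, t) \<in> null_rel V"
    then have "qnorm V (t n \<ominus> s n) = qnorm V (s n \<ominus> t n)" for n
      by (intro qnorm_minus_commute) (auto simp: null_rel_def qCauchyD)
    with * show "(t, s) \<in> null_rel V" by (simp add: null_rel_def)
  qed
  show "trans (null_rel V)"
  proof (rule transI)
    fix s t u assume st: "(s, t) \<in> null_rel V" and tu: "(t, u) \<in> null_rel V"
    have c: "s n \<in> carrier V" "t n \<in> carrier V" "u n \<in> carrier V" for n
      using st tu by (auto simp: null_rel_def dest: qCauchyD)
    have "(\<lambda>n. qnorm V (s n \<ominus> u n)) \<longlonglongrightarrow> 0"
    proof (rule qnull_sandwich)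
      show "(\<lambda>n. qmod * (qnorm V (s n \<ominus> t n) + qnorm V (t n \<ominus> u n))) \<longlonglongrightarrow> 0"
        using st tu unfolding null_rel_def by (auto intro!: tendsto_eq_intros)
      show "qnorm V (s n \<ominus> u n) \<le> qmod * (qnorm V (s n \<ominus> t n) + qnorm V (t n \<ominus> u n))" for n
        by (rule qnorm_via[of _ "t n"]) (use c in auto)
    qed (use c in auto)
    then show "(s, u) \<in> null_rel V" using st tu by (simp add: null_rel_def)
  qed
qed

lemma cls_eq_iff:
  "s \<in> qCauchy V \<Longrightarrow> t \<in> qCauchy V \<Longrightarrow> cls s = cls t \<longleftrightarrow> (\<lambda>n. qnorm V (s n \<ominus> t n)) \<longlonglongrightarrow> 0"
  using eq_equiv_class_iff[OF equiv_null_rel, of s t] by (simp add: null_rel_iff)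

lemma self_in_cls: "s \<in> qCauchy V \<Longrightarrow> s \<in> cls s"
  by (rule equiv_class_self[OF equiv_null_rel])

lemma in_clsD:
  assumes "t \<in> cls s"
  shows "t \<in> qCauchy V" "cls t = cls s"
  using assms equiv_class_eq[OF equiv_null_rel, of s t] by (auto simp: null_rel_iff)

lemma qCauchy_add:
  assumes "s \<in> qCauchy V" "t \<in> qCauchy V"
  shows "(\<lambda>n. s n \<oplus> t n) \<in> qCauchy V"
  unfolding qCauchy_def
proof (safe)
  fix e :: real assume e: "e > 0"
  define d where "d = e / (4 * qmod)"
  have d: "d > 0" using e by (simp add: d_def)
  obtain M where M: "\<And>m n. m \<ge> M \<Longrightarrow> n \<ge> M \<Longrightarrow> qnorm V (s m \<ominus> s n) < d"
    using qCauchyE[OF assms(1) d] by metis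
  obtain N where N: "\<And>m n. m \<ge> N \<Longrightarrow> n \<ge> N \<Longrightarrow> qnorm V (t m \<ominus> t n) < d"
    using qCauchyE[OF assms(2) d] by metis
  have "qnorm V ((s m \<oplus> t m) \<ominus> (s n \<oplus> t n)) < e" if "m \<ge> max M N" "n \<ge> max M N" for m n
  proof -
    have "qnorm V ((s m \<oplus> t m) \<ominus> (s n \<oplus> t n)) \<le> qmod * (d + d)"
      using qCauchyD[OF assms(1)] qCauchyD[OF assms(2)] M[of m n] N[of m n] that
      by (subst add_minus_add) (simp_all only: max.bounded_iff minus_closed qnorm_triangle_le less_imp_le)
    also have "\<dots> < e" using e qmod_pos by (simp add: d_def field_simps del: qmod_pos)
    finally show ?thesis .
  qed
  then show "\<exists>N. \<forall>m\<ge>N. \<forall>n\<ge>N. qnorm V ((s m \<oplus> t m) \<ominus> (s n \<oplus> t n)) < e" by blast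
qed (use assms in \<open>auto dest: qCauchyD\<close>)

lemma qCauchy_smult:
  assumes "s \<in> qCauchy V"
  shows "(\<lambda>n. c \<odot> s n) \<in> qCauchy V"
  unfolding qCauchy_def
proof (safe)
  fix e :: real assume e: "e > 0"
  obtain N where N: "\<And>m n. m \<ge> N \<Longrightarrow> n \<ge> N \<Longrightarrow> qnorm V (s m \<ominus> s n) < e / (norm c + 1)"
    using qCauchyE[OF assms, of "e / (norm c + 1)"] e by (metis add_nonneg_pos divide_pos_pos norm_ge_zero zero_less_one)
  have "qnorm V (c \<odot> s m \<ominus> c \<odot> s n) < e" if "m \<ge> N" "n \<ge> N" for m n
  proof -
    have "norm c * qnorm V (s m \<ominus> s n) \<le> norm c * (e / (norm c + 1))"
      using N[OF that] by (intro mult_left_mono) auto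
    also have "\<dots> = e * (norm c / (norm c + 1))" by simp
    also have "\<dots> < e * 1" using e by (intro mult_strict_left_mono) (auto simp: divide_less_eq add_nonneg_pos)
    also have "\<dots> = e" by simp
    finally show ?thesis using qCauchyD[OF assms] by (simp flip: smult_minus_right)
  qed
  then show "\<exists>N. \<forall>m\<ge>N. \<forall>n\<ge>N. qnorm V (c \<odot> s m \<ominus> c \<odot> s n) < e" by blast
qed (use assms in \<open>auto dest: qCauchyD\<close>)

lemma qCauchy_minus:
  assumes "s \<in> qCauchy V" "t \<in> qCauchy V"
  shows "(\<lambda>n. s n \<ominus> t n) \<in> qCauchy V"
  using qCauchy_add[OF assms(1) qCauchy_smult[OF assms(2), of "- 1"]] qCauchyD[OF assms(2)]
  by (simp add: a_minus_def uminus_eq_smult)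

text \<open>The gauge on the completion asks for a representative bounded at all indices. Dropping
  an initial segment stays in the class, so eventual bounds suffice.\<close>

lemma qCauchy_shift:
  assumes "s \<in> qCauchy V"
  shows "(\<lambda>n. s (n + N)) \<in> cls s"
proof -
  have 1: "(\<lambda>n. s (n + N)) \<in> qCauchy V"
    using assms unfolding qCauchy_def by (auto, meson trans_le_add1)
  have "(\<lambda>n. qnorm V (s n \<ominus> s (n + N))) \<longlonglongrightarrow> 0"
  proof (rule LIMSEQ_I)
    fix r :: real assume "0 < r"
    then obtain M where M: "\<And>m n. m \<ge> M \<Longrightarrow> n \<ge> M \<Longrightarrow> qnorm V (s m \<ominus> s n) < r"
      using qCauchyE[OF assms] by metis
    have "norm (qnorm V (s n \<ominus> s (n + N)) - 0) < r" if "n \<ge> M" for n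
      using M[of n "n + N"] that qCauchyD[OF assms] by simp
    then show "\<exists>no. \<forall>n\<ge>no. norm (qnorm V (s n \<ominus> s (n + N)) - 0) < r" by blast
  qed
  with 1 assms show ?thesis by (simp add: null_rel_iff)
qed

lemma qcompletion_simps:
  "carrier (qcompletion V) = qCauchy V // null_rel V"
  "\<zero>\<^bsub>qcompletion V\<^esub> = cls (\<lambda>_. \<zero>)"
  "qnorm (qcompletion V) a = Inf {r. \<exists>s\<in>a. \<forall>n. qnorm V (s n) \<le> r}"
  by (simp_all add: qcompletion_def)

lemma cls_in_qcompletion [simp, intro]: "s \<in> qCauchy V \<Longrightarrow> cls s \<in> carrier (qcompletion V)"
  by (simp add: qcompletion_simps quotientI)

lemma qcompletionE:
  assumes "a \<in> carrier (qcompletion V)"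
  obtains s where "s \<in> qCauchy V" "a = cls s"
  using assms by (auto simp: qcompletion_simps elim: quotientE)

lemma cls_add:
  assumes "s \<in> qCauchy V" "t \<in> qCauchy V"
  shows "cls s \<oplus>\<^bsub>qcompletion V\<^esub> cls t = cls (\<lambda>n. s n \<oplus> t n)"
proof -
  have "congruent2 (null_rel V) (null_rel V) (\<lambda>s t. cls (\<lambda>n. s n \<oplus> t n))"
  proof (rule congruent2I')
    fix s s' t t' assume *: "(s, s') \<in> null_rel V" "(t, t') \<in> null_rel V"
    then have c: "s n \<in> carrier V" "t n \<in> carrier V" "s' n \<in> carrier V" "t' n \<in> carrier V" for n
      by (auto simp: null_rel_def dest: qCauchyD)
    have "(\<lambda>n. qnorm V ((s n \<oplus> t n) \<ominus> (s' n \<oplus> t' n))) \<longlonglongrightarrow> 0"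
    proof (rule qnull_sandwich)
      show "(\<lambda>n. qmod * (qnorm V (s n \<ominus> s' n) + qnorm V (t n \<ominus> t' n))) \<longlonglongrightarrow> 0"
        using * unfolding null_rel_def by (auto intro!: tendsto_eq_intros)
    qed (use c in \<open>auto simp: add_minus_add intro!: qnorm_triangle\<close>)
    then show "cls (\<lambda>n. s n \<oplus> t n) = cls (\<lambda>n. s' n \<oplus> t' n)"
      using * by (subst cls_eq_iff) (auto simp: null_rel_iff intro!: qCauchy_add)
  qed
  from UN_equiv_class2[OF equiv_null_rel equiv_null_rel this assms] show ?thesis
    by (simp add: qcompletion_def)
qed

lemma cls_smult:
  assumes "s \<in> qCauchy V"
  shows "c \<odot>\<^bsub>qcompletion V\<^esub> cls s = cls (\<lambda>n. c \<odot> s n)"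
proof -
  have "congruent (null_rel V) (\<lambda>s. cls (\<lambda>n. c \<odot> s n))"
  proof (rule congruentI)
    fix s s' assume *: "(s, s') \<in> null_rel V"
    then have c: "s n \<in> carrier V" "s' n \<in> carrier V" for n
      by (auto simp: null_rel_def dest: qCauchyD)
    have "(\<lambda>n. qnorm V (c \<odot> s n \<ominus> c \<odot> s' n)) \<longlonglongrightarrow> 0"
      using * c unfolding null_rel_def by (auto simp flip: smult_minus_right intro!: tendsto_eq_intros)
    then show "cls (\<lambda>n. c \<odot> s n) = cls (\<lambda>n. c \<odot> s' n)"
      using * by (subst cls_eq_iff) (auto simp: null_rel_iff intro!: qCauchy_smult)
  qed
  from UN_equiv_class[OF equiv_null_rel this assms] show ?thesis
    by (simp add: qcompletion_def)
qed

lemma qnorm_cls_le: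
  assumes "s \<in> qCauchy V" "eventually (\<lambda>n. qnorm V (s n) \<le> r) sequentially"
  shows "qnorm (qcompletion V) (cls s) \<le> r"
proof -
  obtain N where N: "\<And>n. n \<ge> N \<Longrightarrow> qnorm V (s n) \<le> r"
    using assms(2) by (auto simp: eventually_sequentially)
  show ?thesis unfolding qcompletion_simps
  proof (rule cInf_lower)
    show "r \<in> {r. \<exists>s\<in>cls s. \<forall>n. qnorm V (s n) \<le> r}"
      using qCauchy_shift[OF assms(1), of N] N by (intro CollectI bexI[of _ "\<lambda>n. s (n + N)"]) auto
    show "bdd_below {r. \<exists>s\<in>cls s. \<forall>n. qnorm V (s n) \<le> r}"
    proof (rule bdd_belowI[of _ 0])
      fix r assume "r \<in> {r. \<exists>s\<in>cls s. \<forall>n. qnorm V (s n) \<le> r}"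
      then obtain t where "t \<in> cls s" "qnorm V (t 0) \<le> r" by blast
      with in_clsD(1) qCauchyD qnorm_nonneg order_trans show "0 \<le> r" by meson
    qed
  qed
qed

lemma qCauchy_bounded:
  assumes "s \<in> qCauchy V"
  obtains r where "eventually (\<lambda>n. qnorm V (s n) \<le> r) sequentially"
proof -
  obtain N where N: "\<And>m n. m \<ge> N \<Longrightarrow> n \<ge> N \<Longrightarrow> qnorm V (s m \<ominus> s n) < 1"
    using qCauchyE[OF assms, of 1] by auto
  have "qnorm V (s n) \<le> qmod * (1 + qnorm V (s N))" if "n \<ge> N" for n
    using qnorm_via[of "s n" "s N" \<zero> 1 "qnorm V (s N)"] N[of n N] that qCauchyD[OF assms] by auto
  then show ?thesis using that by (auto simp: eventually_sequentially)
qed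

lemma qnorm_cls_lessD:
  assumes "s \<in> qCauchy V" "qnorm (qcompletion V) (cls s) < r"
  obtains t where "t \<in> cls s" "\<And>n. qnorm V (t n) \<le> r"
proof -
  obtain r' where "eventually (\<lambda>n. qnorm V (s n) \<le> r') sequentially"
    using qCauchy_bounded[OF assms(1)] .
  then obtain N where N: "\<And>n. n \<ge> N \<Longrightarrow> qnorm V (s n) \<le> r'"
    by (auto simp: eventually_sequentially)
  have "r' \<in> {r. \<exists>s\<in>cls s. \<forall>n. qnorm V (s n) \<le> r}"
    using qCauchy_shift[OF assms(1), of N] N by (intro CollectI bexI[of _ "\<lambda>n. s (n + N)"]) auto
  then have "{r. \<exists>s\<in>cls s. \<forall>n. qnorm V (s n) \<le> r} \<noteq> {}" by blast
  from cInf_lessD[OF this assms(2)[unfolded qcompletion_simps]] obtain z where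
    "\<exists>s\<in>cls s. \<forall>n. qnorm V (s n) \<le> z" "z < r" by auto
  then show ?thesis using that by (meson less_imp_le order_trans)
qed

lemma qnorm_cls_nonneg:
  assumes "s \<in> qCauchy V"
  shows "0 \<le> qnorm (qcompletion V) (cls s)"
proof (rule dense_ge)
  fix r assume "qnorm (qcompletion V) (cls s) < r"
  then obtain t where t: "t \<in> cls s" "\<And>n. qnorm V (t n) \<le> r"
    using qnorm_cls_lessD[OF assms] by metis
  show "0 \<le> r" using t(2)[of 0] qnorm_nonneg[OF qCauchyD[OF in_clsD(1)[OF t(1)], of 0]] by linarith
qed

text \<open>The gauge speaks of some representative t. Returning to the given s adds a null
  sequence, which eventually is below r as well; hence twice r, times \<open>qmod\<close>.\<close>

lemma qnorm_cls_eventually: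
  assumes "s \<in> qCauchy V" "qnorm (qcompletion V) (cls s) < r"
  shows "eventually (\<lambda>n. qnorm V (s n) \<le> 2 * qmod * r) sequentially"
proof -
  obtain t where t: "t \<in> cls s" "\<And>n. qnorm V (t n) \<le> r"
    using qnorm_cls_lessD[OF assms] by metis
  have r: "0 < r" using qnorm_cls_nonneg[OF assms(1)] assms(2) by linarith
  have tc: "t n \<in> carrier V" for n using in_clsD(1)[OF t(1)] by (rule qCauchyD)
  have "(\<lambda>n. qnorm V (s n \<ominus> t n)) \<longlonglongrightarrow> 0" using t(1) by (simp add: null_rel_iff)
  then have "eventually (\<lambda>n. qnorm V (s n \<ominus> t n) < r) sequentially"
    using r by (rule order_tendstoD)
  then show ?thesis
  proof eventually_elim
    case (elim n)
    have "qnorm V (s n \<ominus> \<zero>) \<le> qmod * (r + r)"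
      by (rule qnorm_via[of _ "t n"]) (use elim t(2) tc qCauchyD[OF assms(1)] in auto)
    then show ?case using qCauchyD[OF assms(1)] by (simp add: algebra_simps)
  qed
qed

text \<open>With \<open>qnorm_cls_le\<close> this makes the two quasinorms equivalent on V. It is
  what later makes Y embed injectively and brings estimates in Z(\<Phi>) back to explicit
  pairs.\<close>

lemma qnorm_le_qnorm_cls:
  assumes "x \<in> carrier V"
  shows "qnorm V x \<le> 2 * qmod * qnorm (qcompletion V) (cls (\<lambda>_. x))"
proof -
  have "qnorm V x / (2 * qmod) \<le> qnorm (qcompletion V) (cls (\<lambda>_. x))"
  proof (rule dense_ge)
    fix r assume "qnorm (qcompletion V) (cls (\<lambda>_. x)) < r"
    from qnorm_cls_eventually[OF qCauchy_const[OF assms] this]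
    show "qnorm V x / (2 * qmod) \<le> r" using qmod_pos by (simp add: field_simps del: qmod_pos)
  qed
  then show ?thesis using qmod_pos by (simp add: field_simps del: qmod_pos)
qed

lemma qnorm_cls_smult_le:
  assumes "s \<in> qCauchy V"
  shows "qnorm (qcompletion V) (cls (\<lambda>n. c \<odot> s n)) \<le> norm c * qnorm (qcompletion V) (cls s)"
proof (cases "c = 0")
  case True
  then show ?thesis
    using qnorm_cls_le[OF qCauchy_smult[OF assms], of c 0] qCauchyD[OF assms] by simp
next
  case False
  have "qnorm (qcompletion V) (cls (\<lambda>n. c \<odot> s n)) / norm c \<le> qnorm (qcompletion V) (cls s)"
  proof (rule dense_ge)
    fix r assume "qnorm (qcompletion V) (cls s) < r"
    then obtain t where t: "t \<in> cls s" "\<And>n. qnorm V (t n) \<le> r"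
      using qnorm_cls_lessD[OF assms] by metis
    have tC: "t \<in> qCauchy V" "cls t = cls s" using in_clsD[OF t(1)] by auto
    have "cls (\<lambda>n. c \<odot> s n) = cls (\<lambda>n. c \<odot> t n)"
      using cls_smult[OF assms, of c] cls_smult[OF tC(1), of c] tC(2) by simp
    moreover have "qnorm (qcompletion V) (cls (\<lambda>n. c \<odot> t n)) \<le> norm c * r"
      using t(2) qCauchyD[OF tC(1)]
      by (intro qnorm_cls_le qCauchy_smult[OF tC(1)]) (auto intro!: mult_left_mono always_eventually)
    ultimately show "qnorm (qcompletion V) (cls (\<lambda>n. c \<odot> s n)) / norm c \<le> r"
      using False by (simp add: field_simps)
  qed
  then show ?thesis using False by (simp add: field_simps)
qed

lemma cls_cong: "(\<And>n. s n = t n) \<Longrightarrow> cls s = cls t"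
  by (metis ext)

lemma qnormed_qcompletion: "qnormed (qcompletion V)"
proof
  have "Module.module (scalar_ring :: 'k ring) (qcompletion V)"
  proof (rule module_scalarI)
    fix x y z assume "x \<in> carrier (qcompletion V)" "y \<in> carrier (qcompletion V)" "z \<in> carrier (qcompletion V)"
    then obtain r s t where *: "r \<in> qCauchy V" "x = cls r" "s \<in> qCauchy V" "y = cls s" "t \<in> qCauchy V" "z = cls t"
      by (metis qcompletionE)
    note c = qCauchyD[OF *(1)] qCauchyD[OF *(3)] qCauchyD[OF *(5)]
    show "x \<oplus>\<^bsub>qcompletion V\<^esub> y \<oplus>\<^bsub>qcompletion V\<^esub> z = x \<oplus>\<^bsub>qcompletion V\<^esub> (y \<oplus>\<^bsub>qcompletion V\<^esub> z)"
      using * c by (simp add: cls_add qCauchy_add a_assoc)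
  next
    fix x y and d assume "x \<in> carrier (qcompletion V)" "y \<in> carrier (qcompletion V)"
    then obtain r s where *: "r \<in> qCauchy V" "x = cls r" "s \<in> qCauchy V" "y = cls s"
      by (metis qcompletionE)
    note c = qCauchyD[OF *(1)] qCauchyD[OF *(3)]
    show "x \<oplus>\<^bsub>qcompletion V\<^esub> y \<in> carrier (qcompletion V)"
      using * by (simp add: cls_add qCauchy_add)
    show "x \<oplus>\<^bsub>qcompletion V\<^esub> y = y \<oplus>\<^bsub>qcompletion V\<^esub> x"
      using * c by (simp add: cls_add qCauchy_add) (rule cls_cong, rule a_comm, auto)
    show "d \<odot>\<^bsub>qcompletion V\<^esub> (x \<oplus>\<^bsub>qcompletion V\<^esub> y) = d \<odot>\<^bsub>qcompletion V\<^esub> x \<oplus>\<^bsub>qcompletion V\<^esub> d \<odot>\<^bsub>qcompletion V\<^esub> y"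
      using * c by (simp add: cls_add cls_smult qCauchy_add qCauchy_smult smult_add_right)
  next
    fix x and d e assume "x \<in> carrier (qcompletion V)"
    then obtain r where *: "r \<in> qCauchy V" "x = cls r"
      by (metis qcompletionE)
    note c = qCauchyD[OF *(1)]
    show "d \<odot>\<^bsub>qcompletion V\<^esub> x \<in> carrier (qcompletion V)"
      using * by (simp add: cls_smult qCauchy_smult)
    show "\<zero>\<^bsub>qcompletion V\<^esub> \<oplus>\<^bsub>qcompletion V\<^esub> x = x"
      using * c by (simp add: cls_add qCauchy_const qcompletion_simps(2))
    show "(d + e) \<odot>\<^bsub>qcompletion V\<^esub> x = d \<odot>\<^bsub>qcompletion V\<^esub> x \<oplus>\<^bsub>qcompletion V\<^esub> e \<odot>\<^bsub>qcompletion V\<^esub> x"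
      using * c by (simp add: cls_add cls_smult qCauchy_smult smult_add_left)
    show "(d * e) \<odot>\<^bsub>qcompletion V\<^esub> x = d \<odot>\<^bsub>qcompletion V\<^esub> (e \<odot>\<^bsub>qcompletion V\<^esub> x)"
      using * c by (simp add: cls_smult qCauchy_smult smult_smult)
    show "1 \<odot>\<^bsub>qcompletion V\<^esub> x = x" "0 \<odot>\<^bsub>qcompletion V\<^esub> x = \<zero>\<^bsub>qcompletion V\<^esub>"
      using * c by (simp_all add: cls_smult qcompletion_simps(2))
  qed (simp add: qcompletion_simps(2) qCauchy_const)
  then show "quasinormed_space (qcompletion V)"
  proof (rule quasinormed_spaceI[where C = qmod])
    show z: "qnorm (qcompletion V) \<zero>\<^bsub>qcompletion V\<^esub> = 0"
      using qnorm_cls_le[OF qCauchy_const, of \<zero> 0] qnorm_cls_nonneg[OF qCauchy_const, of \<zero>]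
      by (simp add: qcompletion_simps(2))
    fix x assume "x \<in> carrier (qcompletion V)"
    then obtain s where *: "s \<in> qCauchy V" "x = cls s" by (metis qcompletionE)
    note c = qCauchyD[OF *(1)]
    show "0 \<le> qnorm (qcompletion V) x" using * qnorm_cls_nonneg by simp
    show "qnorm (qcompletion V) (d \<odot>\<^bsub>qcompletion V\<^esub> x) = norm d * qnorm (qcompletion V) x" for d
    proof (cases "d = 0")
      case True
      then show ?thesis using * c z by (simp add: cls_smult qcompletion_simps(2))
    next
      case False
      \<comment> \<open>The reverse inequality is the same lemma for the inverse scalar.\<close>
      have "qnorm (qcompletion V) (cls (\<lambda>n. inverse d \<odot> (d \<odot> s n))) \<le>
         norm (inverse d) * qnorm (qcompletion V) (cls (\<lambda>n. d \<odot> s n))"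
        by (rule qnorm_cls_smult_le) (use * in \<open>auto intro: qCauchy_smult\<close>)
      also have "cls (\<lambda>n. inverse d \<odot> (d \<odot> s n)) = cls s"
        using c False by (simp add: smult_smult)
      finally have "norm d * qnorm (qcompletion V) (cls s) \<le> qnorm (qcompletion V) (cls (\<lambda>n. d \<odot> s n))"
        using False by (simp add: norm_inverse norm_divide field_simps)
      with qnorm_cls_smult_le[OF *(1), of d] * show ?thesis by (simp add: cls_smult)
    qed
    show "x = \<zero>\<^bsub>qcompletion V\<^esub>" if n: "qnorm (qcompletion V) x = 0"
    proof -
      have "(\<lambda>n. qnorm V (s n)) \<longlonglongrightarrow> 0"
      proof (rule tendstoI)
        fix e :: real assume "e > 0"
        then have "0 < e / (4 * qmod)" by simp
        from qnorm_cls_eventually[OF *(1), of "e / (4 * qmod)"] n * this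
        have "eventually (\<lambda>n. qnorm V (s n) \<le> 2 * qmod * (e / (4 * qmod))) sequentially" by simp
        then show "eventually (\<lambda>n. dist (qnorm V (s n)) 0 < e) sequentially"
        proof eventually_elim
          case (elim n)
          have "2 * qmod * (e / (4 * qmod)) = e / 2" using qmod_pos by (simp add: field_simps del: qmod_pos)
          then show ?case using elim c \<open>e > 0\<close> by simp
        qed
      qed
      then show ?thesis using * c
        by (simp add: qcompletion_simps(2) cls_eq_iff qCauchy_const)
    qed
  next
    fix x y assume "x \<in> carrier (qcompletion V)" "y \<in> carrier (qcompletion V)"
    then obtain r s where *: "r \<in> qCauchy V" "x = cls r" "s \<in> qCauchy V" "y = cls s"
      by (metis qcompletionE)
    let ?N = "qnorm (qcompletion V)"
    show "?N (x \<oplus>\<^bsub>qcompletion V\<^esub> y) \<le> qmod * (?N x + ?N y)"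
    proof (rule field_le_epsilon)
      fix e :: real assume "e > 0"
      define d where "d = e / (2 * qmod)"
      have d: "d > 0" using \<open>e > 0\<close> by (simp add: d_def)
      obtain r' where r': "r' \<in> cls r" "\<And>n. qnorm V (r' n) \<le> ?N x + d"
        using qnorm_cls_lessD[OF *(1), of "?N x + d"] d *(2) by auto
      obtain s' where s': "s' \<in> cls s" "\<And>n. qnorm V (s' n) \<le> ?N y + d"
        using qnorm_cls_lessD[OF *(3), of "?N y + d"] d *(4) by auto
      have "x \<oplus>\<^bsub>qcompletion V\<^esub> y = cls (\<lambda>n. r' n \<oplus> s' n)"
        using cls_add[OF in_clsD(1)[OF r'(1)] in_clsD(1)[OF s'(1)]] in_clsD(2)[OF r'(1)] in_clsD(2)[OF s'(1)] *
        by simp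
      moreover have "?N (cls (\<lambda>n. r' n \<oplus> s' n)) \<le> qmod * ((?N x + d) + (?N y + d))"
        using in_clsD(1)[OF r'(1)] in_clsD(1)[OF s'(1)] r'(2) s'(2)
        by (intro qnorm_cls_le qCauchy_add always_eventually allI qnorm_triangle_le) (auto dest: qCauchyD)
      moreover have "qmod * ((?N x + d) + (?N y + d)) = qmod * (?N x + ?N y) + e"
        using qmod_pos by (simp add: d_def field_simps del: qmod_pos)
      ultimately show "?N (x \<oplus>\<^bsub>qcompletion V\<^esub> y) \<le> qmod * (?N x + ?N y) + e" by simp
    qed
  qed
qed

lemma cls_minus:
  assumes "s \<in> qCauchy V" "t \<in> qCauchy V"
  shows "cls s \<ominus>\<^bsub>qcompletion V\<^esub> cls t = cls (\<lambda>n. s n \<ominus> t n)"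
proof -
  interpret C: qnormed "qcompletion V" by (rule qnormed_qcompletion)
  have "cls s \<ominus>\<^bsub>qcompletion V\<^esub> cls t = cls (\<lambda>n. s n \<oplus> (- 1) \<odot> t n)"
    using assms by (simp add: a_minus_def C.uminus_eq_smult cls_smult cls_add qCauchy_smult)
  then show ?thesis using qCauchyD[OF assms(2)] by (simp add: a_minus_def uminus_eq_smult)
qed

text \<open>Approximate the m-th class within 1/(m+1) by the class of a constant sequence
  \<open>v m\<close>. The sequence v is itself Cauchy in V, and its class is the limit.\<close>

lemma quasi_banach_qcompletion: "quasi_banach (qcompletion V)"
proof -
  let ?W = "qcompletion V"
  let ?N = "qnorm ?W"
  interpret C: qnormed ?W by (rule qnormed_qcompletion)
  have dense: "\<exists>v\<in>carrier V. ?N (a \<ominus>\<^bsub>?W\<^esub> cls (\<lambda>_. v)) \<le> e" if ae: "a \<in> carrier ?W" "e > 0" for a e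
  proof -
    obtain s where s: "s \<in> qCauchy V" "a = cls s" by (rule qcompletionE[OF ae(1)])
    obtain N where N: "\<And>m n. m \<ge> N \<Longrightarrow> n \<ge> N \<Longrightarrow> qnorm V (s m \<ominus> s n) < e"
      using qCauchyE[OF s(1) ae(2)] by metis
    have "?N (cls (\<lambda>n. s n \<ominus> s N)) \<le> e"
      by (rule qnorm_cls_le)
        (use N s qCauchyD[OF s(1)] in \<open>auto simp: eventually_sequentially less_imp_le
          intro!: exI[of _ N] qCauchy_minus qCauchy_const\<close>)
    then show ?thesis using s qCauchyD[OF s(1)]
      by (intro bexI[of _ "s N"]) (simp_all add: cls_minus qCauchy_const)
  qed
  have "\<exists>x\<in>carrier ?W. qconverges ?W a x" if a: "a \<in> qCauchy ?W" for a
  proof -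
    have ac: "a m \<in> carrier ?W" for m using a by (rule C.qCauchyD)
    have "\<forall>m. \<exists>v\<in>carrier V. ?N (a m \<ominus>\<^bsub>?W\<^esub> cls (\<lambda>_. v)) \<le> inverse (Suc m)"
      using dense[OF ac] by simp
    then obtain v where v: "\<And>m. v m \<in> carrier V" "\<And>m. ?N (a m \<ominus>\<^bsub>?W\<^esub> cls (\<lambda>_. v m)) \<le> inverse (Suc m)"
      by metis
    have cv: "cls (\<lambda>_. v m) \<in> carrier ?W" for m using v(1) by (simp add: qCauchy_const)
    have lim0: "(\<lambda>m. inverse (real (Suc m))) \<longlonglongrightarrow> 0" by (rule LIMSEQ_inverse_real_of_nat)
    have vC: "v \<in> qCauchy V" unfolding qCauchy_def
    proof (safe intro!: v(1))
      fix e :: real assume e: "e > 0"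
      \<comment> \<open>The path from \<open>v m\<close> over \<open>a m\<close> and
        \<open>a n\<close> to \<open>v n\<close> has three legs of size d, costing at most
        \<open>3 * C.qmod * C.qmod * d\<close> in the completion; returning to V costs
        \<open>2 * qmod\<close>. The total is e / 2.\<close>
      define d where "d = e / (12 * qmod * C.qmod * C.qmod)"
      have d: "d > 0" using e by (simp add: d_def)
      obtain M where M: "\<And>m n. m \<ge> M \<Longrightarrow> n \<ge> M \<Longrightarrow> ?N (a m \<ominus>\<^bsub>?W\<^esub> a n) < d"
        using C.qCauchyE[OF a d] by metis
      obtain N where N: "\<And>m. m \<ge> N \<Longrightarrow> inverse (real (Suc m)) < d"
        using order_tendstoD(2)[OF lim0 d] by (auto simp: eventually_sequentially)
      have "qnorm V (v m \<ominus> v n) < e" if mn: "m \<ge> max M N" "n \<ge> max M N" for m n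
      proof -
        have 1: "?N (a m \<ominus>\<^bsub>?W\<^esub> cls (\<lambda>_. v n)) \<le> C.qmod * (d + d)"
          by (rule C.qnorm_via[of _ "a n"])
            (use M[of m n] N[of n] v(2)[of n] mn ac cv in \<open>auto simp del: of_nat_Suc\<close>)
        have "?N (cls (\<lambda>_. v m) \<ominus>\<^bsub>?W\<^esub> cls (\<lambda>_. v n)) \<le> C.qmod * (d + C.qmod * (d + d))"
          by (rule C.qnorm_via[of _ "a m"])
            (use N[of m] v(2)[of m] 1 mn ac cv in \<open>auto simp del: of_nat_Suc simp: C.qnorm_minus_commute[OF cv ac]\<close>)
        also have "\<dots> \<le> C.qmod * (C.qmod * d + C.qmod * (d + d))"
          using C.qmod_ge_1 d by (intro mult_left_mono add_right_mono) auto
        finally have "?N (cls (\<lambda>_. v m \<ominus> v n)) \<le> 3 * C.qmod * C.qmod * d"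
          using v(1) by (simp add: cls_minus qCauchy_const algebra_simps)
        then have "2 * qmod * ?N (cls (\<lambda>_. v m \<ominus> v n)) \<le> 2 * qmod * (3 * C.qmod * C.qmod * d)"
          by (intro mult_left_mono) (auto simp: less_imp_le)
        moreover have "2 * qmod * (3 * C.qmod * C.qmod * d) = e / 2"
          using qmod_pos C.qmod_pos by (simp add: d_def field_simps del: qmod_pos C.qmod_pos)
        ultimately show ?thesis
          using qnorm_le_qnorm_cls[of "v m \<ominus> v n"] v(1) e by (simp del: of_nat_Suc)
      qed
      then show "\<exists>N. \<forall>m\<ge>N. \<forall>n\<ge>N. qnorm V (v m \<ominus> v n) < e" by blast
    qed
    have "(\<lambda>m. ?N (cls (\<lambda>_. v m) \<ominus>\<^bsub>?W\<^esub> cls v)) \<longlonglongrightarrow> 0"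
    proof (rule LIMSEQ_I)
      fix r :: real assume r: "0 < r"
      obtain N where N: "\<And>m n. m \<ge> N \<Longrightarrow> n \<ge> N \<Longrightarrow> qnorm V (v m \<ominus> v n) < r / 2"
        using qCauchyE[OF vC, of "r / 2"] r by auto
      have "norm (?N (cls (\<lambda>_. v m) \<ominus>\<^bsub>?W\<^esub> cls v) - 0) < r" if "m \<ge> N" for m
      proof -
        have "?N (cls (\<lambda>n. v m \<ominus> v n)) \<le> r / 2"
          by (rule qnorm_cls_le)
            (use N[OF that] v(1) vC in \<open>auto simp: eventually_sequentially less_imp_le
               intro!: exI[of _ N] qCauchy_minus qCauchy_const\<close>)
        moreover have "0 \<le> ?N (cls (\<lambda>n. v m \<ominus> v n))"
          by (intro qnorm_cls_nonneg qCauchy_minus qCauchy_const v(1) vC)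
        ultimately show ?thesis using r v(1) vC by (simp add: cls_minus qCauchy_const)
      qed
      then show "\<exists>no. \<forall>m\<ge>no. norm (?N (cls (\<lambda>_. v m) \<ominus>\<^bsub>?W\<^esub> cls v) - 0) < r" by blast
    qed
    from tendsto_mult_left[OF tendsto_add[OF lim0 this], of C.qmod]
    have lim: "(\<lambda>m. C.qmod * (inverse (real (Suc m)) + ?N (cls (\<lambda>_. v m) \<ominus>\<^bsub>?W\<^esub> cls v))) \<longlonglongrightarrow> 0"
      by simp
    have "(\<lambda>m. ?N (a m \<ominus>\<^bsub>?W\<^esub> cls v)) \<longlonglongrightarrow> 0"
    proof (rule C.qnull_sandwich[OF lim])
      show "?N (a m \<ominus>\<^bsub>?W\<^esub> cls v) \<le> C.qmod * (inverse (real (Suc m)) + ?N (cls (\<lambda>_. v m) \<ominus>\<^bsub>?W\<^esub> cls v))" for m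
        by (rule C.qnorm_via[of _ "cls (\<lambda>_. v m)"]) (use ac cv vC v(2)[of m] in auto)
    qed (use ac vC in auto)
    then show ?thesis using vC unfolding qconverges_def by blast
  qed
  then show ?thesis using C.quasinormed by (simp add: quasi_banach_def)
qed

lemma operator_cls_const: "operator V (qcompletion V) (\<lambda>x. cls (\<lambda>_. x))"
  unfolding operator_def
proof (intro conjI exI ballI allI)
  fix x assume "x \<in> carrier V"
  then show "qnorm (qcompletion V) (cls (\<lambda>_. x)) \<le> 1 * qnorm V x"
    by (intro qnorm_cls_le qCauchy_const) auto
qed (auto simp: cls_add cls_smult qCauchy_const)

end

subsection \<open>Twisted sums\<close>

locale quasilinear = Y: qbanach Y + X: qbanach X
  for Y :: "('k::real_normed_field, 'y) qspace" and X :: "('k, 'x) qspace" +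
  fixes X0 :: "'x set" and \<Phi> :: "'x \<Rightarrow> 'y"
  assumes X0_subset: "x \<in> X0 \<Longrightarrow> x \<in> carrier X"
    and X0_zero [simp]: "\<zero>\<^bsub>X\<^esub> \<in> X0"
    and X0_add [simp]: "x \<in> X0 \<Longrightarrow> x' \<in> X0 \<Longrightarrow> x \<oplus>\<^bsub>X\<^esub> x' \<in> X0"
    and X0_smult [simp]: "x \<in> X0 \<Longrightarrow> c \<odot>\<^bsub>X\<^esub> x \<in> X0"
    and X0_dense: "x \<in> carrier X \<Longrightarrow> 0 < e \<Longrightarrow> \<exists>x'\<in>X0. qnorm X (x \<ominus>\<^bsub>X\<^esub> x') < e"
    and map_closed [simp]: "x \<in> X0 \<Longrightarrow> \<Phi> x \<in> carrier Y"
    and map_smult: "x \<in> X0 \<Longrightarrow> \<Phi> (c \<odot>\<^bsub>X\<^esub> x) = c \<odot>\<^bsub>Y\<^esub> \<Phi> x"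
    and map_quasi_add: "\<exists>Q. \<forall>x\<in>X0. \<forall>x'\<in>X0.
      qnorm Y (\<Phi> (x \<oplus>\<^bsub>X\<^esub> x') \<ominus>\<^bsub>Y\<^esub> (\<Phi> x \<oplus>\<^bsub>Y\<^esub> \<Phi> x')) \<le> Q * (qnorm X x + qnorm X x')"
begin

abbreviation D where "D \<equiv> twisted_sum Y X X0 \<Phi>"
abbreviation Z where "Z \<equiv> Z_space Y X X0 \<Phi>"

lemma X0_carrier [simp]: "x \<in> X0 \<Longrightarrow> x \<in> carrier X"
  by (rule X0_subset)

lemma X0_minus [simp]: "x \<in> X0 \<Longrightarrow> x' \<in> X0 \<Longrightarrow> x \<ominus>\<^bsub>X\<^esub> x' \<in> X0"
  by (simp add: a_minus_def X.uminus_eq_smult)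

lemma map_zero [simp]: "\<Phi> \<zero>\<^bsub>X\<^esub> = \<zero>\<^bsub>Y\<^esub>"
  using map_smult[of "\<zero>\<^bsub>X\<^esub>" 0] by simp

lemma map_quasi_add_obtain:
  obtains Q where "0 < Q" "\<And>x x'. x \<in> X0 \<Longrightarrow> x' \<in> X0 \<Longrightarrow>
      qnorm Y (\<Phi> (x \<oplus>\<^bsub>X\<^esub> x') \<ominus>\<^bsub>Y\<^esub> (\<Phi> x \<oplus>\<^bsub>Y\<^esub> \<Phi> x')) \<le> Q * (qnorm X x + qnorm X x')"
proof -
  obtain Q where Q: "\<And>x x'. x \<in> X0 \<Longrightarrow> x' \<in> X0 \<Longrightarrow>
      qnorm Y (\<Phi> (x \<oplus>\<^bsub>X\<^esub> x') \<ominus>\<^bsub>Y\<^esub> (\<Phi> x \<oplus>\<^bsub>Y\<^esub> \<Phi> x')) \<le> Q * (qnorm X x + qnorm X x')"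
    using map_quasi_add by blast
  have "qnorm Y (\<Phi> (x \<oplus>\<^bsub>X\<^esub> x') \<ominus>\<^bsub>Y\<^esub> (\<Phi> x \<oplus>\<^bsub>Y\<^esub> \<Phi> x')) \<le> max 1 Q * (qnorm X x + qnorm X x')"
    if "x \<in> X0" "x' \<in> X0" for x x'
    by (rule order_trans[OF Q[OF that]], rule mult_right_mono) (use that in auto)
  then show ?thesis using that[of "max 1 Q"] by auto
qed

lemma D_simps [simp]:
  "carrier D = carrier Y \<times> X0"
  "\<zero>\<^bsub>D\<^esub> = (\<zero>\<^bsub>Y\<^esub>, \<zero>\<^bsub>X\<^esub>)"
  "(y, x) \<oplus>\<^bsub>D\<^esub> (y', x') = (y \<oplus>\<^bsub>Y\<^esub> y', x \<oplus>\<^bsub>X\<^esub> x')"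
  "c \<odot>\<^bsub>D\<^esub> (y, x) = (c \<odot>\<^bsub>Y\<^esub> y, c \<odot>\<^bsub>X\<^esub> x)"
  "qnorm D (y, x) = qnorm Y (y \<ominus>\<^bsub>Y\<^esub> \<Phi> x) + qnorm X x"
  by (simp_all add: twisted_sum_def)

text \<open>The difference y - \<Phi> x is additive up to the Cauchy difference of \<Phi>, and
  quasilinearity bounds the latter by norms of second components, which the quasinorm of D already
  contains.\<close>

lemma qnormed_D: "qnormed D"
proof
  have "Module.module (scalar_ring :: 'k ring) D"
    by (rule module_scalarI)
      (auto simp: Y.a_assoc X.a_assoc Y.smult_add_left X.smult_add_left Y.smult_add_right
        X.smult_add_right Y.smult_smult X.smult_smult intro!: Y.a_comm X.a_comm)
  obtain Q where Q: "0 < Q" "\<And>x x'. x \<in> X0 \<Longrightarrow> x' \<in> X0 \<Longrightarrow>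
      qnorm Y (\<Phi> (x \<oplus>\<^bsub>X\<^esub> x') \<ominus>\<^bsub>Y\<^esub> (\<Phi> x \<oplus>\<^bsub>Y\<^esub> \<Phi> x')) \<le> Q * (qnorm X x + qnorm X x')"
    using map_quasi_add_obtain by metis
  \<comment> \<open>Dominates both coefficients that arise: \<open>Y.qmod * Y.qmod\<close> at the
    first components and \<open>Y.qmod * Q + X.qmod\<close> at the second ones.\<close>
  define C where "C = Y.qmod * (Y.qmod + Q) + X.qmod"
  from \<open>Module.module _ D\<close> show "quasinormed_space D"
  proof (rule quasinormed_spaceI[where C = C])
    fix v assume "v \<in> carrier D"
    then obtain y x where v: "v = (y, x)" "y \<in> carrier Y" "x \<in> X0" by auto
    show "0 \<le> qnorm D v" using v by simp
    show "qnorm D (c \<odot>\<^bsub>D\<^esub> v) = norm c * qnorm D v" for c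
      using v by (simp add: map_smult algebra_simps flip: Y.smult_minus_right)
    assume "qnorm D v = 0"
    then have "qnorm Y (y \<ominus>\<^bsub>Y\<^esub> \<Phi> x) = 0 \<and> qnorm X x = 0"
      using v Y.qnorm_nonneg[of "y \<ominus>\<^bsub>Y\<^esub> \<Phi> x"] X.qnorm_nonneg[of x] by (simp add: add_nonneg_eq_0_iff)
    then have "x = \<zero>\<^bsub>X\<^esub>" "y \<ominus>\<^bsub>Y\<^esub> \<Phi> x = \<zero>\<^bsub>Y\<^esub>" using v by (auto simp: Y.qnorm_eq_0_iff X.qnorm_eq_0_iff)
    then show "v = \<zero>\<^bsub>D\<^esub>" using v by simp
  next
    fix v w assume "v \<in> carrier D" "w \<in> carrier D"
    then obtain y x y' x' where v: "v = (y, x)" "y \<in> carrier Y" "x \<in> X0"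
      and w: "w = (y', x')" "y' \<in> carrier Y" "x' \<in> X0" by auto
    let ?n = "qnorm X x + qnorm X x'"
    let ?a = "y \<ominus>\<^bsub>Y\<^esub> \<Phi> x" and ?a' = "y' \<ominus>\<^bsub>Y\<^esub> \<Phi> x'" and ?d = "\<Phi> (x \<oplus>\<^bsub>X\<^esub> x') \<ominus>\<^bsub>Y\<^esub> (\<Phi> x \<oplus>\<^bsub>Y\<^esub> \<Phi> x')"
    have "(y \<oplus>\<^bsub>Y\<^esub> y') \<ominus>\<^bsub>Y\<^esub> \<Phi> (x \<oplus>\<^bsub>X\<^esub> x') =
      ((y \<oplus>\<^bsub>Y\<^esub> y') \<ominus>\<^bsub>Y\<^esub> (\<Phi> x \<oplus>\<^bsub>Y\<^esub> \<Phi> x')) \<oplus>\<^bsub>Y\<^esub> ((\<Phi> x \<oplus>\<^bsub>Y\<^esub> \<Phi> x') \<ominus>\<^bsub>Y\<^esub> \<Phi> (x \<oplus>\<^bsub>X\<^esub> x'))"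
      using v w by (simp add: Y.minus_telescope)
    also have "\<dots> = (?a \<oplus>\<^bsub>Y\<^esub> ?a') \<ominus>\<^bsub>Y\<^esub> ?d"
      using v w by (simp add: Y.add_minus_add) (simp add: a_minus_def[of Y "(_ \<oplus>\<^bsub>Y\<^esub> _)"] Y.uminus_minus flip: Y.uminus_minus[of "\<Phi> (x \<oplus>\<^bsub>X\<^esub> x')"])
    finally have "qnorm Y ((y \<oplus>\<^bsub>Y\<^esub> y') \<ominus>\<^bsub>Y\<^esub> \<Phi> (x \<oplus>\<^bsub>X\<^esub> x')) \<le>
        Y.qmod * (Y.qmod * (qnorm Y ?a + qnorm Y ?a') + Q * ?n)"
      using v w Q(2)[of x x'] by (auto intro!: Y.qnorm_minus_le Y.qnorm_triangle)
    moreover have "qnorm X (x \<oplus>\<^bsub>X\<^esub> x') \<le> X.qmod * ?n"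
      using v w by (intro X.qnorm_triangle) auto
    moreover have "Y.qmod * (Y.qmod * (qnorm Y ?a + qnorm Y ?a')) \<le> C * (qnorm Y ?a + qnorm Y ?a')"
      using v w Q(1) by (simp only: mult.assoc[symmetric], intro mult_right_mono)
        (auto simp: C_def algebra_simps intro!: add_pos_pos mult_pos_pos less_imp_le)
    moreover have "Y.qmod * (Q * ?n) + X.qmod * ?n \<le> C * ?n"
    proof -
      have "Y.qmod * Q + X.qmod \<le> C" by (simp add: C_def algebra_simps less_imp_le)
      then have "(Y.qmod * Q + X.qmod) * ?n \<le> C * ?n" using v w by (intro mult_right_mono) auto
      then show ?thesis by (simp add: algebra_simps)
    qed
    ultimately show "qnorm D (v \<oplus>\<^bsub>D\<^esub> w) \<le> C * (qnorm D v + qnorm D w)"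
      using v w by (simp add: algebra_simps)
  qed simp
qed

sublocale D: qnormed D by (rule qnormed_D)

lemma D_minus:
  "y \<in> carrier Y \<Longrightarrow> y' \<in> carrier Y \<Longrightarrow> x \<in> X0 \<Longrightarrow> x' \<in> X0 \<Longrightarrow>
   (y, x) \<ominus>\<^bsub>D\<^esub> (y', x') = (y \<ominus>\<^bsub>Y\<^esub> y', x \<ominus>\<^bsub>X\<^esub> x')"
  by (simp add: a_minus_def D.uminus_eq_smult Y.uminus_eq_smult X.uminus_eq_smult)

lemma quasi_banach_Z: "quasi_banach Z"
  unfolding Z_space_def by (rule D.quasi_banach_qcompletion)

sublocale Z: qbanach Z by (rule quasi_banachD[OF quasi_banach_Z])

definition emb :: "'y \<times> 'x \<Rightarrow> (nat \<Rightarrow> 'y \<times> 'x) set" where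
  "emb v = D.cls (\<lambda>_. v)"

sublocale emb: qoperator D Z emb
  by unfold_locales (use D.operator_cls_const in \<open>simp add: emb_def[abs_def] Z_space_def\<close>)

lemma qnorm_le_qnorm_emb: "v \<in> carrier D \<Longrightarrow> qnorm D v \<le> 2 * D.qmod * qnorm Z (emb v)"
  unfolding emb_def Z_space_def by (rule D.qnorm_le_qnorm_cls)

lemma qnorm_emb_le: "v \<in> carrier D \<Longrightarrow> qnorm Z (emb v) \<le> qnorm D v"
  unfolding emb_def Z_space_def by (rule D.qnorm_cls_le[OF D.qCauchy_const]) auto

lemma Z_incl_eq_emb: "Z_incl Y X X0 \<Phi> y = emb (y, \<zero>\<^bsub>X\<^esub>)"
  by (simp add: Z_incl_def emb_def)

lemma operator_Z_incl: "operator Y Z (Z_incl Y X X0 \<Phi>)"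
  unfolding operator_def Z_incl_eq_emb
proof (intro conjI exI ballI allI)
  fix y assume "y \<in> carrier Y"
  then show "qnorm Z (emb (y, \<zero>\<^bsub>X\<^esub>)) \<le> 1 * qnorm Y y"
    using qnorm_emb_le[of "(y, \<zero>\<^bsub>X\<^esub>)"] by simp
qed (auto simp flip: emb.add emb.smult)

lemma Z_incl_kernel: "op_kernel Y Z (Z_incl Y X X0 \<Phi>) = {\<zero>\<^bsub>Y\<^esub>}"
proof -
  have "y = \<zero>\<^bsub>Y\<^esub>" if "y \<in> carrier Y" "emb (y, \<zero>\<^bsub>X\<^esub>) = \<zero>\<^bsub>Z\<^esub>" for y
    using qnorm_le_qnorm_emb[of "(y, \<zero>\<^bsub>X\<^esub>)"] that Y.qnorm_nonneg[of y]
    by (simp add: Y.qnorm_eq_0_iff del: Y.qnorm_nonneg)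
  moreover have "emb (\<zero>\<^bsub>Y\<^esub>, \<zero>\<^bsub>X\<^esub>) = \<zero>\<^bsub>Z\<^esub>" using emb.zero by simp
  ultimately show ?thesis by (auto simp: op_kernel_def Z_incl_eq_emb)
qed

lemma qnorm_snd_le: "v \<in> carrier D \<Longrightarrow> qnorm X (snd v) \<le> qnorm D v"
  by (cases v) auto

lemma snd_minus: "v \<in> carrier D \<Longrightarrow> w \<in> carrier D \<Longrightarrow> snd (v \<ominus>\<^bsub>D\<^esub> w) = snd v \<ominus>\<^bsub>X\<^esub> snd w"
  by (cases v; cases w) (auto simp: D_minus)

lemma snd_carrier: "v \<in> carrier D \<Longrightarrow> snd v \<in> carrier X"
  by auto

lemma Z_E:
  assumes "z \<in> carrier Z"
  obtains s where "s \<in> qCauchy D" "z = D.cls s"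
  using assms D.qcompletionE unfolding Z_space_def by metis

lemma snd_limit:
  assumes s: "s \<in> qCauchy D"
  obtains x where "x \<in> carrier X" "qconverges X (\<lambda>n. snd (s n)) x"
proof -
  have "(\<lambda>n. snd (s n)) \<in> qCauchy X"
    unfolding qCauchy_def
  proof safe
    fix e :: real assume "e > 0"
    then obtain N where N: "\<And>m n. m \<ge> N \<Longrightarrow> n \<ge> N \<Longrightarrow> qnorm D (s m \<ominus>\<^bsub>D\<^esub> s n) < e"
      using D.qCauchyE[OF s] by metis
    have "qnorm X (snd (s m) \<ominus>\<^bsub>X\<^esub> snd (s n)) < e" if "m \<ge> N" "n \<ge> N" for m n
      using qnorm_snd_le[of "s m \<ominus>\<^bsub>D\<^esub> s n"] N[OF that] D.qCauchyD[OF s]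
      by (simp add: snd_minus del: D_simps)
    then show "\<exists>N. \<forall>m\<ge>N. \<forall>n\<ge>N. qnorm X (snd (s m) \<ominus>\<^bsub>X\<^esub> snd (s n)) < e" by blast
  qed (rule snd_carrier, rule D.qCauchyD[OF s])
  then show ?thesis using X.complete that by blast
qed

text \<open>The definition quantifies over all representatives, yet one is enough: the second
  component is dominated by the quasinorm of D, so null-equivalent sequences have the same limit in
  X.\<close>

lemma Z_quot_eqI:
  assumes s: "s \<in> qCauchy D" and x: "x \<in> carrier X" "qconverges X (\<lambda>n. snd (s n)) x"
  shows "Z_quot X (D.cls s) = x"
  unfolding Z_quot_def
proof (rule the_equality)
  have sc: "snd (s n) \<in> carrier X" for n by (rule snd_carrier[OF D.qCauchyD[OF s]])
  have "qconverges X (\<lambda>n. snd (t n)) x" if "t \<in> D.cls s" for t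
  proof -
    have t: "t \<in> qCauchy D" "(\<lambda>n. qnorm D (s n \<ominus>\<^bsub>D\<^esub> t n)) \<longlonglongrightarrow> 0"
      using that by (auto simp: D.null_rel_iff)
    have tc: "snd (t n) \<in> carrier X" for n by (rule snd_carrier[OF D.qCauchyD[OF t(1)]])
    have lim: "(\<lambda>n. X.qmod * (qnorm D (s n \<ominus>\<^bsub>D\<^esub> t n) + qnorm X (snd (s n) \<ominus>\<^bsub>X\<^esub> x))) \<longlonglongrightarrow> 0"
      using t(2) x(2) unfolding qconverges_def by (auto intro!: tendsto_eq_intros)
    show ?thesis unfolding qconverges_def
    proof (rule X.qnull_sandwich[OF lim])
      fix n
      have "qnorm X (snd (t n) \<ominus>\<^bsub>X\<^esub> snd (s n)) \<le> qnorm D (s n \<ominus>\<^bsub>D\<^esub> t n)"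
        using qnorm_snd_le[of "s n \<ominus>\<^bsub>D\<^esub> t n"] D.qCauchyD[OF s] D.qCauchyD[OF t(1)] sc tc
        by (simp add: snd_minus X.qnorm_minus_commute del: D_simps)
      then show "qnorm X (snd (t n) \<ominus>\<^bsub>X\<^esub> x) \<le>
          X.qmod * (qnorm D (s n \<ominus>\<^bsub>D\<^esub> t n) + qnorm X (snd (s n) \<ominus>\<^bsub>X\<^esub> x))"
        by (rule X.qnorm_via[OF tc sc x(1)]) simp
    qed (use tc x in auto)
  qed
  then show "x \<in> carrier X \<and> (\<forall>s\<in>D.cls s. qconverges X (\<lambda>n. snd (s n)) x)" using x by blast
  fix x' assume "x' \<in> carrier X \<and> (\<forall>s\<in>D.cls s. qconverges X (\<lambda>n. snd (s n)) x')"
  then show "x' = x"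
    using X.qconverges_unique[of "\<lambda>n. snd (s n)" x' x] D.self_in_cls[OF s] x sc by blast
qed

lemma Z_quot_emb: "v \<in> carrier D \<Longrightarrow> Z_quot X (emb v) = snd v"
  unfolding emb_def by (rule Z_quot_eqI) (auto simp: D.qCauchy_const qconverges_def snd_carrier simp del: D_simps)

lemma operator_Z_quot: "operator Z X (Z_quot X)"
  unfolding operator_def
proof (intro conjI exI ballI allI)
  show "Z_quot X \<in> carrier Z \<rightarrow> carrier X"
  proof
    fix z assume "z \<in> carrier Z"
    then obtain s where s: "s \<in> qCauchy D" "z = D.cls s" by (metis Z_E)
    obtain x where "x \<in> carrier X" "qconverges X (\<lambda>n. snd (s n)) x" using snd_limit[OF s(1)] by metis
    then show "Z_quot X z \<in> carrier X" using Z_quot_eqI[OF s(1)] s(2) by simp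
  qed
next
  fix z z' assume "z \<in> carrier Z" "z' \<in> carrier Z"
  then obtain s t where st: "s \<in> qCauchy D" "z = D.cls s" "t \<in> qCauchy D" "z' = D.cls t" by (metis Z_E)
  obtain x where x: "x \<in> carrier X" "qconverges X (\<lambda>n. snd (s n)) x" using snd_limit[OF st(1)] by metis
  obtain x' where x': "x' \<in> carrier X" "qconverges X (\<lambda>n. snd (t n)) x'" using snd_limit[OF st(3)] by metis
  have "snd (s n \<oplus>\<^bsub>D\<^esub> t n) = snd (s n) \<oplus>\<^bsub>X\<^esub> snd (t n)" for n
    by (cases "s n"; cases "t n") simp
  then have "qconverges X (\<lambda>n. snd (s n \<oplus>\<^bsub>D\<^esub> t n)) (x \<oplus>\<^bsub>X\<^esub> x')"
    using X.qconverges_add[OF x(2) x'(2)] x x' snd_carrier D.qCauchyD[OF st(1)] D.qCauchyD[OF st(3)]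
    by (simp del: D_simps)
  then have "Z_quot X (D.cls (\<lambda>n. s n \<oplus>\<^bsub>D\<^esub> t n)) = x \<oplus>\<^bsub>X\<^esub> x'"
    by (intro Z_quot_eqI D.qCauchy_add) (use st x x' in auto)
  then show "Z_quot X (z \<oplus>\<^bsub>Z\<^esub> z') = Z_quot X z \<oplus>\<^bsub>X\<^esub> Z_quot X z'"
    using st x x' by (simp add: Z_space_def D.cls_add Z_quot_eqI del: D_simps)
next
  fix c z assume "z \<in> carrier Z"
  then obtain s where st: "s \<in> qCauchy D" "z = D.cls s" by (metis Z_E)
  obtain x where x: "x \<in> carrier X" "qconverges X (\<lambda>n. snd (s n)) x" using snd_limit[OF st(1)] by metis
  have "snd (c \<odot>\<^bsub>D\<^esub> s n) = c \<odot>\<^bsub>X\<^esub> snd (s n)" for n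
    by (cases "s n") simp
  then have "qconverges X (\<lambda>n. snd (c \<odot>\<^bsub>D\<^esub> s n)) (c \<odot>\<^bsub>X\<^esub> x)"
    using X.qconverges_smult[OF x(2)] x snd_carrier D.qCauchyD[OF st(1)]
    by (simp del: D_simps)
  then have "Z_quot X (D.cls (\<lambda>n. c \<odot>\<^bsub>D\<^esub> s n)) = c \<odot>\<^bsub>X\<^esub> x"
    by (intro Z_quot_eqI D.qCauchy_smult) (use st x in auto)
  then show "Z_quot X (c \<odot>\<^bsub>Z\<^esub> z) = c \<odot>\<^bsub>X\<^esub> Z_quot X z"
    using st x by (simp add: Z_space_def D.cls_smult Z_quot_eqI del: D_simps)
next
  fix z assume "z \<in> carrier Z"
  then obtain s where st: "s \<in> qCauchy D" "z = D.cls s" by (metis Z_E)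
  have "qnorm X (Z_quot X z) / X.qmod \<le> qnorm Z z"
  proof (rule dense_ge)
    fix r assume "qnorm Z z < r"
    then obtain t where t: "t \<in> D.cls s" "\<And>n. qnorm D (t n) \<le> r"
      using D.qnorm_cls_lessD[OF st(1)] st(2) unfolding Z_space_def by metis
    have tC: "t \<in> qCauchy D" "D.cls t = z" using D.in_clsD[OF t(1)] st by auto
    obtain x where x: "x \<in> carrier X" "qconverges X (\<lambda>n. snd (t n)) x" using snd_limit[OF tC(1)] by metis
    have tc: "t n \<in> carrier D" "snd (t n) \<in> carrier X" for n
      using D.qCauchyD[OF tC(1)] snd_carrier by blast+
    have "qnorm X (snd (t n)) \<le> r" for n
      using t(2)[of n] qnorm_snd_le[OF tc(1), of n] by linarith
    then have "qnorm X (x \<ominus>\<^bsub>X\<^esub> \<zero>\<^bsub>X\<^esub>) \<le> X.qmod * r"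
      using x tc(2) by (intro X.qconverges_bound[OF x(2)]) auto
    then show "qnorm X (Z_quot X z) / X.qmod \<le> r"
      using Z_quot_eqI[OF tC(1) x] tC(2) x X.qmod_pos by (simp add: field_simps del: X.qmod_pos)
  qed
  then show "qnorm X (Z_quot X z) \<le> X.qmod * qnorm Z z"
    using X.qmod_pos by (simp add: field_simps del: X.qmod_pos)
qed

sublocale quot: qoperator Z X "Z_quot X"
  by unfold_locales (rule operator_Z_quot)

text \<open>For the hard inclusion the second components \<open>b n\<close> tend to 0, so the Cauchy
  difference of \<Phi> at \<open>b m\<close> and \<open>- b n\<close> tends to 0 too, by its bound
  in terms of their norms. This makes the corrected first components Cauchy, and their limit is the
  preimage in Y.\<close>

lemma Z_quot_kernel: "op_kernel Z X (Z_quot X) = Z_incl Y X X0 \<Phi> ` carrier Y"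
proof
  show "Z_incl Y X X0 \<Phi> ` carrier Y \<subseteq> op_kernel Z X (Z_quot X)"
    by (auto simp: op_kernel_def Z_incl_eq_emb Z_quot_emb)
next
  show "op_kernel Z X (Z_quot X) \<subseteq> Z_incl Y X X0 \<Phi> ` carrier Y"
  proof
    fix z assume "z \<in> op_kernel Z X (Z_quot X)"
    then have z: "z \<in> carrier Z" "Z_quot X z = \<zero>\<^bsub>X\<^esub>" by (auto simp: op_kernel_def)
    then obtain s where st: "s \<in> qCauchy D" "z = D.cls s" by (metis Z_E)
    obtain x where x: "x \<in> carrier X" "qconverges X (\<lambda>n. snd (s n)) x" using snd_limit[OF st(1)] by metis
    have "x = \<zero>\<^bsub>X\<^esub>" using Z_quot_eqI[OF st(1) x] z(2) st(2) by simp
    define a b where "a = (\<lambda>n. fst (s n))" and "b = (\<lambda>n. snd (s n))"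
    have sab: "s n = (a n, b n)" for n by (simp add: a_def b_def)
    have ab: "a n \<in> carrier Y" "b n \<in> X0" for n
      using D.qCauchyD[OF st(1), of n] by (auto simp: sab)
    have b0: "(\<lambda>n. qnorm X (b n)) \<longlonglongrightarrow> 0"
      using x(2) ab(2) \<open>x = \<zero>\<^bsub>X\<^esub>\<close> by (simp add: qconverges_def b_def)
    \<comment> \<open>The first components alone need not converge, since \<Phi> need not be small
      at small vectors.\<close>
    define w where "w = (\<lambda>n. a n \<ominus>\<^bsub>Y\<^esub> \<Phi> (b n))"
    have wc: "w n \<in> carrier Y" for n using ab by (simp add: w_def)
    obtain Q where Q: "0 < Q" "\<And>x x'. x \<in> X0 \<Longrightarrow> x' \<in> X0 \<Longrightarrow>
      qnorm Y (\<Phi> (x \<oplus>\<^bsub>X\<^esub> x') \<ominus>\<^bsub>Y\<^esub> (\<Phi> x \<oplus>\<^bsub>Y\<^esub> \<Phi> x')) \<le> Q * (qnorm X x + qnorm X x')"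
      using map_quasi_add_obtain by metis
    have "w \<in> qCauchy Y" unfolding qCauchy_def
    proof (safe intro!: wc)
      fix e :: real assume e: "e > 0"
      define d where "d = e / (2 * Y.qmod * (1 + 2 * Q))"
      have d: "d > 0" using e Q by (simp add: d_def)
      obtain M where M: "\<And>m n. m \<ge> M \<Longrightarrow> n \<ge> M \<Longrightarrow> qnorm D (s m \<ominus>\<^bsub>D\<^esub> s n) < d"
        using D.qCauchyE[OF st(1) d] by metis
      obtain N where N: "\<And>n. n \<ge> N \<Longrightarrow> qnorm X (b n) < d"
        using order_tendstoD(2)[OF b0 d] by (auto simp: eventually_sequentially)
      have "qnorm Y (w m \<ominus>\<^bsub>Y\<^esub> w n) < e" if mn: "m \<ge> max M N" "n \<ge> max M N" for m n
      proof -
        let ?b = "b m \<ominus>\<^bsub>X\<^esub> b n"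
        have 1: "qnorm Y ((a m \<ominus>\<^bsub>Y\<^esub> a n) \<ominus>\<^bsub>Y\<^esub> \<Phi> ?b) \<le> d"
          using M[of m n] mn ab X.qnorm_nonneg[of "b m \<ominus>\<^bsub>X\<^esub> b n"] by (simp add: sab D_minus del: X.qnorm_nonneg)
        have "\<Phi> ((- 1) \<odot>\<^bsub>X\<^esub> b n) = \<ominus>\<^bsub>Y\<^esub> \<Phi> (b n)"
          using ab by (simp add: map_smult Y.uminus_eq_smult)
        then have "qnorm Y (\<Phi> ?b \<ominus>\<^bsub>Y\<^esub> (\<Phi> (b m) \<ominus>\<^bsub>Y\<^esub> \<Phi> (b n))) \<le> Q * (qnorm X (b m) + qnorm X (b n))"
          using Q(2)[of "b m" "(- 1) \<odot>\<^bsub>X\<^esub> b n"] ab by (simp add: a_minus_def X.uminus_eq_smult)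
        also have "\<dots> \<le> Q * (d + d)"
          using N[of m] N[of n] mn Q by (intro mult_left_mono) auto
        finally have 2: "qnorm Y (\<Phi> ?b \<ominus>\<^bsub>Y\<^esub> (\<Phi> (b m) \<ominus>\<^bsub>Y\<^esub> \<Phi> (b n))) \<le> Q * (d + d)" .
        have "qnorm Y ((a m \<ominus>\<^bsub>Y\<^esub> a n) \<ominus>\<^bsub>Y\<^esub> (\<Phi> (b m) \<ominus>\<^bsub>Y\<^esub> \<Phi> (b n))) \<le> Y.qmod * (d + Q * (d + d))"
          by (rule Y.qnorm_via[OF _ _ _ 1 2]) (use ab in auto)
        also have "(a m \<ominus>\<^bsub>Y\<^esub> a n) \<ominus>\<^bsub>Y\<^esub> (\<Phi> (b m) \<ominus>\<^bsub>Y\<^esub> \<Phi> (b n)) = w m \<ominus>\<^bsub>Y\<^esub> w n"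
          using ab by (simp add: w_def Y.minus_minus_minus)
        also have "Y.qmod * (d + Q * (d + d)) = Y.qmod * (1 + 2 * Q) * d"
          by (simp add: algebra_simps)
        also have "\<dots> = e / 2"
        proof -
          define p where "p = Y.qmod * (1 + 2 * Q)"
          have "p > 0" using Q by (simp add: p_def)
          moreover have "d = e / (2 * p)" by (simp add: d_def p_def mult.assoc)
          ultimately show ?thesis unfolding p_def[symmetric] by simp
        qed
        finally show ?thesis using e by simp
      qed
      then show "\<exists>N. \<forall>m\<ge>N. \<forall>n\<ge>N. qnorm Y (w m \<ominus>\<^bsub>Y\<^esub> w n) < e" by blast
    qed
    then obtain y where y: "y \<in> carrier Y" "qconverges Y w y" using Y.complete by blast
    have "(\<lambda>n. qnorm D (s n \<ominus>\<^bsub>D\<^esub> (y, \<zero>\<^bsub>X\<^esub>))) \<longlonglongrightarrow> 0"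
    proof -
      have "s n \<ominus>\<^bsub>D\<^esub> (y, \<zero>\<^bsub>X\<^esub>) = (a n \<ominus>\<^bsub>Y\<^esub> y, b n)" for n
        using ab y by (simp add: sab D_minus)
      moreover have "(a n \<ominus>\<^bsub>Y\<^esub> y) \<ominus>\<^bsub>Y\<^esub> \<Phi> (b n) = w n \<ominus>\<^bsub>Y\<^esub> y" for n
        using ab y by (simp add: w_def a_minus_def Y.a_ac)
      ultimately show ?thesis using tendsto_add[OF y(2)[unfolded qconverges_def] b0] by simp
    qed
    then have "z = emb (y, \<zero>\<^bsub>X\<^esub>)"
      unfolding st(2) emb_def using y st(1) by (subst D.cls_eq_iff) (auto intro!: D.qCauchy_const)
    then show "z \<in> Z_incl Y X X0 \<Phi> ` carrier Y" using y by (auto simp: Z_incl_eq_emb)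
  qed
qed

text \<open>Lifting the approximants to (\<Phi> (a n), a n) need not give a Cauchy sequence. Lifting
  the increments does: (\<Phi> d, d) has exactly the norm of d, and the partial sums of these lifts
  lie over the \<open>a n\<close>. The approximants are chosen with the geometric rate that D
  requires.\<close>

lemma Z_quot_surj: "Z_quot X ` carrier Z = carrier X"
proof
  show "Z_quot X ` carrier Z \<subseteq> carrier X" by auto
  show "carrier X \<subseteq> Z_quot X ` carrier Z"
  proof
    fix x assume x: "x \<in> carrier X"
    define q where "q = 1 / (2 * D.qmod)"
    have q: "0 < q" "q < 1" using D.qmod_ge_1 by (auto simp: q_def field_simps)
    have "\<forall>n. \<exists>x'\<in>X0. qnorm X (x \<ominus>\<^bsub>X\<^esub> x') < q ^ n" using X0_dense[OF x] q by simp
    then obtain a where a: "\<And>n. a n \<in> X0" "\<And>n. qnorm X (x \<ominus>\<^bsub>X\<^esub> a n) < q ^ n" by metis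
    define d where "d = (\<lambda>n. a (Suc n) \<ominus>\<^bsub>X\<^esub> a n)"
    have d: "d n \<in> X0" for n using a by (simp add: d_def)
    define s where "s = rec_nat (\<Phi> (a 0), a 0) (\<lambda>n v. v \<oplus>\<^bsub>D\<^esub> (\<Phi> (d n), d n))"
    have s0: "s 0 = (\<Phi> (a 0), a 0)" and sS: "s (Suc n) = s n \<oplus>\<^bsub>D\<^esub> (\<Phi> (d n), d n)" for n
      by (simp_all add: s_def)
    have sc: "s n \<in> carrier D \<and> snd (s n) = a n" for n
    proof (induction n)
      case 0
      then show ?case using a by (simp add: s0)
    next
      case (Suc n)
      then show ?case using a d by (cases "s n") (auto simp: sS d_def X.add_minus_cancel)
    qed
    have sd: "qnorm D (s (Suc n) \<ominus>\<^bsub>D\<^esub> s n) \<le> (2 * X.qmod) * (1 / (2 * D.qmod)) ^ n" for n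
    proof -
      have "s (Suc n) \<ominus>\<^bsub>D\<^esub> s n = (\<Phi> (d n), d n)"
        unfolding sS using sc[of n] d by (intro D.add_minus_cancel_left) auto
      then have "qnorm D (s (Suc n) \<ominus>\<^bsub>D\<^esub> s n) = qnorm X (a (Suc n) \<ominus>\<^bsub>X\<^esub> a n)"
        using d by (simp add: d_def)
      also have "\<dots> \<le> X.qmod * (q ^ n + q ^ n)"
      proof (rule X.qnorm_via[of _ x])
        have "q ^ Suc n \<le> q ^ n" using q by (simp add: mult_left_le_one_le)
        then show "qnorm X (a (Suc n) \<ominus>\<^bsub>X\<^esub> x) \<le> q ^ n"
          using a x by (metis X.qnorm_minus_commute X0_carrier less_imp_le order_trans)
      qed (use a x in \<open>auto simp: less_imp_le\<close>)
      finally show ?thesis by (simp add: q_def)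
    qed
    have sC: "s \<in> qCauchy D"
      by (rule D.geometric_qCauchy[OF _ sd]) (use sc in \<open>auto simp: less_imp_le\<close>)
    have "(\<lambda>n. qnorm X (a n \<ominus>\<^bsub>X\<^esub> x)) \<longlonglongrightarrow> 0"
    proof (rule X.qnull_sandwich[of "\<lambda>n. q ^ n"])
      show "(\<lambda>n. q ^ n) \<longlonglongrightarrow> 0" using q by (intro LIMSEQ_power_zero) auto
    qed (use a x in \<open>auto simp: less_imp_le X.qnorm_minus_commute[OF _ x]\<close>)
    then have "Z_quot X (D.cls s) = x"
      using sc by (intro Z_quot_eqI[OF sC x]) (simp add: qconverges_def)
    moreover have "D.cls s \<in> carrier Z" unfolding Z_space_def using sC by blast
    ultimately show "x \<in> Z_quot X ` carrier Z" by blast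
  qed
qed

end

subsection \<open>The space \<open>l2\<close>\<close>

lemma l2_simps [simp]:
  "x \<in> carrier l2 \<longleftrightarrow> summable (\<lambda>n. (norm (x n))\<^sup>2)"
  "\<zero>\<^bsub>l2\<^esub> = (\<lambda>_. 0)" "x \<oplus>\<^bsub>l2\<^esub> y = (\<lambda>n. x n + y n)" "c \<odot>\<^bsub>l2\<^esub> x = (\<lambda>n. c * x n)"
  "qnorm l2 x = norm2 x"
  by (simp_all add: l2_def)

text \<open>On finite sets of coordinates the inequalities of Minkowski and Cauchy-Schwarz for
  \<open>L2_set\<close> are at hand; the infinite sum enters only through bounds uniform in the
  finite section.\<close>

abbreviation nrm :: "(nat \<Rightarrow> 'k::real_normed_field) \<Rightarrow> nat set \<Rightarrow> real" where
  "nrm x A \<equiv> L2_set (\<lambda>n. norm (x n)) A"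

lemma nrm_le_norm2:
  assumes "summable (\<lambda>n. (norm (x n))\<^sup>2)" "finite A"
  shows "nrm x A \<le> norm2 x"
  unfolding L2_set_def norm2_def
  by (intro real_sqrt_le_mono sum_le_suminf) (use assms in auto)

lemma norm2_leI:
  assumes "\<And>N. nrm x {..<N} \<le> r"
  shows "summable (\<lambda>n. (norm (x n))\<^sup>2)" "norm2 x \<le> r"
proof -
  have r: "0 \<le> r" using assms[of 0] by simp
  have *: "(\<Sum>n<N. (norm (x n))\<^sup>2) \<le> r\<^sup>2" for N
    using assms[of N] r unfolding L2_set_def by (simp add: real_sqrt_le_iff sqrt_le_D)
  show s: "summable (\<lambda>n. (norm (x n))\<^sup>2)"
    by (rule summableI_nonneg_bounded[where x = "r\<^sup>2"]) (use * in auto)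
  have "(\<Sum>n. (norm (x n))\<^sup>2) \<le> r\<^sup>2" using s * by (rule suminf_le_const)
  then have "norm2 x \<le> sqrt (r\<^sup>2)" unfolding norm2_def by (rule real_sqrt_le_mono)
  then show "norm2 x \<le> r" using r by simp
qed

lemma nrm_triangle: "nrm (\<lambda>n. x n + y n) A \<le> nrm x A + nrm y A"
  by (rule order_trans[OF L2_set_mono L2_set_triangle_ineq]) (auto intro: norm_triangle_ineq)

lemma nrm_triangle_minus: "nrm (\<lambda>n. x n - y n) A \<le> nrm x A + nrm y A"
  by (rule order_trans[OF L2_set_mono L2_set_triangle_ineq]) (auto intro: norm_triangle_ineq4)

lemma nrm_mult: "nrm (\<lambda>n. x n * c) A = norm c * nrm x A"
  by (simp add: norm_mult L2_set_right_distrib mult.commute)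

lemma norm2_triangle:
  assumes "summable (\<lambda>n. (norm (x n))\<^sup>2)" "summable (\<lambda>n. (norm (y n))\<^sup>2)"
  shows "summable (\<lambda>n. (norm (x n + y n))\<^sup>2)" "norm2 (\<lambda>n. x n + y n) \<le> norm2 x + norm2 y"
proof -
  have *: "nrm (\<lambda>n. x n + y n) {..<N} \<le> norm2 x + norm2 y" for N
    by (rule order_trans[OF nrm_triangle add_mono]) (use assms nrm_le_norm2 in auto)
  show "summable (\<lambda>n. (norm (x n + y n))\<^sup>2)" using * by (rule norm2_leI)
  show "norm2 (\<lambda>n. x n + y n) \<le> norm2 x + norm2 y" using * by (rule norm2_leI)
qed

lemma norm2_nonneg: "summable (\<lambda>n. (norm (x n))\<^sup>2) \<Longrightarrow> 0 \<le> norm2 x"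
  unfolding norm2_def by (simp add: suminf_nonneg)

lemma norm2_smult:
  assumes "summable (\<lambda>n. (norm (x n))\<^sup>2)"
  shows "norm2 (\<lambda>n. c * x n) = norm c * norm2 x"
  unfolding norm2_def using assms
  by (simp add: norm_mult power_mult_distrib suminf_mult real_sqrt_mult)

lemma norm_le_norm2:
  assumes "summable (\<lambda>n. (norm (x n))\<^sup>2)"
  shows "norm (x n) \<le> norm2 x"
  using nrm_le_norm2[OF assms, of "{n}"] by simp

lemma qnormed_l2: "qnormed (l2 :: ('k::real_normed_field, nat \<Rightarrow> 'k) qspace)"
proof
  have "Module.module (scalar_ring :: 'k ring) l2"
    by (rule module_scalarI)
      (auto simp: algebra_simps norm2_triangle(1) norm_mult power_mult_distrib)
  then show "quasinormed_space (l2 :: ('k::real_normed_field, nat \<Rightarrow> 'k) qspace)"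
  proof (rule quasinormed_spaceI[where C = 1])
    fix x :: "nat \<Rightarrow> 'k" assume x: "x \<in> carrier l2" "qnorm l2 x = 0"
    have "x n = 0" for n using norm_le_norm2[of x n] x by simp
    then show "x = \<zero>\<^bsub>l2\<^esub>" by auto
  qed (auto simp: norm2_nonneg norm2_smult norm2_triangle norm2_def[of "\<lambda>_. 0"])
qed

interpretation l2: qnormed "l2 :: ('k::real_normed_field, nat \<Rightarrow> 'k) qspace"
  by (rule qnormed_l2)

lemma l2_minus [simp]:
  assumes "summable (\<lambda>n. (norm (y n))\<^sup>2)"
  shows "x \<ominus>\<^bsub>l2\<^esub> y = (\<lambda>n. x n - y n)"
  using assms by (simp add: a_minus_def l2.uminus_eq_smult)

lemma quasi_banach_l2: "quasi_banach (l2 :: ('k::{real_normed_field,banach}, nat \<Rightarrow> 'k) qspace)"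
proof -
  have "\<exists>x\<in>carrier l2. qconverges l2 s x"
    if s: "s \<in> qCauchy l2" for s :: "nat \<Rightarrow> nat \<Rightarrow> 'k"
  proof -
    have sc: "summable (\<lambda>n. (norm (s m n))\<^sup>2)" for m using l2.qCauchyD[OF s, of m] by simp
    have dc: "summable (\<lambda>n. (norm (s m n - s p n))\<^sup>2)" for m p
      using l2.minus_closed[OF l2.qCauchyD[OF s, of m] l2.qCauchyD[OF s, of p]] sc by simp
    have C: "\<exists>N. \<forall>m\<ge>N. \<forall>p\<ge>N. norm2 (\<lambda>n. s m n - s p n) < e" if "e > 0" for e
      using s that sc unfolding qCauchy_def by simp
    have "Cauchy (\<lambda>m. s m n)" for n
    proof (rule CauchyI)
      fix e :: real assume "e > 0"
      from C[OF this] norm_le_norm2[OF dc, where n = n]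
      show "\<exists>M. \<forall>m\<ge>M. \<forall>p\<ge>M. norm (s m n - s p n) < e" by (meson order_le_less_trans)
    qed
    then have "\<forall>n. \<exists>l. (\<lambda>m. s m n) \<longlonglongrightarrow> l" by (simp add: Cauchy_convergent_iff convergent_def)
    then obtain x where x: "\<And>n. (\<lambda>m. s m n) \<longlonglongrightarrow> x n" by metis
    \<comment> \<open>Over a finite section the limit in p can be taken inside the sum; the uniform
      bound then passes to the full norm by \<open>norm2_leI\<close>.\<close>
    have lim: "\<exists>M. \<forall>m\<ge>M. \<forall>N. nrm (\<lambda>n. s m n - x n) {..<N} \<le> e" if e: "e > 0" for e
    proof -
      obtain M where M: "\<And>m p. m \<ge> M \<Longrightarrow> p \<ge> M \<Longrightarrow> norm2 (\<lambda>n. s m n - s p n) < e" using C[OF e] by metis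
      have "nrm (\<lambda>n. s m n - x n) {..<N} \<le> e" if m: "m \<ge> M" for m N
      proof (rule tendsto_upperbound)
        show "(\<lambda>p. nrm (\<lambda>n. s m n - s p n) {..<N}) \<longlonglongrightarrow> nrm (\<lambda>n. s m n - x n) {..<N}"
          unfolding L2_set_def by (intro tendsto_intros x)
        show "\<forall>\<^sub>F p in sequentially. nrm (\<lambda>n. s m n - s p n) {..<N} \<le> e"
          using eventually_ge_at_top[of M]
        proof eventually_elim
          case (elim p)
          then show ?case using nrm_le_norm2[OF dc[of m p], of "{..<N}"] M[OF m elim] by simp
        qed
      qed simp
      then show ?thesis by blast
    qed
    have xl: "summable (\<lambda>n. (norm (x n))\<^sup>2)"
    proof -
      obtain M where "\<And>N. nrm (\<lambda>n. s M n - x n) {..<N} \<le> 1" using lim[of 1] by auto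
      then have "summable (\<lambda>n. (norm (s M n - x n))\<^sup>2)" by (rule norm2_leI)
      then have "(\<lambda>n. s M n - (s M n - x n)) \<in> carrier l2"
        using l2.minus_closed[of "s M" "\<lambda>n. s M n - x n"] sc by simp
      then show ?thesis by simp
    qed
    have "(\<lambda>m. norm2 (\<lambda>n. s m n - x n)) \<longlonglongrightarrow> 0"
    proof (rule LIMSEQ_I)
      fix r :: real assume r: "0 < r"
      then obtain M where M: "\<And>m N. m \<ge> M \<Longrightarrow> nrm (\<lambda>n. s m n - x n) {..<N} \<le> r / 2"
        using lim[of "r / 2"] by auto
      have "norm (norm2 (\<lambda>n. s m n - x n) - 0) < r" if "m \<ge> M" for m
      proof -
        have "norm2 (\<lambda>n. s m n - x n) \<le> r / 2" "summable (\<lambda>n. (norm (s m n - x n))\<^sup>2)"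
          using M[OF that] by (rule norm2_leI)+
        then show ?thesis using r norm2_nonneg[of "\<lambda>n. s m n - x n"] by simp
      qed
      then show "\<exists>no. \<forall>m\<ge>no. norm (norm2 (\<lambda>n. s m n - x n) - 0) < r" by blast
    qed
    then show ?thesis using xl by (intro bexI[of _ x]) (simp_all add: qconverges_def)
  qed
  then show ?thesis using l2.quasinormed by (simp add: quasi_banach_def)
qed

lemma norm2_eq_nrm:
  assumes "finite A" "\<And>n. n \<notin> A \<Longrightarrow> x n = 0"
  shows "norm2 x = nrm x A"
  unfolding norm2_def L2_set_def by (subst suminf_finite[of A]) (use assms in auto)

lemma l2_fin_carrier: "x \<in> l2_fin \<Longrightarrow> summable (\<lambda>n. (norm (x n))\<^sup>2)"
  by (rule summable_finite[of "{n. x n \<noteq> 0}"]) (auto simp: l2_fin_def)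

lemma l2_finI: "finite A \<Longrightarrow> (\<And>n. n \<notin> A \<Longrightarrow> x n = 0) \<Longrightarrow> x \<in> l2_fin"
  unfolding l2_fin_def by (auto intro: finite_subset[of _ A])

lemma l2_fin_add: "x \<in> l2_fin \<Longrightarrow> y \<in> l2_fin \<Longrightarrow> (\<lambda>n. x n + y n) \<in> l2_fin"
  by (rule l2_finI[of "{n. x n \<noteq> 0} \<union> {n. y n \<noteq> 0}"]) (auto simp: l2_fin_def)

lemma l2_fin_smult: "x \<in> l2_fin \<Longrightarrow> (\<lambda>n. c * x n) \<in> l2_fin"
  by (rule l2_finI[of "{n. x n \<noteq> 0}"]) (auto simp: l2_fin_def)

lemma l2_fin_dense:
  assumes x: "summable (\<lambda>n. (norm (x n))\<^sup>2)" and e: "0 < e"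
  shows "\<exists>y\<in>l2_fin. norm2 (\<lambda>n. x n - y n) < e"
proof -
  let ?f = "\<lambda>n. (norm (x n))\<^sup>2"
  have "(\<lambda>N. \<Sum>n<N. ?f n) \<longlonglongrightarrow> suminf ?f" using x by (rule summable_LIMSEQ)
  then have "eventually (\<lambda>N. suminf ?f - e\<^sup>2 < (\<Sum>n<N. ?f n)) sequentially"
    by (rule order_tendstoD) (use e in auto)
  then obtain N where N: "suminf ?f - e\<^sup>2 < (\<Sum>n<N. ?f n)" by (auto simp: eventually_sequentially)
  define y where "y = (\<lambda>n. if n < N then x n else 0)"
  have y: "y \<in> l2_fin" by (rule l2_finI[of "{..<N}"]) (auto simp: y_def)
  have "(\<Sum>n. (norm (x n - y n))\<^sup>2) = (\<Sum>n. ?f n - (norm (y n))\<^sup>2)"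
    by (rule arg_cong[of _ _ suminf]) (auto simp: y_def)
  also have "\<dots> = suminf ?f - (\<Sum>n. (norm (y n))\<^sup>2)"
    by (rule suminf_diff[symmetric]) (use x y l2_fin_carrier in auto)
  also have "(\<Sum>n. (norm (y n))\<^sup>2) = (\<Sum>n<N. ?f n)"
    by (subst suminf_finite[of "{..<N}"]) (auto simp: y_def)
  also have "suminf ?f - (\<Sum>n<N. ?f n) < e\<^sup>2" using N by simp
  finally have "norm2 (\<lambda>n. x n - y n) < sqrt (e\<^sup>2)" unfolding norm2_def by (rule real_sqrt_less_mono)
  then show ?thesis using y e by auto
qed

subsection \<open>Quasilinearity of the Kalton--Peck maps\<close>

text \<open>From - ln t \<le> 1/t - 1. This boundedness of t ln t is the analytic source of the
  quasilinearity of both maps.\<close>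

lemma mult_abs_ln_le:
  fixes t :: real
  assumes "0 \<le> t" "t \<le> 1"
  shows "t * \<bar>ln t\<bar> \<le> 1"
proof (cases "t = 0")
  case False
  then have t: "0 < t" using assms by simp
  have "- ln t \<le> inverse t - 1" using ln_le_minus_one[of "inverse t"] t by (simp add: ln_inverse)
  then have "t * (- ln t) \<le> t * (inverse t - 1)" using t by (intro mult_left_mono) auto
  also have "\<dots> = 1 - t" using t by (simp add: algebra_simps)
  finally show ?thesis using t assms by (simp add: abs_if)
qed simp

lemma nrm_mult_ln_le:
  assumes "0 < s" "nrm u A \<le> s"
  shows "nrm (\<lambda>n. u n * of_real (ln (nrm u A / s))) A \<le> s"
proof -
  have "nrm (\<lambda>n. u n * of_real (ln (nrm u A / s))) A = s * ((nrm u A / s) * \<bar>ln (nrm u A / s)\<bar>)"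
    using assms by (subst nrm_mult) simp
  also have "\<dots> \<le> s * 1" using assms by (intro mult_left_mono mult_abs_ln_le) auto
  finally show ?thesis by simp
qed

text \<open>Dividing every norm inside the logarithm by the sum s of the two norms changes the map
  by the linear term z ln s, which cancels in the Cauchy difference. Each of the three remaining
  terms has norm s t |ln t| with t \<le> 1, hence the constant 3.\<close>

lemma mult_ln_nrm_quasi_additive:
  fixes u v :: "nat \<Rightarrow> 'k::real_normed_field"
  assumes "finite A"
  shows "nrm (\<lambda>n. (u n + v n) * of_real (ln (nrm (\<lambda>n. u n + v n) A))
      - u n * of_real (ln (nrm u A)) - v n * of_real (ln (nrm v A))) A \<le> 3 * (nrm u A + nrm v A)"
    (is "nrm ?E A \<le> _")
proof -
  let ?w = "\<lambda>n. u n + v n"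
  define s where "s = nrm u A + nrm v A"
  have nn: "0 \<le> nrm u A" "0 \<le> nrm v A" by auto
  show ?thesis
  proof (cases "s = 0")
    case True
    then have "nrm u A = 0" "nrm v A = 0" using nn by (auto simp: s_def simp del: L2_set_nonneg)
    then have "u n = 0" "v n = 0" if "n \<in> A" for n
      using assms that by (auto simp: L2_set_eq_0_iff)
    then have "nrm ?E A = 0" using assms by (subst L2_set_eq_0_iff) auto
    then show ?thesis using nn by simp
  next
    case False
    then have s: "0 < s" using nn unfolding s_def by linarith
    \<comment> \<open>If the norm is 0 then z vanishes on A, and the value of the logarithm is
      immaterial.\<close>
    have ln: "z n * of_real (ln (nrm z A / s)) = z n * of_real (ln (nrm z A)) - z n * of_real (ln s)"
      if "n \<in> A" for n and z :: "nat \<Rightarrow> 'k"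
    proof (cases "nrm z A = 0")
      case True
      then show ?thesis using assms that by (auto simp: L2_set_eq_0_iff)
    next
      case False
      then have "0 < nrm z A" using L2_set_nonneg by (simp add: less_le)
      then show ?thesis using s by (simp add: ln_div algebra_simps)
    qed
    let ?F = "\<lambda>n. ?w n * of_real (ln (nrm ?w A / s)) - u n * of_real (ln (nrm u A / s))
        - v n * of_real (ln (nrm v A / s))"
    have "nrm ?E A = nrm ?F A"
    proof (rule L2_set_cong)
      fix n assume n: "n \<in> A"
      show "norm (?E n) = norm (?F n)"
        unfolding ln[OF n, of u] ln[OF n, of v] ln[OF n, of ?w] by (simp add: algebra_simps)
    qed simp
    also have "\<dots> \<le> (s + s) + s"
    proof (rule order_trans[OF nrm_triangle_minus add_mono])
      show "nrm (\<lambda>n. ?w n * of_real (ln (nrm ?w A / s)) - u n * of_real (ln (nrm u A / s))) A \<le> s + s"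
        by (rule order_trans[OF nrm_triangle_minus add_mono]; rule nrm_mult_ln_le[OF s])
          (use nn nrm_triangle[of u v A] in \<open>auto simp: s_def\<close>)
      show "nrm (\<lambda>n. v n * of_real (ln (nrm v A / s))) A \<le> s"
        by (rule nrm_mult_ln_le[OF s]) (use nn in \<open>auto simp: s_def\<close>)
    qed
    finally show ?thesis by (simp add: s_def)
  qed
qed

section \<open>Blocks of a partition and the block map\<close>

lemma partition_block_unique:
  "partition_on UNIV P \<Longrightarrow> B \<in> P \<Longrightarrow> B' \<in> P \<Longrightarrow> n \<in> B \<Longrightarrow> n \<in> B' \<Longrightarrow> B = B'"
  by (auto simp: partition_on_def disjoint_def)

lemma the_block_eq:
  assumes "partition_on UNIV P" "B \<in> P" "n \<in> B"
  shows "(THE B. B \<in> P \<and> n \<in> B) = B"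
proof (rule the_equality)
  fix C assume "C \<in> P \<and> n \<in> C"
  then show "C = B" using partition_block_unique[OF assms(1), of C B n] assms by simp
qed (use assms in simp)

lemma finite_blocks_meeting:
  assumes "partition_on UNIV P" "finite A"
  shows "finite {B \<in> P. B \<inter> A \<noteq> {}}"
proof -
  have "{B \<in> P. B \<inter> A \<noteq> {}} \<subseteq> (\<lambda>n. THE B. B \<in> P \<and> n \<in> B) ` A"
  proof
    fix B assume "B \<in> {B \<in> P. B \<inter> A \<noteq> {}}"
    then obtain n where n: "B \<in> P" "n \<in> B" "n \<in> A" by auto
    then show "B \<in> (\<lambda>n. THE B. B \<in> P \<and> n \<in> B) ` A"
      using the_block_eq[OF assms(1)] by (intro image_eqI[of _ _ n]) simp_all
  qed
  then show ?thesis using assms(2) finite_surj by blast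
qed

lemma kalton_peck_blocks_eq:
  fixes x :: "nat \<Rightarrow> 'k::real_normed_field"
  assumes P: "partition_on UNIV P" and x: "x \<in> l2_fin" and B: "B \<in> P" "n \<in> B"
  shows "kalton_peck_blocks P x n = x n * of_real (ln (norm2 x / norm2 (restrict_to x B)))"
proof -
  define F where "F = {B. B \<in> P \<and> restrict_to x B \<noteq> (\<lambda>_. 0)}"
  let ?c = "x n * of_real (ln (norm2 x / norm2 (restrict_to x B)))"
  have "F \<subseteq> {B \<in> P. B \<inter> {n. x n \<noteq> 0} \<noteq> {}}"
    by (auto simp: F_def restrict_to_def fun_eq_iff indicator_def split: if_splits)
  then have fin: "finite F"
    using finite_blocks_meeting[OF P, of "{n. x n \<noteq> 0}"] x finite_subset by (auto simp: l2_fin_def)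
  have "kalton_peck_blocks P x n = (\<Sum>B'\<in>F. if B' = B then ?c else 0)"
    unfolding kalton_peck_blocks_def F_def
  proof (rule sum.cong)
    fix B' assume "B' \<in> {B. B \<in> P \<and> restrict_to x B \<noteq> (\<lambda>_. 0)}"
    then have "n \<in> B' \<Longrightarrow> B' = B" using partition_block_unique[OF P, of B' B n] B by simp
    then show "restrict_to x B' n * of_real (ln (norm2 x / norm2 (restrict_to x B'))) = (if B' = B then ?c else 0)"
      using B by (cases "n \<in> B'") (auto simp: restrict_to_def)
  qed simp
  also have "\<dots> = (if B \<in> F then ?c else 0)" using fin by simp
  also have "\<dots> = ?c"
  proof (cases "B \<in> F")
    case False
    then have "restrict_to x B n = 0" using B by (auto simp: F_def)
    then show ?thesis using B by (simp add: restrict_to_def)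
  qed simp
  finally show ?thesis .
qed

lemma norm2_restrict_to:
  assumes "finite A" "\<And>n. n \<notin> A \<Longrightarrow> x n = 0"
  shows "norm2 (restrict_to x B) = nrm x (A \<inter> B)"
proof -
  have "norm2 (restrict_to x B) = nrm (restrict_to x B) (A \<inter> B)"
    by (rule norm2_eq_nrm) (use assms in \<open>auto simp: restrict_to_def indicator_def\<close>)
  also have "\<dots> = nrm x (A \<inter> B)" by (rule L2_set_cong) (auto simp: restrict_to_def)
  finally show ?thesis .
qed

lemma partition_singletons: "partition_on UNIV (range (\<lambda>n::nat. {n}))"
  by (auto simp: partition_on_def disjoint_def)

text \<open>The Kalton-Peck map is the block map of the partition into singletons, so one set of
  estimates serves both maps.\<close>

lemma kalton_peck_eq_blocks:
  assumes "x \<in> l2_fin"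
  shows "kalton_peck x = kalton_peck_blocks (range (\<lambda>n. {n})) x"
proof
  fix n
  have "norm2 (restrict_to x {n}) = norm (x n)"
    by (subst norm2_eq_nrm[of "{n}"]) (auto simp: restrict_to_def)
  then show "kalton_peck x n = kalton_peck_blocks (range (\<lambda>n. {n})) x n"
    by (subst kalton_peck_blocks_eq[OF partition_singletons assms, of "{n}"])
      (auto simp: kalton_peck_def)
qed

text \<open>Separating the quotient inside the logarithm exhibits the block map as a difference of
  two instances of z ln |z|, one over the whole support and one inside each block.\<close>

lemma kalton_peck_blocks_split:
  assumes P: "partition_on UNIV P" and A: "finite A" "\<And>n. n \<notin> A \<Longrightarrow> x n = 0" and B: "B \<in> P" "n \<in> B"
  shows "kalton_peck_blocks P x n = x n * of_real (ln (nrm x A)) - x n * of_real (ln (nrm x (A \<inter> B)))"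
proof (cases "x n = 0")
  case True
  then show ?thesis using kalton_peck_blocks_eq[OF P l2_finI[OF A] B] by simp
next
  case False
  then have n: "n \<in> A \<inter> B" using A B by auto
  then have "norm (x n) \<le> nrm x (A \<inter> B)" "norm (x n) \<le> nrm x A"
    using member_le_L2_set[of _ n "\<lambda>n. norm (x n)"] A(1) by auto
  then have "0 < nrm x (A \<inter> B)" "0 < nrm x A" using False by (auto intro: less_le_trans[of 0 "norm (x n)"])
  then show ?thesis
    using kalton_peck_blocks_eq[OF P l2_finI[OF A] B] norm2_eq_nrm[OF A] norm2_restrict_to[OF A, where B = B]
    by (simp add: ln_div algebra_simps)
qed

lemma nrm_blocks:
  assumes P: "partition_on UNIV P" and A: "finite A"
  shows "L2_set (\<lambda>B. nrm x (A \<inter> B)) {B \<in> P. B \<inter> A \<noteq> {}} = nrm x A"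
proof -
  let ?PA = "{B \<in> P. B \<inter> A \<noteq> {}}"
  have "(\<Sum>B\<in>?PA. (nrm x (A \<inter> B))\<^sup>2) = (\<Sum>B\<in>?PA. \<Sum>n\<in>A \<inter> B. (norm (x n))\<^sup>2)"
    unfolding L2_set_def by (rule sum.cong) (auto simp: sum_nonneg)
  also have "\<dots> = (\<Sum>n\<in>(\<Union>B\<in>?PA. A \<inter> B). (norm (x n))\<^sup>2)"
    by (rule sum.UNION_disjoint[symmetric])
      (use finite_blocks_meeting[OF P A] A in \<open>auto dest: partition_block_unique[OF P]\<close>)
  also have "(\<Union>B\<in>?PA. A \<inter> B) = A"
    using P by (auto simp: partition_on_def)
  finally show ?thesis unfolding L2_set_def[of _ ?PA] L2_set_def[of _ A] by simp
qed

text \<open>The constant 6 is 3 for the whole support plus 3 for the blocks. The second part applies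
  the same estimate in every block and takes the Euclidean sum over blocks, which preserves the
  constant.\<close>

lemma kalton_peck_blocks_quasi_additive:
  fixes x y :: "nat \<Rightarrow> 'k::real_normed_field"
  assumes P: "partition_on UNIV P" and x: "x \<in> l2_fin" and y: "y \<in> l2_fin"
  shows "norm2 (\<lambda>n. kalton_peck_blocks P (\<lambda>n. x n + y n) n
      - (kalton_peck_blocks P x n + kalton_peck_blocks P y n)) \<le> 6 * (norm2 x + norm2 y)"
proof -
  define A where "A = {n. x n \<noteq> 0} \<union> {n. y n \<noteq> 0}"
  have A: "finite A" "\<And>n. n \<notin> A \<Longrightarrow> x n = 0" "\<And>n. n \<notin> A \<Longrightarrow> y n = 0" "\<And>n. n \<notin> A \<Longrightarrow> x n + y n = 0"
    using x y by (auto simp: A_def l2_fin_def)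
  let ?z = "\<lambda>n. x n + y n"
  define bl where "bl n = (THE B. B \<in> P \<and> n \<in> B)" for n
  have bl_eq: "bl n = B" if "B \<in> P" "n \<in> B" for n B
    unfolding bl_def using P that by (rule the_block_eq)
  have bl: "bl n \<in> P" "n \<in> bl n" for n
    using P bl_eq unfolding partition_on_def by (metis UNIV_I UnionE)+
  let ?G = "\<lambda>S n. ?z n * of_real (ln (nrm ?z S)) - x n * of_real (ln (nrm x S)) - y n * of_real (ln (nrm y S))"
  let ?PA = "{B \<in> P. B \<inter> A \<noteq> {}}"
  let ?E = "\<lambda>n. kalton_peck_blocks P ?z n - (kalton_peck_blocks P x n + kalton_peck_blocks P y n)"
  have E: "?E n = ?G A n - ?G (A \<inter> bl n) n" for n
    by (subst (1 2 3) kalton_peck_blocks_split[OF P A(1) _ bl]) (use A in \<open>auto simp: algebra_simps\<close>)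
  have "norm2 ?E = nrm ?E A"
    by (rule norm2_eq_nrm) (use A E in auto)
  also have "\<dots> \<le> nrm (?G A) A + nrm (\<lambda>n. ?G (A \<inter> bl n) n) A"
    unfolding E by (rule nrm_triangle_minus)
  also have "nrm (?G A) A \<le> 3 * (nrm x A + nrm y A)"
    by (rule mult_ln_nrm_quasi_additive[OF A(1)])
  also have "nrm (\<lambda>n. ?G (A \<inter> bl n) n) A \<le> 3 * (nrm x A + nrm y A)"
  proof -
    have "nrm (\<lambda>n. ?G (A \<inter> bl n) n) A = L2_set (\<lambda>B. nrm (\<lambda>n. ?G (A \<inter> bl n) n) (A \<inter> B)) ?PA"
      by (rule nrm_blocks[OF P A(1), symmetric])
    also have "\<dots> \<le> L2_set (\<lambda>B. 3 * (nrm x (A \<inter> B) + nrm y (A \<inter> B))) ?PA"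
    proof (rule L2_set_mono)
      fix B assume B: "B \<in> ?PA"
      have "nrm (\<lambda>n. ?G (A \<inter> bl n) n) (A \<inter> B) = nrm (?G (A \<inter> B)) (A \<inter> B)"
        by (rule L2_set_cong) (use B bl_eq in auto)
      also have "\<dots> \<le> 3 * (nrm x (A \<inter> B) + nrm y (A \<inter> B))"
        by (rule mult_ln_nrm_quasi_additive) (use A in auto)
      finally show "nrm (\<lambda>n. ?G (A \<inter> bl n) n) (A \<inter> B) \<le> 3 * (nrm x (A \<inter> B) + nrm y (A \<inter> B))" .
    qed auto
    also have "\<dots> = 3 * L2_set (\<lambda>B. nrm x (A \<inter> B) + nrm y (A \<inter> B)) ?PA"
      by (rule L2_set_right_distrib[symmetric]) simp
    also have "\<dots> \<le> 3 * (L2_set (\<lambda>B. nrm x (A \<inter> B)) ?PA + L2_set (\<lambda>B. nrm y (A \<inter> B)) ?PA)"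
      by (intro mult_left_mono L2_set_triangle_ineq) auto
    finally show ?thesis unfolding nrm_blocks[OF P A(1)] .
  qed
  finally show ?thesis using norm2_eq_nrm[OF A(1,2)] norm2_eq_nrm[OF A(1,3)] by simp
qed

lemma kalton_peck_blocks_zero_coord:
  assumes "partition_on UNIV P" "x \<in> l2_fin" "x n = 0"
  shows "kalton_peck_blocks P x n = 0"
proof -
  obtain B where "B \<in> P" "n \<in> B" using assms(1) unfolding partition_on_def by blast
  then show ?thesis using kalton_peck_blocks_eq[OF assms(1,2)] assms(3) by simp
qed

lemma kalton_peck_blocks_l2_fin:
  assumes "partition_on UNIV P" "x \<in> l2_fin"
  shows "kalton_peck_blocks P x \<in> l2_fin"
  by (rule l2_finI[of "{n. x n \<noteq> 0}"])
    (use assms kalton_peck_blocks_zero_coord in \<open>auto simp: l2_fin_def\<close>)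

lemma kalton_peck_blocks_smult:
  fixes x :: "nat \<Rightarrow> 'k::real_normed_field"
  assumes P: "partition_on UNIV P" and x: "x \<in> l2_fin"
  shows "kalton_peck_blocks P (\<lambda>n. c * x n) = (\<lambda>n. c * kalton_peck_blocks P x n)"
proof
  fix n
  obtain B where B: "B \<in> P" "n \<in> B" using P unfolding partition_on_def by blast
  have "restrict_to x B \<in> l2_fin"
    by (rule l2_finI[of "{n. x n \<noteq> 0}"]) (use x in \<open>auto simp: l2_fin_def restrict_to_def\<close>)
  moreover have "restrict_to (\<lambda>n. c * x n) B = (\<lambda>n. c * restrict_to x B n)"
    by (simp add: restrict_to_def mult.assoc)
  ultimately have "norm2 (restrict_to (\<lambda>n. c * x n) B) = norm c * norm2 (restrict_to x B)"
    by (simp add: norm2_smult l2_fin_carrier)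
  then show "kalton_peck_blocks P (\<lambda>n. c * x n) n = c * kalton_peck_blocks P x n"
    using kalton_peck_blocks_eq[OF P x B] kalton_peck_blocks_eq[OF P l2_fin_smult[OF x] B, of c]
      norm2_smult[OF l2_fin_carrier[OF x], of c]
    by (cases "c = 0") auto
qed

lemma quasilinear_kalton_peck_blocks:
  assumes "partition_on UNIV P"
  shows "quasilinear l2 (l2 :: ('k::{real_normed_field,banach}, nat \<Rightarrow> 'k) qspace) l2_fin (kalton_peck_blocks P)"
proof -
  interpret L: qbanach "l2 :: ('k, nat \<Rightarrow> 'k) qspace" by (rule quasi_banachD[OF quasi_banach_l2])
  show ?thesis
  proof
    fix x :: "nat \<Rightarrow> 'k" and e :: real assume "x \<in> carrier l2" "0 < e"
    then obtain y where "y \<in> l2_fin" "norm2 (\<lambda>n. x n - y n) < e" using l2_fin_dense[of x e] by auto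
    then show "\<exists>y\<in>l2_fin. qnorm l2 (x \<ominus>\<^bsub>l2\<^esub> y) < e"
      by (intro bexI[of _ y]) (simp_all add: l2_fin_carrier)
  next
    show "\<exists>Q. \<forall>x\<in>l2_fin. \<forall>x'\<in>l2_fin.
       qnorm l2 (kalton_peck_blocks P (x \<oplus>\<^bsub>l2\<^esub> x') \<ominus>\<^bsub>l2\<^esub>
         (kalton_peck_blocks P x \<oplus>\<^bsub>l2\<^esub> kalton_peck_blocks P (x' :: nat \<Rightarrow> 'k)))
       \<le> Q * (qnorm l2 x + qnorm l2 x')"
      by (intro exI[of _ 6] ballI)
        (simp add: l2_fin_carrier l2_fin_add kalton_peck_blocks_l2_fin[OF assms]
          kalton_peck_blocks_quasi_additive[OF assms] del: distrib_left_numeral)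
  qed (auto simp: l2_fin_carrier l2_fin_add l2_fin_smult kalton_peck_blocks_l2_fin[OF assms]
      kalton_peck_blocks_smult[OF assms] intro: l2_finI[of "{}"])
qed

lemma quasilinear_cong:
  assumes "quasilinear Y X X0 \<Phi>" "\<And>x. x \<in> X0 \<Longrightarrow> \<Psi> x = \<Phi> x"
  shows "quasilinear Y X X0 \<Psi>"
  using assms unfolding quasilinear_def quasilinear_axioms_def by simp

lemma quasilinear_kalton_peck:
  "quasilinear l2 (l2 :: ('k::{real_normed_field,banach}, nat \<Rightarrow> 'k) qspace) l2_fin kalton_peck"
  by (rule quasilinear_cong[OF quasilinear_kalton_peck_blocks[OF partition_singletons] kalton_peck_eq_blocks])

lemma kalton_peck_l2_fin: "x \<in> l2_fin \<Longrightarrow> kalton_peck x \<in> l2_fin"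
  using kalton_peck_blocks_l2_fin[OF partition_singletons] by (simp add: kalton_peck_eq_blocks)

subsection \<open>The combinatorial obstruction\<close>

text \<open>S marks the negative coordinates independently of the support F, so one S gives
  compatible signs to all supports at once and sign vectors of disjoint supports add up.\<close>

definition sgv :: "nat set \<Rightarrow> nat set \<Rightarrow> nat \<Rightarrow> 'k::real_normed_field" where
  "sgv S F = (\<lambda>k. if k \<in> F then (if k \<in> S then - 1 else 1) else 0)"

lemma sgv_l2_fin: "finite F \<Longrightarrow> sgv S F \<in> l2_fin"
  by (rule l2_finI[of F]) (auto simp: sgv_def)

lemma norm_sgv: "k \<in> F \<Longrightarrow> norm (sgv S F k) = 1"
  by (simp add: sgv_def)

lemma nrm_sgv: "nrm (sgv S F :: nat \<Rightarrow> 'k::real_normed_field) (F \<inter> B) = sqrt (card (F \<inter> B))"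
proof -
  have "nrm (sgv S F :: nat \<Rightarrow> 'k) (F \<inter> B) = L2_set (\<lambda>_. 1) (F \<inter> B)"
    by (rule L2_set_cong) (auto simp: norm_sgv)
  then show ?thesis by (simp add: L2_set_constant)
qed

lemma norm2_sgv: "finite F \<Longrightarrow> norm2 (sgv S F :: nat \<Rightarrow> 'k::real_normed_field) = sqrt (card F)"
  using nrm_sgv[of S F UNIV] by (subst norm2_eq_nrm[of F]) (auto simp: sgv_def)

lemma sgv_union: "F \<inter> F' = {} \<Longrightarrow> sgv S (F \<union> F') k = sgv S F k + sgv S F' k"
  by (auto simp: sgv_def)

lemma kalton_peck_sgv:
  assumes "finite F"
  shows "kalton_peck (sgv S F :: nat \<Rightarrow> 'k::real_normed_field) n = sgv S F n * of_real (ln (sqrt (card F)))"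
  using norm2_sgv[OF assms, of S, where 'k = 'k] norm_sgv[of n F S, where 'a = 'k]
  by (cases "n \<in> F") (auto simp: kalton_peck_def sgv_def)

text \<open>The premise \<open>unif\<close> says, without a division, that F is spread evenly over p
  blocks. The whole then has norm sqrt p times that of each piece, so the map multiplies by ln sqrt
  p; off F both sides vanish.\<close>

lemma kalton_peck_blocks_sgv:
  assumes P: "partition_on UNIV P" and F: "finite F" and p: "0 < p"
    and unif: "\<And>B. B \<in> P \<Longrightarrow> F \<inter> B \<noteq> {} \<Longrightarrow> card (F \<inter> B) * p = card F"
  shows "kalton_peck_blocks P (sgv S F :: nat \<Rightarrow> 'k::real_normed_field) n = sgv S F n * of_real (ln (real p) / 2)"
proof (cases "n \<in> F")
  case True
  obtain B where B: "B \<in> P" "n \<in> B" using P unfolding partition_on_def by blast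
  have ne: "F \<inter> B \<noteq> {}" using True B by auto
  then have pos: "0 < card (F \<inter> B)" using F by (simp add: card_gt_0_iff)
  have "norm2 (restrict_to (sgv S F :: nat \<Rightarrow> 'k) B) = nrm (sgv S F :: nat \<Rightarrow> 'k) (F \<inter> B)"
    by (rule norm2_restrict_to[OF F]) (simp add: sgv_def)
  then have "norm2 (restrict_to (sgv S F :: nat \<Rightarrow> 'k) B) = sqrt (card (F \<inter> B))" by (simp add: nrm_sgv)
  moreover have "norm2 (sgv S F :: nat \<Rightarrow> 'k) = sqrt (card (F \<inter> B)) * sqrt p"
    using norm2_sgv[OF F, of S, where 'k = 'k] unif[OF B(1) ne]
    by (simp flip: real_sqrt_mult of_nat_mult)
  ultimately have "norm2 (sgv S F :: nat \<Rightarrow> 'k) / norm2 (restrict_to (sgv S F :: nat \<Rightarrow> 'k) B) = sqrt p"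
    using pos by simp
  then show ?thesis
    using kalton_peck_blocks_eq[OF P sgv_l2_fin[OF F] B, of S, where 'k = 'k] p by (simp add: ln_sqrt)
next
  case False
  then show ?thesis
    using kalton_peck_blocks_zero_coord[OF P sgv_l2_fin[OF F], of S n, where 'a = 'k] by (simp add: sgv_def)
qed

text \<open>This is \<phi>(F) before division by the number of signs. The sets S range over one
  fixed A meant to contain all supports, so that the terms for F, F' and their union can be
  subtracted S by S. Sign vectors are real, hence the pairing without conjugation.\<close>

definition sign_sum ::
  "((nat \<Rightarrow> 'k::real_normed_field) \<Rightarrow> nat \<Rightarrow> 'k) \<Rightarrow> nat set \<Rightarrow> nat set \<Rightarrow> 'k" where
  "sign_sum \<Theta> A F = (\<Sum>S\<in>Pow A. \<Sum>k\<in>F. sgv S F k * \<Theta> (sgv S F) k)"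

text \<open>Flipping the signs on \<open>F'\<close> is an involution that negates the sum.\<close>

lemma sign_cross_sum:
  fixes \<Theta> :: "(nat \<Rightarrow> 'k::real_normed_field) \<Rightarrow> nat \<Rightarrow> 'k"
  assumes "F' \<subseteq> A" "F \<inter> F' = {}"
  shows "(\<Sum>S\<in>Pow A. \<Sum>k\<in>F'. sgv S F' k * \<Theta> (sgv S F) k) = 0" (is "?C = 0")
proof -
  let ?t = "\<lambda>S. (S - F') \<union> (F' - S)"
  have 1: "sgv (?t S) F = (sgv S F :: nat \<Rightarrow> 'k)" for S using assms(2) by (auto simp: sgv_def fun_eq_iff)
  have 2: "sgv (?t S) F' k = - (sgv S F' k :: 'k)" for S k by (auto simp: sgv_def)
  have "?C = (\<Sum>S\<in>Pow A. - (\<Sum>k\<in>F'. sgv S F' k * \<Theta> (sgv S F) k))"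
  proof (rule sum.reindex_bij_witness[of _ ?t ?t])
    show "- (\<Sum>k\<in>F'. sgv (?t S) F' k * \<Theta> (sgv (?t S) F) k) = (\<Sum>k\<in>F'. sgv S F' k * \<Theta> (sgv S F) k)" for S
      unfolding 1 2 by (simp add: sum_negf)
    show "?t (?t S) = S" "?t (?t S) = S" for S by auto
    show "?t S \<in> Pow A" "?t S \<in> Pow A" if "S \<in> Pow A" for S using that assms(1) by auto
  qed
  also have "\<dots> = - ?C" by (simp add: sum_negf)
  finally have "?C + ?C = 0" unfolding eq_neg_iff_add_eq_0 .
  then have "2 * ?C = 0" by (simp only: mult_2)
  then show ?thesis by (simp only: mult_eq_0_iff) simp
qed

text \<open>Because F and F' have equal size, the Cauchy difference of \<open>kalton_peck\<close> at
  their sign vectors is exactly ln 2 / 2 times the sign vector z of the union; by homogeneity the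
  block map turns this into \<kappa> z. Pairing with z turns \<kappa> z into \<kappa> times the
  number 2 f of points.\<close>

lemma sign_sum_union:
  fixes \<Theta> :: "(nat \<Rightarrow> 'k::real_normed_field) \<Rightarrow> nat \<Rightarrow> 'k"
  assumes P: "partition_on UNIV P"
    and \<Theta>: "\<And>x. x \<in> l2_fin \<Longrightarrow> \<Theta> x \<in> carrier l2"
    and Q: "\<And>x y. x \<in> l2_fin \<Longrightarrow> y \<in> l2_fin \<Longrightarrow>
      norm2 (\<lambda>n. \<Theta> (\<lambda>n. x n + y n) n - (\<Theta> x n + \<Theta> y n) -
        kalton_peck_blocks P (\<lambda>n. kalton_peck (\<lambda>n. x n + y n) n - (kalton_peck x n + kalton_peck y n)) n)
      \<le> Q * (norm2 x + norm2 y)"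
    and Q0: "0 \<le> Q"
    and A: "finite A" "F \<subseteq> A" "F' \<subseteq> A" "F \<inter> F' = {}" and f: "card F = f" "card F' = f" "0 < f"
    and p: "0 < p" "\<And>B. B \<in> P \<Longrightarrow> (F \<union> F') \<inter> B \<noteq> {} \<Longrightarrow> card ((F \<union> F') \<inter> B) * p = 2 * f"
  shows "norm (sign_sum \<Theta> A (F \<union> F') - sign_sum \<Theta> A F - sign_sum \<Theta> A F'
     - of_real (2 ^ card A * (2 * real f) * (ln 2 / 2 * (ln (real p) / 2)))) \<le> 2 ^ card A * (2 * real f) * (2 * Q)"
proof -
  define G where "G = F \<union> F'"
  have fin: "finite F" "finite F'" "finite G" using A finite_subset by (auto simp: G_def)
  have cG: "card G = 2 * f" using A f fin by (simp add: G_def card_Un_disjoint)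
  define \<kappa> where "\<kappa> = ln 2 / 2 * (ln (real p) / 2)"
  \<comment> \<open>For a single S the cross terms are not small; they are carried along and cancel
    only in the sum over S.\<close>
  have each: "norm ((\<Sum>k\<in>G. sgv S G k * \<Theta> (sgv S G) k) - (\<Sum>k\<in>F. sgv S F k * \<Theta> (sgv S F) k)
      - (\<Sum>k\<in>F'. sgv S F' k * \<Theta> (sgv S F') k) - (\<Sum>k\<in>F'. sgv S F' k * \<Theta> (sgv S F) k)
      - (\<Sum>k\<in>F. sgv S F k * \<Theta> (sgv S F') k) - of_real (2 * real f * \<kappa>)) \<le> (2 * real f) * (2 * Q)" for S
  proof -
    define x y z :: "nat \<Rightarrow> 'k" where "x = sgv S F" and "y = sgv S F'" and "z = sgv S G"
    have l: "x \<in> l2_fin" "y \<in> l2_fin" "z \<in> l2_fin" using fin sgv_l2_fin by (auto simp: x_def y_def z_def)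
    have z: "z = (\<lambda>n. x n + y n)" unfolding x_def y_def z_def G_def using sgv_union[OF A(4)] by auto
    have ln2: "ln (sqrt (real (2 * f))) = ln (sqrt f) + ln 2 / 2"
      using f by (simp add: real_sqrt_mult ln_mult ln_sqrt)
    have kp: "(\<lambda>n. kalton_peck z n - (kalton_peck x n + kalton_peck y n)) = (\<lambda>n. of_real (ln 2 / 2) * z n)"
    proof
      fix n
      have "kalton_peck z n = z n * of_real (ln (sqrt (real (2 * f))))"
        using kalton_peck_sgv[OF fin(3), of S n, where 'k = 'k] cG by (simp add: z_def)
      moreover have "kalton_peck x n = x n * of_real (ln (sqrt (real f)))"
        using kalton_peck_sgv[OF fin(1), of S n, where 'k = 'k] f by (simp add: x_def)
      moreover have "kalton_peck y n = y n * of_real (ln (sqrt (real f)))"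
        using kalton_peck_sgv[OF fin(2), of S n, where 'k = 'k] f by (simp add: y_def)
      ultimately show "kalton_peck z n - (kalton_peck x n + kalton_peck y n) = of_real (ln 2 / 2) * z n"
        unfolding ln2 by (simp add: z algebra_simps)
    qed
    have kpb: "kalton_peck_blocks P (\<lambda>n. of_real (ln 2 / 2) * z n) n = of_real \<kappa> * z n" for n
    proof -
      have "kalton_peck_blocks P z n = z n * of_real (ln (real p) / 2)"
        unfolding z_def by (rule kalton_peck_blocks_sgv[OF P fin(3) p(1)]) (use p(2) cG G_def in auto)
      then show ?thesis
        using kalton_peck_blocks_smult[OF P l(3), of "of_real (ln 2 / 2)"] by (simp add: \<kappa>_def mult_ac)
    qed
    define w where "w = (\<lambda>n. \<Theta> z n - (\<Theta> x n + \<Theta> y n) - of_real \<kappa> * z n)"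
    have "norm2 w \<le> Q * (norm2 x + norm2 y)"
      using Q[OF l(1,2)] unfolding z[symmetric] kp kpb w_def .
    also have "norm2 x + norm2 y = 2 * sqrt f"
      using norm2_sgv[OF fin(1), of S, where 'k = 'k] norm2_sgv[OF fin(2), of S, where 'k = 'k] f
      by (simp add: x_def y_def)
    finally have nw: "norm2 w \<le> Q * (2 * sqrt f)" .
    have ws: "summable (\<lambda>n. (norm (w n))\<^sup>2)"
    proof -
      have "(\<Theta> z \<ominus>\<^bsub>l2\<^esub> (\<Theta> x \<oplus>\<^bsub>l2\<^esub> \<Theta> y)) \<ominus>\<^bsub>l2\<^esub> (of_real \<kappa> \<odot>\<^bsub>l2\<^esub> z) \<in> carrier l2"
        using \<Theta>[OF l(1)] \<Theta>[OF l(2)] \<Theta>[OF l(3)] l2_fin_carrier[OF l(3)]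
        by (intro l2.minus_closed l2.a_closed l2.smult_closed) simp_all
      moreover have "summable (\<lambda>n. (norm (of_real \<kappa> * z n))\<^sup>2)" "summable (\<lambda>n. (norm (\<Theta> x n + \<Theta> y n))\<^sup>2)"
        using l2_fin_carrier[OF l2_fin_smult[OF l(3), of "of_real \<kappa>"]] norm2_triangle(1) \<Theta>[OF l(1)] \<Theta>[OF l(2)] by auto
      ultimately show ?thesis by (simp add: w_def)
    qed
    \<comment> \<open>Cauchy-Schwarz: sqrt (2 f) from the signs times 2 Q sqrt f from the deviation
      w. The product is proportional to f, so the error per point is independent of the size of
      F.\<close>
    have "norm (\<Sum>k\<in>G. z k * w k) \<le> (\<Sum>k\<in>G. \<bar>1\<bar> * \<bar>norm (w k)\<bar>)"
      by (rule order_trans[OF norm_sum sum_mono]) (auto simp: norm_mult z_def norm_sgv)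
    also have "\<dots> \<le> L2_set (\<lambda>_. 1) G * nrm w G" by (rule L2_set_mult_ineq)
    also have "\<dots> \<le> sqrt (2 * f) * (Q * (2 * sqrt f))"
      using nrm_le_norm2[OF ws fin(3)] nw cG by (intro mult_mono) (auto simp: L2_set_constant)
    also have "\<dots> = (2 * real f) * (sqrt 2 * Q)" by (simp add: real_sqrt_mult)
    also have "\<dots> \<le> (2 * real f) * (2 * Q)"
      using Q0 sqrt2_less_2 by (intro mult_left_mono mult_right_mono) (auto simp: less_imp_le)
    finally have "norm (\<Sum>k\<in>G. z k * w k) \<le> (2 * real f) * (2 * Q)" .
    moreover have "(\<Sum>k\<in>G. z k * w k) = (\<Sum>k\<in>G. z k * \<Theta> z k) - (\<Sum>k\<in>F. x k * \<Theta> x k)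
      - (\<Sum>k\<in>F'. y k * \<Theta> y k) - (\<Sum>k\<in>F'. y k * \<Theta> x k) - (\<Sum>k\<in>F. x k * \<Theta> y k) - of_real (2 * real f * \<kappa>)"
    proof -
      have "(\<Sum>k\<in>G. z k * w k) = (\<Sum>k\<in>G. z k * \<Theta> z k) - (\<Sum>k\<in>G. z k * \<Theta> x k) - (\<Sum>k\<in>G. z k * \<Theta> y k) - (\<Sum>k\<in>G. of_real \<kappa>)"
        unfolding sum_subtractf[symmetric]
        by (rule sum.cong) (auto simp: w_def algebra_simps z_def sgv_def)
      moreover have "(\<Sum>k\<in>G. z k * \<Theta> u k) = (\<Sum>k\<in>F. x k * \<Theta> u k) + (\<Sum>k\<in>F'. y k * \<Theta> u k)" for u
      proof -
        have "(\<Sum>k\<in>G. z k * \<Theta> u k) = (\<Sum>k\<in>F. z k * \<Theta> u k) + (\<Sum>k\<in>F'. z k * \<Theta> u k)"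
          unfolding G_def by (rule sum.union_disjoint[OF fin(1,2) A(4)])
        moreover have "(\<Sum>k\<in>F. z k * \<Theta> u k) = (\<Sum>k\<in>F. x k * \<Theta> u k)"
          by (rule sum.cong) (auto simp: z_def x_def G_def sgv_def)
        moreover have "(\<Sum>k\<in>F'. z k * \<Theta> u k) = (\<Sum>k\<in>F'. y k * \<Theta> u k)"
          by (rule sum.cong) (auto simp: z_def y_def G_def sgv_def)
        ultimately show ?thesis by simp
      qed
      ultimately show ?thesis using cG by simp
    qed
    ultimately show ?thesis by (simp only: x_def y_def z_def)
  qed
  let ?C1 = "\<Sum>S\<in>Pow A. \<Sum>k\<in>F'. sgv S F' k * \<Theta> (sgv S F) k"
  let ?C2 = "\<Sum>S\<in>Pow A. \<Sum>k\<in>F. sgv S F k * \<Theta> (sgv S F') k"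
  have C: "?C1 = 0" "?C2 = 0" using A by (auto intro!: sign_cross_sum)
  have "sign_sum \<Theta> A G - sign_sum \<Theta> A F - sign_sum \<Theta> A F' - ?C1 - ?C2 - (\<Sum>S\<in>Pow A. of_real (2 * real f * \<kappa>)) =
    (\<Sum>S\<in>Pow A. (\<Sum>k\<in>G. sgv S G k * \<Theta> (sgv S G) k) - (\<Sum>k\<in>F. sgv S F k * \<Theta> (sgv S F) k)
      - (\<Sum>k\<in>F'. sgv S F' k * \<Theta> (sgv S F') k) - (\<Sum>k\<in>F'. sgv S F' k * \<Theta> (sgv S F) k)
      - (\<Sum>k\<in>F. sgv S F k * \<Theta> (sgv S F') k) - of_real (2 * real f * \<kappa>))"
    by (simp only: sign_sum_def sum_subtractf)
  also have "norm \<dots> \<le> (\<Sum>S\<in>Pow A. (2 * real f) * (2 * Q))"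
    by (rule order_trans[OF norm_sum sum_mono]) (rule each)
  finally show ?thesis
    unfolding C G_def using A(1) by (simp add: card_Pow \<kappa>_def mult_ac)
qed

section \<open>Repeated doubling on a grid of points\<close>

text \<open>Split I into halves: the error satisfies e(i+1) \<le> 2 e(i) + 2^(i+1) w q, so relative
  to the size 2^i w each doubling adds only q. The weight w stands for the side of the grid that is
  kept fixed, times the number of signs; b and r are value and error per point at the start. An
  arbitrary set function f lets the lemma serve both rows and columns.\<close>

lemma dyadic_growth:
  fixes f :: "nat set \<Rightarrow> 'k::real_normed_field"
  assumes step: "\<And>i I I'. I \<subseteq> G \<Longrightarrow> I' \<subseteq> G \<Longrightarrow> I \<inter> I' = {} \<Longrightarrow> card I = 2 ^ i \<Longrightarrow> card I' = 2 ^ i \<Longrightarrow>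
      norm (f (I \<union> I') - f I - f I' - of_real (2 ^ Suc i * w * \<kappa> (Suc i))) \<le> 2 ^ Suc i * w * q"
    and base: "\<And>x. x \<in> G \<Longrightarrow> norm (f {x} - of_real (w * b)) \<le> w * r"
    and I: "I \<subseteq> G" "card I = 2 ^ i"
  shows "norm (f I - of_real (2 ^ i * w * (b + (\<Sum>k=1..i. \<kappa> k)))) \<le> 2 ^ i * w * (r + real i * q)"
  using I
proof (induction i arbitrary: I)
  case 0
  then obtain x where "I = {x}" by (auto simp: card_1_singleton_iff)
  then show ?case using base[of x] 0 by simp
next
  case (Suc i)
  then have fin: "finite I" using card.infinite by fastforce
  obtain I1 where I1: "I1 \<subseteq> I" "card I1 = 2 ^ i"
  proof -
    have "2 ^ i \<le> card I" using Suc.prems by simp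
    then show ?thesis using that by (rule obtain_subset_with_card_n)
  qed
  define I2 where "I2 = I - I1"
  have I2: "card I2 = 2 ^ i" "I1 \<inter> I2 = {}" "I1 \<union> I2 = I" "I2 \<subseteq> G" "I1 \<subseteq> G"
    using I1 Suc.prems fin by (auto simp: I2_def card_Diff_subset finite_subset)
  let ?v = "of_real (2 ^ i * w * (b + (\<Sum>k=1..i. \<kappa> k))) :: 'k"
  have eq: "f I - of_real (2 ^ Suc i * w * (b + (\<Sum>k=1..Suc i. \<kappa> k))) =
     (f I - f I1 - f I2 - of_real (2 ^ Suc i * w * \<kappa> (Suc i))) + (f I1 - ?v) + (f I2 - ?v)"
    by (simp add: algebra_simps)
  have "norm (f I - of_real (2 ^ Suc i * w * (b + (\<Sum>k=1..Suc i. \<kappa> k)))) \<le>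
     2 ^ Suc i * w * q + 2 ^ i * w * (r + real i * q) + 2 ^ i * w * (r + real i * q)"
    unfolding eq
    by (intro norm_triangle_le add_mono Suc.IH)
      (use step[of I1 I2 i] I1 I2 in auto)
  also have "\<dots> = 2 ^ Suc i * w * (r + real (Suc i) * q)" by (simp add: algebra_simps)
  finally show ?case .
qed

text \<open>Coordinates on n points in each of n distinct blocks, so that the number of blocks and
  the number of points per block can be varied independently. Infinite blocks are listed separately
  because their \<open>card\<close> is 0.\<close>

lemma block_grid:
  fixes P :: "nat set set" and n :: nat
  assumes P: "partition_on UNIV P"
    and "\<exists>Q\<subseteq>P. finite Q \<and> card Q = n \<and> (\<forall>B\<in>Q. infinite B \<or> n \<le> card B)"
  obtains g :: "nat \<Rightarrow> nat \<Rightarrow> nat" and b :: "nat \<Rightarrow> nat set" where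
    "\<And>i. i < n \<Longrightarrow> b i \<in> P" "inj_on b {..<n}" "\<And>i j. i < n \<Longrightarrow> j < n \<Longrightarrow> g i j \<in> b i"
    "\<And>i. i < n \<Longrightarrow> inj_on (g i) {..<n}"
proof -
  obtain Q where Q: "Q \<subseteq> P" "finite Q" "card Q = n" "\<forall>B\<in>Q. infinite B \<or> n \<le> card B" using assms(2) by auto
  obtain b where b: "bij_betw b {..<n} Q"
    using ex_bij_betw_nat_finite[OF Q(2)] Q(3) by (auto simp: atLeast0LessThan)
  have bQ: "b i \<in> Q" if "i < n" for i using b that by (auto simp: bij_betw_def)
  have "\<exists>h. (\<forall>j<n. h j \<in> b i) \<and> inj_on h {..<n}" if i: "i < n" for i
  proof -
    obtain T where T: "T \<subseteq> b i" "finite T" "card T = n"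
    proof (cases "infinite (b i)")
      case True
      then show ?thesis using infinite_arbitrarily_large[of "b i" n] that by blast
    next
      case False
      then have "n \<le> card (b i)" using Q(4) bQ[OF i] by auto
      then show ?thesis using obtain_subset_with_card_n[of n "b i"] that by metis
    qed
    obtain h where "bij_betw h {..<n} T"
      using ex_bij_betw_nat_finite[OF T(2)] T(3) by (auto simp: atLeast0LessThan)
    then show ?thesis using T(1) by (intro exI[of _ h]) (auto simp: bij_betw_def)
  qed
  then obtain g where "\<And>i. i < n \<Longrightarrow> (\<forall>j<n. g i j \<in> b i) \<and> inj_on (g i) {..<n}" by metis
  with that[of b g] bQ Q(1) b show ?thesis by (auto simp: bij_betw_def)
qed

text \<open>Doubling the columns adds c times the binary logarithm of the number of rows present: m
  c in each doubling if all rows are already there, and 0 if there is one row. Doubling the rows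
  contributes the same sum s on both routes.\<close>

lemma no_quasi_additive_correction:
  fixes \<Theta> :: "(nat \<Rightarrow> 'k::real_normed_field) \<Rightarrow> nat \<Rightarrow> 'k"
  assumes P: "partition_on UNIV P"
    and blocks: "\<forall>n::nat. \<exists>Q\<subseteq>P. finite Q \<and> card Q = n \<and> (\<forall>B\<in>Q. infinite B \<or> n \<le> card B)"
    and \<Theta>: "\<And>x. x \<in> l2_fin \<Longrightarrow> \<Theta> x \<in> carrier l2"
    and Q: "\<And>x y. x \<in> l2_fin \<Longrightarrow> y \<in> l2_fin \<Longrightarrow>
      norm2 (\<lambda>n. \<Theta> (\<lambda>n. x n + y n) n - (\<Theta> x n + \<Theta> y n) -
        kalton_peck_blocks P (\<lambda>n. kalton_peck (\<lambda>n. x n + y n) n - (kalton_peck x n + kalton_peck y n)) n)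
      \<le> Q * (norm2 x + norm2 y)"
    and Q0: "0 \<le> Q"
  shows False
proof -
  \<comment> \<open>One factor ln 2 / 2 comes from doubling the support, the other from ln p / 2
    with p a power of 2.\<close>
  define c :: real where "c = (ln 2)\<^sup>2 / 4"
  have c: "c > 0" by (simp add: c_def)
  \<comment> \<open>Each route makes 2 m doublings with relative error 2 Q, so the two predictions
    may differ by at most 8 Q m per point; they differ by c m^2.\<close>
  obtain m :: nat where m: "8 * Q / c < real m" using reals_Archimedean2 by blast
  have m0: "0 < m" using m Q0 c by (cases m) (auto simp: field_simps)
  define n :: nat where "n = 2 ^ m"
  obtain g b where gb: "\<And>i. i < n \<Longrightarrow> b i \<in> P" "inj_on b {..<n}" "\<And>i j. i < n \<Longrightarrow> j < n \<Longrightarrow> g i j \<in> b i"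
    "\<And>i. i < n \<Longrightarrow> inj_on (g i) {..<n}"
    using block_grid[OF P blocks[rule_format, of n]] by metis
  \<comment> \<open>The rectangle of rows I, one row per block, and columns J.\<close>
  define R where "R I J = (\<lambda>(i, j). g i j) ` (I \<times> J)" for I J
  define N where "N = {..<n}"
  have same: "i = i'" if "g i j \<in> b i'" "i < n" "i' < n" "j < n" for i i' j
    using that partition_block_unique[OF P gb(1)[OF that(2)] gb(1)[OF that(3)] gb(3)[OF that(2,4)]] gb(2)
    by (auto simp: inj_on_def)
  have inj: "inj_on (\<lambda>(i, j). g i j) (N \<times> N)"
  proof (rule inj_onI, clarify)
    fix i j i' j' assume *: "i \<in> N" "j \<in> N" "i' \<in> N" "j' \<in> N" "g i j = g i' j'"
    then have "i = i'" using same[of i j i'] gb(3)[of i' j'] by (auto simp: N_def)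
    then show "i = i' \<and> j = j'" using * gb(4)[of i] by (auto simp: N_def inj_on_def)
  qed
  have cardR: "card (R I J) = card I * card J" if "I \<subseteq> N" "J \<subseteq> N" for I J
    unfolding R_def using inj_on_subset[OF inj, of "I \<times> J"] that
    by (subst card_image) (auto simp: card_cartesian_product)
  have disjR: "R I J \<inter> R I' J' = {}" if "I \<subseteq> N" "J \<subseteq> N" "I' \<subseteq> N" "J' \<subseteq> N" "I \<inter> I' = {} \<or> J \<inter> J' = {}" for I J I' J'
  proof -
    have "R I J \<inter> R I' J' = (\<lambda>(i, j). g i j) ` ((I \<times> J) \<inter> (I' \<times> J'))"
      unfolding R_def by (rule inj_on_image_Int[symmetric, OF inj]) (use that in auto)
    then show ?thesis using that(5) by auto
  qed
  \<comment> \<open>A rectangle is spread evenly over its rows; this supplies the uniformity premise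
    with p the number of rows.\<close>
  have RB: "card (R I J \<inter> B) * card I = card I * card J"
    if IJ: "I \<subseteq> N" "J \<subseteq> N" and B: "B \<in> P" "R I J \<inter> B \<noteq> {}" for I J B
  proof -
    obtain i j where ij: "i \<in> I" "j \<in> J" "g i j \<in> B" using B(2) by (auto simp: R_def)
    have "B = b i"
      using partition_block_unique[OF P B(1) gb(1) ij(3) gb(3)] ij IJ by (auto simp: N_def)
    have "R I J \<inter> B = R {i} J"
    proof (intro equalityI subsetI)
      fix k assume k: "k \<in> R I J \<inter> B"
      then obtain i' j' where *: "i' \<in> I" "j' \<in> J" "k = g i' j'" by (auto simp: R_def)
      then have "i' = i" using same[of i' j' i] k ij IJ \<open>B = b i\<close> by (auto simp: N_def)
      then show "k \<in> R {i} J" using * by (auto simp: R_def)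
    next
      fix k assume "k \<in> R {i} J"
      then obtain j' where "j' \<in> J" "k = g i j'" by (auto simp: R_def)
      then show "k \<in> R I J \<inter> B" using gb(3)[of i j'] ij IJ \<open>B = b i\<close> by (auto simp: R_def N_def)
    qed
    then show ?thesis using cardR[of "{i}" J] ij IJ by auto
  qed
  define A where "A = R N N"
  have A: "finite A" by (simp add: A_def R_def N_def)
  have RA: "R I J \<subseteq> A" if "I \<subseteq> N" "J \<subseteq> N" for I J using that by (auto simp: R_def A_def)
  define M :: real where "M = 2 ^ card A"
  have M: "M > 0" by (simp add: M_def)
  \<comment> \<open>The subtracted part is additive over disjoint unions, so it leaves every
    increment unchanged while making D vanish at single points.\<close>
  define D where "D I J = sign_sum \<Theta> A (R I J) - (\<Sum>k\<in>R I J. sign_sum \<Theta> A {k})" for I J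
  have lnp: "ln 2 / 2 * (ln (real (2 ^ i)) / 2) = c * real i" for i
    by (simp add: c_def ln_realpow power2_eq_square)
  have fN: "finite I" if "I \<subseteq> N" for I using that by (auto simp: N_def intro: finite_subset)
  have merge: "norm (D K L - D I J - D I' J' - of_real (M * (2 * real f) * (c * real a))) \<le> M * (2 * real f) * (2 * Q)"
    if IJ: "I \<subseteq> N" "J \<subseteq> N" "I' \<subseteq> N" "J' \<subseteq> N" "K \<subseteq> N" "L \<subseteq> N" "I \<inter> I' = {} \<or> J \<inter> J' = {}"
      and KL: "R K L = R I J \<union> R I' J'" and f: "card I * card J = f" "card I' * card J' = f" "0 < f"
      and a: "card K = 2 ^ a" for I J I' J' K L f a
  proof -
    have dj: "R I J \<inter> R I' J' = {}" by (rule disjR) (use IJ in auto)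
    have fin: "finite (R I J)" "finite (R I' J')" using IJ fN by (simp_all add: R_def)
    have cK: "card K * card L = 2 * f"
      using cardR[OF IJ(5,6)] cardR[OF IJ(1,2)] cardR[OF IJ(3,4)] f fin dj
      by (simp add: KL card_Un_disjoint)
    have "norm (sign_sum \<Theta> A (R I J \<union> R I' J') - sign_sum \<Theta> A (R I J) - sign_sum \<Theta> A (R I' J')
       - of_real (2 ^ card A * (2 * real f) * (ln 2 / 2 * (ln (real (2 ^ a)) / 2)))) \<le> 2 ^ card A * (2 * real f) * (2 * Q)"
    proof (rule sign_sum_union[OF P \<Theta> Q Q0 A])
      fix B assume "B \<in> P" "(R I J \<union> R I' J') \<inter> B \<noteq> {}"
      then show "card ((R I J \<union> R I' J') \<inter> B) * 2 ^ a = 2 * f"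
        using RB[OF IJ(5,6), of B] cK a KL by (simp add: mult.commute)
    qed (use RA IJ dj cardR f in auto)
    then show ?thesis
      unfolding lnp D_def KL sum.union_disjoint[OF fin dj] M_def by (simp add: algebra_simps)
  qed
  have D0: "D {i} {j} = 0" for i j by (simp add: D_def R_def)
  have R_un1: "R (I \<union> I') J = R I J \<union> R I' J" and R_un2: "R I (J \<union> J') = R I J \<union> R I J'" for I I' J J'
    by (auto simp: R_def)
  \<comment> \<open>What counts is the number of rows of the union, hence \<open>Suc i\<close>; for
    columns the row number 2^a stays fixed.\<close>
  have grow_rows: "norm (D (I \<union> I') J - D I J - D I' J - of_real (2 ^ Suc i * (real (card J) * M) * (c * real (Suc i))))
      \<le> 2 ^ Suc i * (real (card J) * M) * (2 * Q)"
    if "I \<subseteq> N" "I' \<subseteq> N" "J \<subseteq> N" "I \<inter> I' = {}" "card I = 2 ^ i" "card I' = 2 ^ i" "0 < card J" for I I' J i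
    using merge[of I J I' J "I \<union> I'" J "2 ^ i * card J" "Suc i"] that fN[of I] fN[of I']
    by (simp add: R_un1 card_Un_disjoint algebra_simps)
  have grow_cols: "norm (D I (J \<union> J') - D I J - D I J' - of_real (2 ^ Suc j * (real (card I) * M) * (c * real a)))
      \<le> 2 ^ Suc j * (real (card I) * M) * (2 * Q)"
    if "I \<subseteq> N" "J \<subseteq> N" "J' \<subseteq> N" "J \<inter> J' = {}" "card J = 2 ^ j" "card J' = 2 ^ j" "card I = 2 ^ a" for I J J' j a
    using merge[of I J I J' I "J \<union> J'" "card I * 2 ^ j" a] that fN[of J] fN[of J']
    by (simp add: R_un2 card_Un_disjoint algebra_simps)
  have cN: "card N = 2 ^ m" by (simp add: N_def n_def)
  define s where "s = (\<Sum>k=1..m. c * real k)"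
  let ?q = "2 * Q"
  \<comment> \<open>First route: each column is built up to full height, and then the columns are
    doubled with all rows present.\<close>
  have rows1: "norm (D N {j} - of_real (2 ^ m * M * (0 + s))) \<le> 2 ^ m * M * (0 + real m * ?q)" if "j \<in> N" for j
    unfolding s_def
    by (rule dyadic_growth[where f = "\<lambda>I. D I {j}" and G = N])
      (use grow_rows[of _ _ "{j}"] that cN in \<open>auto simp: D0\<close>)
  have colsA: "norm (D N N - of_real (2 ^ m * (2 ^ m * M) * (s + (\<Sum>k=1..m. c * real m)))) \<le>
      2 ^ m * (2 ^ m * M) * (real m * ?q + real m * ?q)"
    by (rule dyadic_growth[where f = "\<lambda>J. D N J" and G = N])
      (use grow_cols[of N] rows1 cN in auto)
  \<comment> \<open>Second route: within a single row ln p = 0, so the columns contribute only error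
    before the rows are doubled.\<close>
  have cols1: "norm (D {i} N - of_real (2 ^ m * M * (0 + (\<Sum>k=1..m. 0)))) \<le> 2 ^ m * M * (0 + real m * ?q)" if "i \<in> N" for i
    by (rule dyadic_growth[where f = "\<lambda>J. D {i} J" and G = N])
      (use grow_cols[of "{i}" _ _ _ 0] that cN in \<open>auto simp: D0\<close>)
  have rowsB: "norm (D N N - of_real (2 ^ m * (2 ^ m * M) * (0 + s))) \<le>
      2 ^ m * (2 ^ m * M) * (real m * ?q + real m * ?q)"
    unfolding s_def
    by (rule dyadic_growth[where f = "\<lambda>I. D I N" and G = N])
      (use grow_rows[of _ _ N] cols1 cN in auto)
  let ?L = "2 ^ m * (2 ^ m * M)"
  have L: "?L > 0" using M by simp
  \<comment> \<open>The common term s cancels, leaving the discrepancy c m^2 per point; both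
    predictions concern the same number \<open>D N N\<close>.\<close>
  have "?L * (c * real m * real m) = norm (of_real (?L * (s + (\<Sum>k=1..m. c * real m))) - of_real (?L * (0 + s)) :: 'k)"
    unfolding of_real_diff[symmetric] norm_of_real using M c by (simp add: algebra_simps abs_mult)
  also have "\<dots> = norm ((D N N - of_real (?L * (0 + s))) - (D N N - of_real (?L * (s + (\<Sum>k=1..m. c * real m)))))"
    by (rule arg_cong[of _ _ norm]) simp
  also have "\<dots> \<le> ?L * (real m * ?q + real m * ?q) + ?L * (real m * ?q + real m * ?q)"
    by (rule order_trans[OF norm_triangle_ineq4 add_mono[OF rowsB colsA]])
  also have "\<dots> = ?L * (8 * Q * real m)" by (simp add: algebra_simps)
  finally have "c * real m * real m \<le> 8 * Q * real m" using L by (simp only: mult_le_cancel_left_pos)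
  then have "c * real m \<le> 8 * Q" using m0 by simp
  then show False using m c by (simp add: field_simps)
qed

subsection \<open>Linear, bounded and quasi-additive maps on \<open>l2_fin\<close>\<close>

definition fin_linear :: "('k::real_normed_field, 'a) qspace \<Rightarrow> ((nat \<Rightarrow> 'k) \<Rightarrow> 'a) \<Rightarrow> bool" where
  "fin_linear V L \<longleftrightarrow> (\<forall>x\<in>l2_fin. L x \<in> carrier V) \<and>
     (\<forall>x\<in>l2_fin. \<forall>y\<in>l2_fin. L (\<lambda>n. x n + y n) = L x \<oplus>\<^bsub>V\<^esub> L y) \<and>
     (\<forall>c. \<forall>x\<in>l2_fin. L (\<lambda>n. c * x n) = c \<odot>\<^bsub>V\<^esub> L x)"

text \<open>Bounded in size without any algebraic condition, as suits preimages chosen point by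
  point with norm control.\<close>

definition fin_bounded :: "('k::real_normed_field, 'a) qspace \<Rightarrow> ((nat \<Rightarrow> 'k) \<Rightarrow> 'a) \<Rightarrow> bool" where
  "fin_bounded V f \<longleftrightarrow> (\<forall>x\<in>l2_fin. f x \<in> carrier V) \<and> (\<exists>Q\<ge>0. \<forall>x\<in>l2_fin. qnorm V (f x) \<le> Q * norm2 x)"

abbreviation cauchy_diff ::
  "('k::real_normed_field, 'a) qspace \<Rightarrow> ((nat \<Rightarrow> 'k) \<Rightarrow> 'a) \<Rightarrow> (nat \<Rightarrow> 'k) \<Rightarrow> (nat \<Rightarrow> 'k) \<Rightarrow> 'a" where
  "cauchy_diff V f x y \<equiv> f (\<lambda>n. x n + y n) \<ominus>\<^bsub>V\<^esub> (f x \<oplus>\<^bsub>V\<^esub> f y)"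

text \<open>Quasilinearity without homogeneity: pointwise choices of preimages cannot be expected to
  respect scalars.\<close>

definition quasi_additive :: "('k::real_normed_field, 'a) qspace \<Rightarrow> ((nat \<Rightarrow> 'k) \<Rightarrow> 'a) \<Rightarrow> bool" where
  "quasi_additive V f \<longleftrightarrow> (\<forall>x\<in>l2_fin. f x \<in> carrier V) \<and>
     (\<exists>Q\<ge>0. \<forall>x\<in>l2_fin. \<forall>y\<in>l2_fin. qnorm V (cauchy_diff V f x y) \<le> Q * (norm2 x + norm2 y))"

lemma fin_linearD:
  assumes "fin_linear V L"
  shows "x \<in> l2_fin \<Longrightarrow> L x \<in> carrier V"
    "x \<in> l2_fin \<Longrightarrow> y \<in> l2_fin \<Longrightarrow> L (\<lambda>n. x n + y n) = L x \<oplus>\<^bsub>V\<^esub> L y"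
    "x \<in> l2_fin \<Longrightarrow> L (\<lambda>n. c * x n) = c \<odot>\<^bsub>V\<^esub> L x"
  using assms by (auto simp: fin_linear_def)

lemma fin_boundedE:
  assumes "fin_bounded V f"
  obtains Q where "0 \<le> Q" "\<And>x. x \<in> l2_fin \<Longrightarrow> qnorm V (f x) \<le> Q * norm2 x"
  using assms unfolding fin_bounded_def by blast

lemma fin_bounded_closed: "fin_bounded V f \<Longrightarrow> x \<in> l2_fin \<Longrightarrow> f x \<in> carrier V"
  by (simp add: fin_bounded_def)

lemma quasi_additiveE:
  assumes "quasi_additive V f"
  obtains Q where "0 \<le> Q"
    "\<And>x y. x \<in> l2_fin \<Longrightarrow> y \<in> l2_fin \<Longrightarrow> qnorm V (cauchy_diff V f x y) \<le> Q * (norm2 x + norm2 y)"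
  using assms unfolding quasi_additive_def by blast

lemma quasi_additive_closed: "quasi_additive V f \<Longrightarrow> x \<in> l2_fin \<Longrightarrow> f x \<in> carrier V"
  by (simp add: quasi_additive_def)

lemma norm2_fin_triangle: "x \<in> l2_fin \<Longrightarrow> y \<in> l2_fin \<Longrightarrow> norm2 (\<lambda>n. x n + y n) \<le> norm2 x + norm2 y"
  by (simp add: norm2_triangle l2_fin_carrier)

lemma quasi_additive_cong:
  "(\<And>x. x \<in> l2_fin \<Longrightarrow> f x = g x) \<Longrightarrow> quasi_additive V f \<longleftrightarrow> quasi_additive V g"
  unfolding quasi_additive_def by (simp add: l2_fin_add cong: ball_cong)

lemma fin_bounded_cong:
  "(\<And>x. x \<in> l2_fin \<Longrightarrow> f x = g x) \<Longrightarrow> fin_bounded V f \<longleftrightarrow> fin_bounded V g"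
  unfolding fin_bounded_def by (simp cong: ball_cong)

context qnormed
begin

lemma fin_linear_minus:
  assumes "fin_linear V f" "fin_linear V g"
  shows "fin_linear V (\<lambda>x. f x \<ominus> g x)"
  unfolding fin_linear_def using fin_linearD[OF assms(1)] fin_linearD[OF assms(2)]
  by (simp add: add_minus_add smult_minus_right)

lemma fin_bounded_minus:
  assumes "fin_bounded V f" "fin_bounded V g"
  shows "fin_bounded V (\<lambda>x. f x \<ominus> g x)"
proof -
  obtain Q where Q: "0 \<le> Q" "\<And>x. x \<in> l2_fin \<Longrightarrow> qnorm V (f x) \<le> Q * norm2 x"
    using fin_boundedE[OF assms(1)] by metis
  obtain R where R: "0 \<le> R" "\<And>x. x \<in> l2_fin \<Longrightarrow> qnorm V (g x) \<le> R * norm2 x"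
    using fin_boundedE[OF assms(2)] by metis
  note c = fin_bounded_closed[OF assms(1)] fin_bounded_closed[OF assms(2)]
  have "qnorm V (f x \<ominus> g x) \<le> (qmod * (Q + R)) * norm2 x" if "x \<in> l2_fin" for x
    using qnorm_minus_le[OF c(1)[OF that] c(2)[OF that] Q(2)[OF that] R(2)[OF that]]
    by (simp add: algebra_simps)
  then show ?thesis unfolding fin_bounded_def using c Q R
    by (auto intro!: exI[of _ "qmod * (Q + R)"] mult_nonneg_nonneg simp: less_imp_le)
qed

text \<open>Bounded maps and linear maps are the two trivial kinds of quasi-additive maps;
  corrections of both kinds are used below to move a given map into a prescribed fibre of an
  arrow.\<close>

lemma fin_bounded_imp_quasi_additive:
  assumes "fin_bounded V f"
  shows "quasi_additive V f"
proof -
  obtain Q where Q: "0 \<le> Q" "\<And>x. x \<in> l2_fin \<Longrightarrow> qnorm V (f x) \<le> Q * norm2 x"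
    using fin_boundedE[OF assms] by metis
  note c = fin_bounded_closed[OF assms]
  have "qnorm V (cauchy_diff V f x y) \<le> (qmod * (Q + qmod * Q)) * (norm2 x + norm2 y)"
    if xy: "x \<in> l2_fin" "y \<in> l2_fin" for x y
  proof -
    have "qnorm V (f (\<lambda>n. x n + y n)) \<le> Q * (norm2 x + norm2 y)"
      by (rule order_trans[OF Q(2)]) (use xy Q in \<open>auto intro!: mult_left_mono norm2_fin_triangle l2_fin_add\<close>)
    moreover have "qnorm V (f x \<oplus> f y) \<le> qmod * (Q * norm2 x + Q * norm2 y)"
      using c xy Q by (intro qnorm_triangle_le) auto
    ultimately have "qnorm V (cauchy_diff V f x y) \<le> qmod * (Q * (norm2 x + norm2 y) + qmod * (Q * norm2 x + Q * norm2 y))"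
      using c xy by (intro qnorm_minus_le) (auto simp: l2_fin_add)
    then show ?thesis by (simp add: algebra_simps)
  qed
  then show ?thesis unfolding quasi_additive_def using c Q
    by (auto intro!: exI[of _ "qmod * (Q + qmod * Q)"] mult_nonneg_nonneg add_nonneg_nonneg simp: less_imp_le)
qed

lemma fin_linear_imp_quasi_additive:
  assumes "fin_linear V f"
  shows "quasi_additive V f"
  unfolding quasi_additive_def using fin_linearD[OF assms]
  by (auto intro!: exI[of _ 0])

lemma quasi_additive_add:
  assumes "quasi_additive V f" "quasi_additive V g"
  shows "quasi_additive V (\<lambda>x. f x \<oplus> g x)"
proof -
  obtain Q where Q: "0 \<le> Q" "\<And>x y. x \<in> l2_fin \<Longrightarrow> y \<in> l2_fin \<Longrightarrow> qnorm V (cauchy_diff V f x y) \<le> Q * (norm2 x + norm2 y)"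
    using quasi_additiveE[OF assms(1)] by metis
  obtain R where R: "0 \<le> R" "\<And>x y. x \<in> l2_fin \<Longrightarrow> y \<in> l2_fin \<Longrightarrow> qnorm V (cauchy_diff V g x y) \<le> R * (norm2 x + norm2 y)"
    using quasi_additiveE[OF assms(2)] by metis
  note c = quasi_additive_closed[OF assms(1)] quasi_additive_closed[OF assms(2)]
  have "qnorm V (cauchy_diff V (\<lambda>x. f x \<oplus> g x) x y) \<le> (qmod * (Q + R)) * (norm2 x + norm2 y)"
    if xy: "x \<in> l2_fin" "y \<in> l2_fin" for x y
  proof -
    have "(f x \<oplus> g x) \<oplus> (f y \<oplus> g y) = (f x \<oplus> f y) \<oplus> (g x \<oplus> g y)"
      using c xy by (simp add: a_ac)
    then have "cauchy_diff V (\<lambda>x. f x \<oplus> g x) x y = cauchy_diff V f x y \<oplus> cauchy_diff V g x y"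
      using c xy by (simp add: add_minus_add l2_fin_add)
    moreover have "qnorm V (cauchy_diff V f x y \<oplus> cauchy_diff V g x y) \<le> qmod * (Q * (norm2 x + norm2 y) + R * (norm2 x + norm2 y))"
      using c xy Q R by (intro qnorm_triangle_le) (auto simp: l2_fin_add)
    ultimately show ?thesis by (simp add: algebra_simps)
  qed
  then show ?thesis unfolding quasi_additive_def using c Q R
    by (auto intro!: exI[of _ "qmod * (Q + R)"] mult_nonneg_nonneg add_nonneg_nonneg simp: less_imp_le)
qed

lemma quasi_additive_minus:
  assumes "quasi_additive V f" "quasi_additive V g"
  shows "quasi_additive V (\<lambda>x. f x \<ominus> g x)"
proof -
  note c = quasi_additive_closed[OF assms(2)]
  have "cauchy_diff V (\<lambda>x. \<ominus> g x) x y = \<ominus> cauchy_diff V g x y" if "x \<in> l2_fin" "y \<in> l2_fin" for x y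
    using c that by (simp add: a_minus_def minus_add l2_fin_add)
  then have "quasi_additive V (\<lambda>x. \<ominus> g x)"
    using assms(2) c unfolding quasi_additive_def by (simp add: l2_fin_add)
  then show ?thesis unfolding a_minus_def by (rule quasi_additive_add[OF assms(1)])
qed

end

context qoperator
begin

lemma fin_linear_compose: "fin_linear V f \<Longrightarrow> fin_linear W (\<lambda>x. T (f x))"
  by (simp add: fin_linear_def add smult)

lemma fin_bounded_compose:
  assumes "fin_bounded V f"
  shows "fin_bounded W (\<lambda>x. T (f x))"
proof -
  obtain Q where Q: "0 \<le> Q" "\<And>x. x \<in> l2_fin \<Longrightarrow> qnorm V (f x) \<le> Q * norm2 x"
    using fin_boundedE[OF assms] by metis
  obtain C where C: "0 < C" "\<And>x. x \<in> carrier V \<Longrightarrow> qnorm W (T x) \<le> C * qnorm V x" using bounded by metis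
  note c = fin_bounded_closed[OF assms]
  have "qnorm W (T (f x)) \<le> (C * Q) * norm2 x" if "x \<in> l2_fin" for x
  proof -
    have "qnorm W (T (f x)) \<le> C * (Q * norm2 x)"
      by (rule order_trans[OF C(2) mult_left_mono]) (use c Q C that in auto)
    then show ?thesis by simp
  qed
  then show ?thesis unfolding fin_bounded_def using c Q C by (auto intro!: exI[of _ "C * Q"])
qed

lemma cauchy_diff_compose:
  assumes "\<And>x. x \<in> l2_fin \<Longrightarrow> f x \<in> carrier V" "x \<in> l2_fin" "y \<in> l2_fin"
  shows "cauchy_diff W (\<lambda>x. T (f x)) x y = T (cauchy_diff V f x y)"
  using assms by (simp add: minus add l2_fin_add)

lemma quasi_additive_compose:
  assumes "quasi_additive V f"
  shows "quasi_additive W (\<lambda>x. T (f x))"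
proof -
  obtain Q where Q: "0 \<le> Q" "\<And>x y. x \<in> l2_fin \<Longrightarrow> y \<in> l2_fin \<Longrightarrow> qnorm V (cauchy_diff V f x y) \<le> Q * (norm2 x + norm2 y)"
    using quasi_additiveE[OF assms] by metis
  obtain C where C: "0 < C" "\<And>x. x \<in> carrier V \<Longrightarrow> qnorm W (T x) \<le> C * qnorm V x" using bounded by metis
  note c = quasi_additive_closed[OF assms]
  have "qnorm W (cauchy_diff W (\<lambda>x. T (f x)) x y) \<le> (C * Q) * (norm2 x + norm2 y)"
    if xy: "x \<in> l2_fin" "y \<in> l2_fin" for x y
  proof -
    have "qnorm W (T (cauchy_diff V f x y)) \<le> C * (Q * (norm2 x + norm2 y))"
      by (rule order_trans[OF C(2) mult_left_mono]) (use c Q C xy in \<open>auto simp: l2_fin_add\<close>)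
    then show ?thesis using c xy by (simp add: cauchy_diff_compose)
  qed
  then show ?thesis unfolding quasi_additive_def using c Q C by (auto intro!: exI[of _ "C * Q"])
qed

text \<open>The unit vectors are a basis of \<open>l2_fin\<close>, so linear maps on it lift through surjections.\<close>

lemma fin_linear_lift:
  fixes L :: "(nat \<Rightarrow> 'k) \<Rightarrow> 'b"
  assumes L: "fin_linear W L" and im: "\<And>x. x \<in> l2_fin \<Longrightarrow> L x \<in> T ` carrier V"
  obtains M where "fin_linear V M" "\<And>x. x \<in> l2_fin \<Longrightarrow> T (M x) = L x"
proof -
  define e :: "nat \<Rightarrow> nat \<Rightarrow> 'k" where "e k = (\<lambda>n. if n = k then 1 else 0)" for k
  have e: "e k \<in> l2_fin" for k by (rule l2_finI[of "{k}"]) (auto simp: e_def)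
  have "\<forall>k. \<exists>v\<in>carrier V. T v = L (e k)" using im[OF e] by (metis imageE)
  then obtain m where m: "\<And>k. m k \<in> carrier V" "\<And>k. T (m k) = L (e k)" by metis
  define s where "s A x = finsum V (\<lambda>k. x k \<odot>\<^bsub>V\<^esub> m k) A" for A and x :: "nat \<Rightarrow> 'k"
  have sc: "s A x \<in> carrier V" for A x unfolding s_def using m by (intro V.finsum_closed) auto
  define M where "M x = s {k. x k \<noteq> 0} x" for x
  \<comment> \<open>Any finite set containing the support gives the same sum, so vectors of
    different supports can be compared over a common set.\<close>
  have Ms: "M x = s A x" if "finite A" "\<And>k. k \<notin> A \<Longrightarrow> x k = 0" for A x
    unfolding M_def s_def
    by (rule V.add.finprod_mono_neutral_cong_left) (use that m in auto)
  have Ts: "T (s A x) = L (\<lambda>n. if n \<in> A then x n else 0)" if "finite A" for A x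
    using that
  proof (induction A rule: finite_induct)
    case empty
    have "(\<lambda>n. 0) = (\<lambda>n. 0 * e 0 n)" by simp
    then have "L (\<lambda>n. 0) = \<zero>\<^bsub>W\<^esub>" using fin_linearD(3)[OF L e, of 0 0] fin_linearD(1)[OF L e] by simp
    then show ?case by (simp add: s_def)
  next
    case (insert k A)
    have "s (insert k A) x = x k \<odot>\<^bsub>V\<^esub> m k \<oplus>\<^bsub>V\<^esub> s A x"
      unfolding s_def using insert.hyps m by (intro V.finsum_insert) auto
    then have "T (s (insert k A) x) = x k \<odot>\<^bsub>W\<^esub> L (e k) \<oplus>\<^bsub>W\<^esub> L (\<lambda>n. if n \<in> A then x n else 0)"
      using sc m insert.IH by (simp add: add smult)
    also have "\<dots> = L (\<lambda>n. x k * e k n) \<oplus>\<^bsub>W\<^esub> L (\<lambda>n. if n \<in> A then x n else 0)"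
      by (simp add: fin_linearD(3)[OF L e])
    also have "\<dots> = L (\<lambda>n. x k * e k n + (if n \<in> A then x n else 0))"
      by (rule fin_linearD(2)[OF L, symmetric]) (use e insert.hyps in \<open>auto intro: l2_fin_smult l2_finI[of A]\<close>)
    also have "(\<lambda>n. x k * e k n + (if n \<in> A then x n else 0)) = (\<lambda>n. if n \<in> insert k A then x n else 0)"
      using insert.hyps by (auto simp: e_def)
    finally show ?case .
  qed
  have "fin_linear V M" unfolding fin_linear_def
  proof (intro conjI ballI allI)
    fix x :: "nat \<Rightarrow> 'k" assume x: "x \<in> l2_fin"
    define A where "A = {k. x k \<noteq> 0}"
    have A: "finite A" using x by (simp add: A_def l2_fin_def)
    show "M x \<in> carrier V" by (simp add: M_def sc)
    show "M (\<lambda>n. c * x n) = c \<odot>\<^bsub>V\<^esub> M x" for c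
    proof -
      have "M (\<lambda>n. c * x n) = s A (\<lambda>n. c * x n)" "M x = s A x"
        by (intro Ms; use A in \<open>auto simp: A_def\<close>)+
      then show ?thesis
        using Module.module.finsum_smult_ldistr[OF V.scalar_module A, of c "\<lambda>k. x k \<odot>\<^bsub>V\<^esub> m k"] m
        by (simp add: s_def V.smult_smult)
    qed
    fix y :: "nat \<Rightarrow> 'k" assume y: "y \<in> l2_fin"
    define C where "C = A \<union> {k. y k \<noteq> 0}"
    have C: "finite C" using A y by (simp add: C_def l2_fin_def)
    have "M (\<lambda>n. x n + y n) = s C (\<lambda>n. x n + y n)" "M x = s C x" "M y = s C y"
      by (intro Ms; use C in \<open>auto simp: C_def A_def\<close>)+
    then show "M (\<lambda>n. x n + y n) = M x \<oplus>\<^bsub>V\<^esub> M y"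
      using m by (simp add: s_def V.smult_add_left V.finsum_addf)
  qed
  moreover have "T (M x) = L x" if x: "x \<in> l2_fin" for x
    using Ts[of "{k. x k \<noteq> 0}" x] x unfolding M_def l2_fin_def
    by (simp add: if_distrib cong: if_cong) (metis (mono_tags))
  ultimately show ?thesis using that by blast
qed

end

text \<open>Counterpart of \<open>fin_linear_lift\<close> for bounded maps: the constant of the open
  mapping theorem controls an otherwise arbitrary choice of preimages.\<close>

lemma fin_bounded_lift:
  assumes OM: "0 < C" "\<And>w. w \<in> R \<Longrightarrow> \<exists>v\<in>carrier V. T v = w \<and> qnorm V v \<le> C * qnorm W w"
    and f: "fin_bounded W f" "\<And>x. x \<in> l2_fin \<Longrightarrow> f x \<in> R"
  obtains g where "fin_bounded V g" "\<And>x. x \<in> l2_fin \<Longrightarrow> T (g x) = f x"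
proof -
  obtain Q where Q: "0 \<le> Q" "\<And>x. x \<in> l2_fin \<Longrightarrow> qnorm W (f x) \<le> Q * norm2 x"
    using fin_boundedE[OF f(1)] by metis
  obtain g where g: "\<And>x. x \<in> l2_fin \<Longrightarrow> g x \<in> carrier V \<and> T (g x) = f x \<and> qnorm V (g x) \<le> C * qnorm W (f x)"
    using OM(2)[OF f(2)] by metis
  have "qnorm V (g x) \<le> (C * Q) * norm2 x" if "x \<in> l2_fin" for x
    unfolding mult.assoc
    by (rule order_trans[OF _ mult_left_mono[OF Q(2)[OF that] less_imp_le[OF OM(1)]]]) (use g[OF that] in simp)
  then have "fin_bounded V g" unfolding fin_bounded_def using g OM(1) Q(1) by (auto intro!: exI[of _ "C * Q"])
  then show ?thesis using that g by blast
qed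

subsection \<open>A homological invariant of four-term sequences\<close>

locale four_term =
  fixes X :: "('k::real_normed_field, 'x) qspace" and Y :: "('k, 'y) qspace"
    and S :: "('k, 'y, 'x, 'u) four_seq"
  assumes four_term: "S \<in> four_term_seqs X Y"
begin

sublocale X: qbanach X + Y: qbanach Y + E1: qbanach "mid1 S" + E2: qbanach "mid2 S"
  using four_term by (simp_all add: four_term_seqs_def quasi_banachD)

sublocale arr1: qoperator Y "mid1 S" "arr1 S"
  by unfold_locales (use four_term in \<open>simp add: four_term_seqs_def\<close>)

sublocale arr2: qoperator "mid1 S" "mid2 S" "arr2 S"
  by unfold_locales (use four_term in \<open>simp add: four_term_seqs_def\<close>)

sublocale arr3: qoperator "mid2 S" X "arr3 S"
  by unfold_locales (use four_term in \<open>simp add: four_term_seqs_def\<close>)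

lemma exact:
  "op_kernel Y (mid1 S) (arr1 S) = {\<zero>\<^bsub>Y\<^esub>}"
  "op_kernel (mid1 S) (mid2 S) (arr2 S) = arr1 S ` carrier Y"
  "op_kernel (mid2 S) X (arr3 S) = arr2 S ` carrier (mid1 S)"
  "arr3 S ` carrier (mid2 S) = carrier X"
  using four_term by (simp_all add: four_term_seqs_def)

lemma arr2_eq_zeroD: "e \<in> carrier (mid1 S) \<Longrightarrow> arr2 S e = \<zero>\<^bsub>mid2 S\<^esub> \<Longrightarrow> e \<in> arr1 S ` carrier Y"
  using exact(2) by (auto simp: op_kernel_def)

lemma arr2_arr1: "y \<in> carrier Y \<Longrightarrow> arr2 S (arr1 S y) = \<zero>\<^bsub>mid2 S\<^esub>"
  using exact(2) by (auto simp: op_kernel_def)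

lemma arr3_eq_zeroD: "e \<in> carrier (mid2 S) \<Longrightarrow> arr3 S e = \<zero>\<^bsub>X\<^esub> \<Longrightarrow> e \<in> arr2 S ` carrier (mid1 S)"
  using exact(3) by (auto simp: op_kernel_def)

lemma arr3_arr2: "e \<in> carrier (mid1 S) \<Longrightarrow> arr3 S (arr2 S e) = \<zero>\<^bsub>X\<^esub>"
  using exact(3) by (auto simp: op_kernel_def)

lemma quasi_banach_terms: "quasi_banach X" "quasi_banach Y" "quasi_banach (mid1 S)" "quasi_banach (mid2 S)"
  using four_term by (simp_all add: four_term_seqs_def)

lemma arr3_open:
  obtains C where "0 < C"
    "\<And>w. w \<in> carrier X \<Longrightarrow> \<exists>v\<in>carrier (mid2 S). arr3 S v = w \<and> qnorm (mid2 S) v \<le> C * qnorm X w"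
proof -
  have "qclosed X (arr3 S ` carrier (mid2 S))" unfolding exact(4) by (simp add: qclosed_def)
  from open_mapping[OF quasi_banach_terms(4,1) arr3.operator this] that show ?thesis unfolding exact(4) by metis
qed

lemma arr2_open:
  obtains C where "0 < C" "\<And>w. w \<in> arr2 S ` carrier (mid1 S) \<Longrightarrow>
    \<exists>v\<in>carrier (mid1 S). arr2 S v = w \<and> qnorm (mid1 S) v \<le> C * qnorm (mid2 S) w"
proof -
  have "qclosed (mid2 S) (arr2 S ` carrier (mid1 S))"
    unfolding exact(3)[symmetric] by (rule arr3.qclosed_op_kernel)
  from open_mapping[OF quasi_banach_terms(3,4) arr2.operator this] that show ?thesis by metis
qed

lemma arr1_inj:
  assumes "y \<in> carrier Y" "y' \<in> carrier Y" "arr1 S y = arr1 S y'"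
  shows "y = y'"
proof -
  have "y \<ominus>\<^bsub>Y\<^esub> y' \<in> op_kernel Y (mid1 S) (arr1 S)" using assms by (simp add: op_kernel_def arr1.minus)
  then show ?thesis using assms Y.minus_eq_zeroD unfolding exact(1) by blast
qed

text \<open>By injectivity the controlled preimage of \<open>arr1 S y\<close> can only be y
  itself.\<close>

lemma arr1_bounded_below:
  obtains C where "0 < C" "\<And>y. y \<in> carrier Y \<Longrightarrow> qnorm Y y \<le> C * qnorm (mid1 S) (arr1 S y)"
proof -
  have "qclosed (mid1 S) (arr1 S ` carrier Y)"
    unfolding exact(2)[symmetric] by (rule arr2.qclosed_op_kernel)
  from open_mapping[OF quasi_banach_terms(2,3) arr1.operator this] obtain C where C: "0 < C"
    "\<And>w. w \<in> arr1 S ` carrier Y \<Longrightarrow> \<exists>v\<in>carrier Y. arr1 S v = w \<and> qnorm Y v \<le> C * qnorm (mid1 S) w" by metis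
  have "qnorm Y y \<le> C * qnorm (mid1 S) (arr1 S y)" if "y \<in> carrier Y" for y
    using C(2)[of "arr1 S y"] arr1_inj that by blast
  then show ?thesis using that C(1) by blast
qed

end

text \<open>
  If \<open>W\<close> is the twisted sum defined by \<open>\<Lambda>\<close>, then \<open>(e, x) \<mapsto> arr2 S e \<oplus> L x\<close> is an operator
  from \<open>W\<close> to \<open>mid2 S\<close>.  So this says that \<open>mid1 S \<rightarrow> mid2 S\<close> factors through an extension
  of \<open>l2\<close> by \<open>mid1 S\<close>, compatibly with the projections to \<open>l2\<close>.
\<close>

definition liftable :: "('k::real_normed_field, 'y, nat \<Rightarrow> 'k, 'u) four_seq \<Rightarrow> bool" where
  "liftable S \<longleftrightarrow> (\<exists>\<Lambda> L. quasi_additive (mid1 S) \<Lambda> \<and> fin_linear (mid2 S) L \<and>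
     (\<forall>x\<in>l2_fin. arr3 S (L x) = x) \<and> fin_bounded (mid2 S) (\<lambda>x. arr2 S (\<Lambda> x) \<oplus>\<^bsub>mid2 S\<^esub> L x))"

text \<open>Compose \<Lambda> with u1 and L with u2; the middle square carries the bounded sum to
  the bounded sum required.\<close>

lemma liftable_forward:
  assumes "four_seq_arrow l2 Y S T" "liftable S"
  shows "liftable T"
proof -
  interpret S: four_term l2 Y S using assms(1) by unfold_locales (simp add: four_seq_arrow_def)
  interpret T: four_term l2 Y T using assms(1) by unfold_locales (simp add: four_seq_arrow_def)
  obtain u1 u2 where u: "operator (mid1 S) (mid1 T) u1" "operator (mid2 S) (mid2 T) u2"
      "\<And>y. y\<in>carrier Y \<Longrightarrow> u1 (arr1 S y) = arr1 T y"
      "\<And>e. e\<in>carrier (mid1 S) \<Longrightarrow> u2 (arr2 S e) = arr2 T (u1 e)"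
      "\<And>e. e\<in>carrier (mid2 S) \<Longrightarrow> arr3 T (u2 e) = arr3 S e"
    using assms(1) unfolding four_seq_arrow_def by blast
  interpret u1: qoperator "mid1 S" "mid1 T" u1 by unfold_locales fact
  interpret u2: qoperator "mid2 S" "mid2 T" u2 by unfold_locales fact
  obtain \<Lambda> L where L: "quasi_additive (mid1 S) \<Lambda>" "fin_linear (mid2 S) L"
     "\<And>x. x\<in>l2_fin \<Longrightarrow> arr3 S (L x) = x" "fin_bounded (mid2 S) (\<lambda>x. arr2 S (\<Lambda> x) \<oplus>\<^bsub>mid2 S\<^esub> L x)"
    using assms(2) unfolding liftable_def by blast
  have "fin_bounded (mid2 T) (\<lambda>x. u2 (arr2 S (\<Lambda> x) \<oplus>\<^bsub>mid2 S\<^esub> L x))"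
    using L(4) by (rule u2.fin_bounded_compose)
  moreover have "u2 (arr2 S (\<Lambda> x) \<oplus>\<^bsub>mid2 S\<^esub> L x) = arr2 T (u1 (\<Lambda> x)) \<oplus>\<^bsub>mid2 T\<^esub> u2 (L x)" if "x \<in> l2_fin" for x
    using quasi_additive_closed[OF L(1) that] fin_linearD(1)[OF L(2) that] u(4) by (simp add: u2.add)
  ultimately have "fin_bounded (mid2 T) (\<lambda>x. arr2 T (u1 (\<Lambda> x)) \<oplus>\<^bsub>mid2 T\<^esub> u2 (L x))"
    by (subst fin_bounded_cong) auto
  moreover have "arr3 T (u2 (L x)) = x" if "x \<in> l2_fin" for x
    using u(5) fin_linearD(1)[OF L(2) that] L(3)[OF that] by simp
  ultimately show ?thesis unfolding liftable_def
    using u1.quasi_additive_compose[OF L(1)] u2.fin_linear_compose[OF L(2)] by blast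
qed

lemma fin_linear_id: "fin_linear l2 (\<lambda>x. x)"
  by (simp add: fin_linear_def l2_fin_carrier)

lemma fin_bounded_id: "fin_bounded l2 (\<lambda>x. x)"
  unfolding fin_bounded_def by (auto simp: l2_fin_carrier intro!: exI[of _ 1])

text \<open>
  The left square of an arrow is a pullback up to isomorphism: \<open>e\<close> is determined by
  \<open>(arr2 S e, u1 e)\<close>, with a norm estimate.
\<close>

lemma (in four_term) arrow_estimate:
  assumes T: "four_term X Y T" and u1: "qoperator (mid1 S) (mid1 T) u1"
    and u: "\<And>y. y\<in>carrier Y \<Longrightarrow> u1 (arr1 S y) = arr1 T y"
  obtains C where "0 < C" "\<And>e. e \<in> carrier (mid1 S) \<Longrightarrow>
    qnorm (mid1 S) e \<le> C * (qnorm (mid2 S) (arr2 S e) + qnorm (mid1 T) (u1 e))"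
proof -
  interpret T: four_term X Y T by (rule T)
  interpret u1: qoperator "mid1 S" "mid1 T" u1 by (rule u1)
  obtain C2 where C2: "0 < C2" "\<And>w. w \<in> arr2 S ` carrier (mid1 S) \<Longrightarrow>
    \<exists>v\<in>carrier (mid1 S). arr2 S v = w \<and> qnorm (mid1 S) v \<le> C2 * qnorm (mid2 S) w" using arr2_open by metis
  obtain C1 where C1: "0 < C1" "\<And>y. y \<in> carrier Y \<Longrightarrow> qnorm Y y \<le> C1 * qnorm (mid1 T) (arr1 T y)"
    using T.arr1_bounded_below by metis
  obtain A where A: "0 < A" "\<And>x. x \<in> carrier Y \<Longrightarrow> qnorm (mid1 S) (arr1 S x) \<le> A * qnorm Y x"
    using arr1.bounded by metis
  obtain U where U: "0 < U" "\<And>x. x \<in> carrier (mid1 S) \<Longrightarrow> qnorm (mid1 T) (u1 x) \<le> U * qnorm (mid1 S) x"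
    using u1.bounded by metis
  define K where "K = A * C1 * T.E1.qmod"
  have K: "K > 0" using A C1 by (simp add: K_def)
  define C where "C = E1.qmod * (C2 + K + K * (U * C2))"
  have C: "C > 0" using K C2 U by (simp add: C_def add_pos_pos)
  have "qnorm (mid1 S) e \<le> C * (qnorm (mid2 S) (arr2 S e) + qnorm (mid1 T) (u1 e))"
    if e: "e \<in> carrier (mid1 S)" for e
  proof -
    let ?a = "qnorm (mid2 S) (arr2 S e)" and ?b = "qnorm (mid1 T) (u1 e)"
    have ab: "0 \<le> ?a" "0 \<le> ?b" using e by auto
    \<comment> \<open>A controlled preimage v of \<open>arr2 S e\<close> differs from e by an
      element of Y, and the norm of that element can be read off in \<open>mid1 T\<close>, where u1
      becomes \<open>arr1 T\<close>.\<close>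
    obtain v where v: "v \<in> carrier (mid1 S)" "arr2 S v = arr2 S e" "qnorm (mid1 S) v \<le> C2 * ?a"
      using C2(2) e by blast
    have "arr2 S (e \<ominus>\<^bsub>mid1 S\<^esub> v) = \<zero>\<^bsub>mid2 S\<^esub>" using e v by (simp add: arr2.minus)
    then obtain y where y: "y \<in> carrier Y" "e \<ominus>\<^bsub>mid1 S\<^esub> v = arr1 S y"
      using arr2_eq_zeroD e v by blast
    have "qnorm (mid1 T) (u1 v) \<le> U * (C2 * ?a)"
      by (rule order_trans[OF U(2)[OF v(1)] mult_left_mono[OF v(3) less_imp_le[OF U(1)]]])
    moreover have "arr1 T y = u1 e \<ominus>\<^bsub>mid1 T\<^esub> u1 v"
      using u[OF y(1)] e v by (simp flip: y(2) add: u1.minus)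
    ultimately have "qnorm (mid1 T) (arr1 T y) \<le> T.E1.qmod * (?b + U * (C2 * ?a))"
      using e v by (auto intro!: T.E1.qnorm_minus_le)
    then have "C1 * qnorm (mid1 T) (arr1 T y) \<le> C1 * (T.E1.qmod * (?b + U * (C2 * ?a)))"
      using C1(1) by (intro mult_left_mono) auto
    then have "qnorm Y y \<le> C1 * (T.E1.qmod * (?b + U * (C2 * ?a)))" using C1(2)[OF y(1)] by linarith
    then have "A * qnorm Y y \<le> A * (C1 * (T.E1.qmod * (?b + U * (C2 * ?a))))"
      using A(1) by (intro mult_left_mono) auto
    then have "qnorm (mid1 S) (arr1 S y) \<le> K * (?b + U * (C2 * ?a))"
      using A(2)[OF y(1)] by (simp add: K_def mult.assoc)
    then have "qnorm (mid1 S) (arr1 S y \<oplus>\<^bsub>mid1 S\<^esub> v) \<le> E1.qmod * (K * (?b + U * (C2 * ?a)) + C2 * ?a)"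
      using y v by (intro E1.qnorm_triangle_le) auto
    also have "arr1 S y \<oplus>\<^bsub>mid1 S\<^esub> v = e" using e v by (simp flip: y(2) add: E1.minus_add_cancel)
    also have "E1.qmod * (K * (?b + U * (C2 * ?a)) + C2 * ?a) \<le> C * (?a + ?b)"
    proof -
      have "K * (?b + U * (C2 * ?a)) + C2 * ?a \<le> (C2 + K + K * (U * C2)) * (?a + ?b)"
        using ab K C2 U by (simp add: algebra_simps add_increasing2)
      then show ?thesis unfolding C_def mult.assoc by (intro mult_left_mono) (auto simp: less_imp_le)
    qed
    finally show ?thesis .
  qed
  then show ?thesis using that C by blast
qed

text \<open>Maps into T cannot be pulled back along u1 and u2 directly. Instead, choose in S a
  linear lift L and a bounded lift B of the identity; every \<Lambda> with
  \<open>arr2 S (\<Lambda> x)\<close> = B x - L x makes the boundedness condition automatic. What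
  has to be arranged is quasi-additivity, and by \<open>arrow_estimate\<close> it is enough that u1
  \<Lambda> is quasi-additive too.\<close>

lemma liftable_backward:
  assumes "four_seq_arrow l2 Y S T" "liftable T"
  shows "liftable S"
proof -
  interpret S: four_term l2 Y S using assms(1) by unfold_locales (simp add: four_seq_arrow_def)
  interpret T: four_term l2 Y T using assms(1) by unfold_locales (simp add: four_seq_arrow_def)
  obtain u1 u2 where u: "operator (mid1 S) (mid1 T) u1" "operator (mid2 S) (mid2 T) u2"
      "\<And>y. y\<in>carrier Y \<Longrightarrow> u1 (arr1 S y) = arr1 T y"
      "\<And>e. e\<in>carrier (mid1 S) \<Longrightarrow> u2 (arr2 S e) = arr2 T (u1 e)"
      "\<And>e. e\<in>carrier (mid2 S) \<Longrightarrow> arr3 T (u2 e) = arr3 S e"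
    using assms(1) unfolding four_seq_arrow_def by blast
  interpret u1: qoperator "mid1 S" "mid1 T" u1 by unfold_locales fact
  interpret u2: qoperator "mid2 S" "mid2 T" u2 by unfold_locales fact
  obtain \<Lambda>' L' where L': "quasi_additive (mid1 T) \<Lambda>'" "fin_linear (mid2 T) L'"
     "\<And>x. x\<in>l2_fin \<Longrightarrow> arr3 T (L' x) = x" "fin_bounded (mid2 T) (\<lambda>x. arr2 T (\<Lambda>' x) \<oplus>\<^bsub>mid2 T\<^esub> L' x)"
    using assms(2) unfolding liftable_def by blast
  note L'c = quasi_additive_closed[OF L'(1)] fin_linearD(1)[OF L'(2)]
  have fc: "x \<in> carrier l2" if "x \<in> l2_fin" for x :: "nat \<Rightarrow> 'a" using that by (simp add: l2_fin_carrier)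
  obtain L where L: "fin_linear (mid2 S) L" "\<And>x. x \<in> l2_fin \<Longrightarrow> arr3 S (L x) = x"
    using S.arr3.fin_linear_lift[OF fin_linear_id] S.exact(4) fc by metis
  note Lc = fin_linearD(1)[OF L(1)]
  obtain B where B: "fin_bounded (mid2 S) B" "\<And>x. x \<in> l2_fin \<Longrightarrow> arr3 S (B x) = x"
  proof -
    obtain C where "0 < C" "\<And>w. w \<in> carrier l2 \<Longrightarrow>
       \<exists>v\<in>carrier (mid2 S). arr3 S v = w \<and> qnorm (mid2 S) v \<le> C * qnorm l2 w" using S.arr3_open by metis
    from fin_bounded_lift[OF this fin_bounded_id fc] that show ?thesis by metis
  qed
  note Bc = fin_bounded_closed[OF B(1)]
  have "u2 (L x) \<ominus>\<^bsub>mid2 T\<^esub> L' x \<in> arr2 T ` carrier (mid1 T)" if x: "x \<in> l2_fin" for x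
    by (rule T.arr3_eq_zeroD) (use Lc[OF x] L'c(2)[OF x] L(2)[OF x] L'(3)[OF x] u(5) fc[OF x] in \<open>auto simp: T.arr3.minus\<close>)
  then obtain M where M: "fin_linear (mid1 T) M" "\<And>x. x \<in> l2_fin \<Longrightarrow> arr2 T (M x) = u2 (L x) \<ominus>\<^bsub>mid2 T\<^esub> L' x"
    using T.arr2.fin_linear_lift[OF T.E2.fin_linear_minus[OF u2.fin_linear_compose[OF L(1)] L'(2)]] by metis
  note Mc = fin_linearD(1)[OF M(1)]
  define b where "b x = arr2 T (\<Lambda>' x) \<oplus>\<^bsub>mid2 T\<^esub> L' x" for x
  have bc: "b x \<in> carrier (mid2 T)" if "x \<in> l2_fin" for x using L'c that by (simp add: b_def)
  have bb: "fin_bounded (mid2 T) (\<lambda>x. u2 (B x) \<ominus>\<^bsub>mid2 T\<^esub> b x)"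
    using L'(4) unfolding b_def[symmetric] by (intro T.E2.fin_bounded_minus u2.fin_bounded_compose B(1)) simp
  have bi: "u2 (B x) \<ominus>\<^bsub>mid2 T\<^esub> b x \<in> arr2 T ` carrier (mid1 T)" if x: "x \<in> l2_fin" for x
  proof (rule T.arr3_eq_zeroD)
    have "arr3 T (b x) = x"
      using L'c(1)[OF x] L'c(2)[OF x] L'(3)[OF x] by (simp add: b_def T.arr3.add T.arr3_arr2)
    then show "arr3 T (u2 (B x) \<ominus>\<^bsub>mid2 T\<^esub> b x) = \<zero>\<^bsub>l2\<^esub>"
      using Bc[OF x] bc[OF x] u(5) B(2)[OF x] fc[OF x] by (simp add: T.arr3.minus)
  qed (use Bc[OF x] bc[OF x] in auto)
  obtain C2 where C2: "0 < C2" "\<And>w. w \<in> arr2 T ` carrier (mid1 T) \<Longrightarrow>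
     \<exists>v\<in>carrier (mid1 T). arr2 T v = w \<and> qnorm (mid1 T) v \<le> C2 * qnorm (mid2 T) w" using T.arr2_open by metis
  obtain \<beta> where \<beta>: "fin_bounded (mid1 T) \<beta>" "\<And>x. x \<in> l2_fin \<Longrightarrow> arr2 T (\<beta> x) = u2 (B x) \<ominus>\<^bsub>mid2 T\<^esub> b x"
    using fin_bounded_lift[OF C2 bb bi] by metis
  note \<beta>c = fin_bounded_closed[OF \<beta>(1)]
  \<comment> \<open>The prescribed value of u1 \<Lambda>: the linear M makes up for the difference
    of the two linear lifts, the bounded \<beta> for that of the two bounded ones, so that
    \<open>arr2 T (G x)\<close> becomes u2 (B x - L x).\<close>
  define G where "G x = (\<Lambda>' x \<ominus>\<^bsub>mid1 T\<^esub> M x) \<oplus>\<^bsub>mid1 T\<^esub> \<beta> x" for x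
  have Gc: "G x \<in> carrier (mid1 T)" if "x \<in> l2_fin" for x using L'c Mc \<beta>c that by (simp add: G_def)
  have arr2G: "arr2 T (G x) = u2 (B x \<ominus>\<^bsub>mid2 S\<^esub> L x)" if x: "x \<in> l2_fin" for x
  proof -
    note c [simp] = L'c(1)[OF x] L'c(2)[OF x] Mc[OF x] \<beta>c[OF x] bc[OF x] Bc[OF x] Lc[OF x]
    let ?A = "arr2 T (\<Lambda>' x)" and ?m = "u2 (L x) \<ominus>\<^bsub>mid2 T\<^esub> L' x"
    have "arr2 T (G x) = (?A \<ominus>\<^bsub>mid2 T\<^esub> ?m) \<oplus>\<^bsub>mid2 T\<^esub> (u2 (B x) \<ominus>\<^bsub>mid2 T\<^esub> b x)"
      by (simp add: G_def T.arr2.add T.arr2.minus M(2)[OF x] \<beta>(2)[OF x])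
    also have "\<dots> = (?A \<oplus>\<^bsub>mid2 T\<^esub> u2 (B x)) \<ominus>\<^bsub>mid2 T\<^esub> (?m \<oplus>\<^bsub>mid2 T\<^esub> b x)"
      by (rule T.E2.add_minus_add[symmetric]) auto
    also have "?m \<oplus>\<^bsub>mid2 T\<^esub> b x = ?A \<oplus>\<^bsub>mid2 T\<^esub> (?m \<oplus>\<^bsub>mid2 T\<^esub> L' x)"
      unfolding b_def by (rule T.E2.a_lcomm) auto
    also have "?m \<oplus>\<^bsub>mid2 T\<^esub> L' x = u2 (L x)" by (rule T.E2.minus_add_cancel) auto
    also have "(?A \<oplus>\<^bsub>mid2 T\<^esub> u2 (B x)) \<ominus>\<^bsub>mid2 T\<^esub> (?A \<oplus>\<^bsub>mid2 T\<^esub> u2 (L x)) = u2 (B x) \<ominus>\<^bsub>mid2 T\<^esub> u2 (L x)"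
      by (simp add: T.E2.add_minus_add)
    finally show ?thesis by (simp add: u2.minus)
  qed
  \<comment> \<open>Existence in the pullback: the two prescribed values agree in
    \<open>mid2 T\<close>, so a preimage for the first is off in the second by an element of Y,
    which can be added without changing the first.\<close>
  have "\<exists>e\<in>carrier (mid1 S). arr2 S e = B x \<ominus>\<^bsub>mid2 S\<^esub> L x \<and> u1 e = G x" if x: "x \<in> l2_fin" for x
  proof -
    have "B x \<ominus>\<^bsub>mid2 S\<^esub> L x \<in> arr2 S ` carrier (mid1 S)"
      by (rule S.arr3_eq_zeroD) (use Bc[OF x] Lc[OF x] L(2)[OF x] B(2)[OF x] fc[OF x] in \<open>auto simp: S.arr3.minus\<close>)
    then obtain e0 where e0: "e0 \<in> carrier (mid1 S)" "arr2 S e0 = B x \<ominus>\<^bsub>mid2 S\<^esub> L x" by auto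
    have "arr2 T (G x \<ominus>\<^bsub>mid1 T\<^esub> u1 e0) = \<zero>\<^bsub>mid2 T\<^esub>"
      using Gc[OF x] e0 arr2G[OF x] Bc[OF x] Lc[OF x] by (simp add: T.arr2.minus flip: u(4))
    then obtain y where y: "y \<in> carrier Y" "G x \<ominus>\<^bsub>mid1 T\<^esub> u1 e0 = arr1 T y"
      using T.arr2_eq_zeroD[of "G x \<ominus>\<^bsub>mid1 T\<^esub> u1 e0"] Gc[OF x] e0 by auto
    have "u1 (e0 \<oplus>\<^bsub>mid1 S\<^esub> arr1 S y) = G x"
      using e0 y(1) Gc[OF x] u(3)[OF y(1)] by (simp add: u1.add T.E1.add_minus_cancel flip: y(2))
    moreover have "arr2 S (e0 \<oplus>\<^bsub>mid1 S\<^esub> arr1 S y) = B x \<ominus>\<^bsub>mid2 S\<^esub> L x"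
      using e0 y(1) Bc[OF x] Lc[OF x] by (simp add: S.arr2.add S.arr2_arr1)
    ultimately show ?thesis using e0(1) y(1) by (intro bexI[of _ "e0 \<oplus>\<^bsub>mid1 S\<^esub> arr1 S y"]) auto
  qed
  then obtain \<Lambda> where \<Lambda>: "\<And>x. x \<in> l2_fin \<Longrightarrow> \<Lambda> x \<in> carrier (mid1 S)"
    "\<And>x. x \<in> l2_fin \<Longrightarrow> arr2 S (\<Lambda> x) = B x \<ominus>\<^bsub>mid2 S\<^esub> L x" "\<And>x. x \<in> l2_fin \<Longrightarrow> u1 (\<Lambda> x) = G x"
    by metis
  have "quasi_additive (mid2 S) (\<lambda>x. B x \<ominus>\<^bsub>mid2 S\<^esub> L x)"
    by (rule S.E2.quasi_additive_minus[OF S.E2.fin_bounded_imp_quasi_additive[OF B(1)]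
          S.E2.fin_linear_imp_quasi_additive[OF L(1)]])
  then have qa2: "quasi_additive (mid2 S) (\<lambda>x. arr2 S (\<Lambda> x))"
    by (subst quasi_additive_cong) (use \<Lambda>(2) in auto)
  obtain Q1 where Q1: "0 \<le> Q1" "\<And>x y. x \<in> l2_fin \<Longrightarrow> y \<in> l2_fin \<Longrightarrow>
     qnorm (mid2 S) (cauchy_diff (mid2 S) (\<lambda>x. arr2 S (\<Lambda> x)) x y) \<le> Q1 * (norm2 x + norm2 y)"
    by (rule quasi_additiveE[OF qa2]) (rule that, assumption, blast)
  have "quasi_additive (mid1 T) G" unfolding G_def
    by (rule T.E1.quasi_additive_add[OF
          T.E1.quasi_additive_minus[OF L'(1) T.E1.fin_linear_imp_quasi_additive[OF M(1)]]
          T.E1.fin_bounded_imp_quasi_additive[OF \<beta>(1)]])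
  then have qa1: "quasi_additive (mid1 T) (\<lambda>x. u1 (\<Lambda> x))"
    by (subst quasi_additive_cong) (use \<Lambda>(3) in auto)
  obtain Q2 where Q2: "0 \<le> Q2" "\<And>x y. x \<in> l2_fin \<Longrightarrow> y \<in> l2_fin \<Longrightarrow>
     qnorm (mid1 T) (cauchy_diff (mid1 T) (\<lambda>x. u1 (\<Lambda> x)) x y) \<le> Q2 * (norm2 x + norm2 y)"
    by (rule quasi_additiveE[OF qa1]) (rule that, assumption, blast)
  obtain C where C: "0 < C" "\<And>e. e \<in> carrier (mid1 S) \<Longrightarrow>
    qnorm (mid1 S) e \<le> C * (qnorm (mid2 S) (arr2 S e) + qnorm (mid1 T) (u1 e))"
    using S.arrow_estimate[OF T.four_term_axioms u1.qoperator_axioms u(3)] by metis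
  have "qnorm (mid1 S) (cauchy_diff (mid1 S) \<Lambda> x y) \<le> (C * (Q1 + Q2)) * (norm2 x + norm2 y)"
    if xy: "x \<in> l2_fin" "y \<in> l2_fin" for x y
  proof -
    have c: "cauchy_diff (mid1 S) \<Lambda> x y \<in> carrier (mid1 S)" using \<Lambda>(1) xy by (simp add: l2_fin_add)
    have "qnorm (mid1 S) (cauchy_diff (mid1 S) \<Lambda> x y) \<le>
      C * (Q1 * (norm2 x + norm2 y) + Q2 * (norm2 x + norm2 y))"
      by (rule order_trans[OF C(2)[OF c]])
        (use Q1(2)[OF xy] Q2(2)[OF xy] \<Lambda>(1) xy C(1) in
          \<open>auto simp: S.arr2.cauchy_diff_compose u1.cauchy_diff_compose intro!: mult_left_mono add_mono\<close>)
    then show ?thesis by (simp add: algebra_simps)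
  qed
  then have "quasi_additive (mid1 S) \<Lambda>"
    unfolding quasi_additive_def using \<Lambda>(1) C(1) Q1(1) Q2(1) by (auto intro!: exI[of _ "C * (Q1 + Q2)"])
  moreover have "fin_bounded (mid2 S) (\<lambda>x. arr2 S (\<Lambda> x) \<oplus>\<^bsub>mid2 S\<^esub> L x)"
    using B(1) by (subst fin_bounded_cong[where g = B])
      (use \<Lambda>(2) Bc Lc in \<open>auto simp: S.E2.minus_add_cancel\<close>)
  ultimately show ?thesis unfolding liftable_def using L by blast
qed

text \<open>The last arrow is split by the identity of \<open>l2\<close>, which is linear and
  bounded at once, so \<Lambda> can be zero.\<close>

lemma liftable_zero_seq:
  assumes "quasi_banach Y" "quasi_banach (l2 :: ('k::real_normed_field, nat \<Rightarrow> 'k) qspace)"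
  shows "liftable (zero_seq (l2 :: ('k, nat \<Rightarrow> 'k) qspace) Y :: ('k, 'y, nat \<Rightarrow> 'k, 'y + (nat \<Rightarrow> 'k) + 'u) four_seq)"
proof -
  interpret Y: qbanach Y using assms(1) by (rule quasi_banachD)
  let ?Y = "copy_space Inl Y :: ('k, 'y + (nat \<Rightarrow> 'k) + 'u) qspace"
  let ?X = "copy_space (Inr \<circ> Inl) l2 :: ('k, 'y + (nat \<Rightarrow> 'k) + 'u) qspace"
  have i: "inj_on (Inl :: 'y \<Rightarrow> 'y + (nat \<Rightarrow> 'k) + 'u) (carrier Y)"
    "inj_on (Inr \<circ> Inl :: _ \<Rightarrow> 'y + (nat \<Rightarrow> 'k) + 'u) (carrier l2)" by (auto simp: inj_on_def)
  interpret CY: qnormed ?Y using i(1) by (rule Y.qnormed_copy_space)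
  interpret CX: qnormed ?X using i(2) by (rule l2.qnormed_copy_space)
  interpret f: qoperator l2 ?X "Inr \<circ> Inl" by unfold_locales (rule l2.operator_into_copy[OF i(2)])
  have "fin_linear ?Y (\<lambda>x. \<zero>\<^bsub>?Y\<^esub>)" by (simp add: fin_linear_def)
  then have 1: "quasi_additive ?Y (\<lambda>x. Inl \<zero>\<^bsub>Y\<^esub>)"
    using CY.fin_linear_imp_quasi_additive by (simp add: Y.copy_space_simps(2)[OF i(1)])
  have 2: "fin_linear ?X (\<lambda>x. (Inr \<circ> Inl) x)" using f.fin_linear_compose[OF fin_linear_id] .
  have z: "Inr (Inl \<zero>\<^bsub>l2\<^esub>) = \<zero>\<^bsub>?X\<^esub>" using l2.copy_space_simps(2)[OF i(2)] by (simp only: o_apply)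
  have eq: "Inr (Inl \<zero>\<^bsub>l2\<^esub>) \<oplus>\<^bsub>?X\<^esub> (Inr \<circ> Inl) x = (Inr \<circ> Inl) x" if "x \<in> l2_fin" for x
    unfolding z by (rule CX.l_zero, rule f.closed) (simp add: l2_fin_carrier that)
  have "fin_bounded ?X (\<lambda>x. Inr (Inl \<zero>\<^bsub>l2\<^esub>) \<oplus>\<^bsub>?X\<^esub> (Inr \<circ> Inl) x)"
    by (rule iffD2[OF fin_bounded_cong[OF eq] f.fin_bounded_compose[OF fin_bounded_id]])
  with 1 2 show ?thesis unfolding liftable_def zero_seq_def
    by (intro exI[of _ "\<lambda>x. Inl \<zero>\<^bsub>Y\<^esub>"] exI[of _ "\<lambda>x. (Inr \<circ> Inl) x"]) auto
qed

text \<open>The equivalence is generated by chains whose arrows point either way, so the property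
  has to be transported in both directions.\<close>

theorem ext2_trivial_imp_liftable:
  fixes S :: "('k::real_normed_field, 'y, nat \<Rightarrow> 'k, 'y + (nat \<Rightarrow> 'k) + 'u) four_seq"
  assumes "ext2_trivial l2 Y S"
  shows "liftable S"
proof -
  have *: "zero_seq l2 Y \<in> (four_term_seqs l2 Y :: ('k, 'y, nat \<Rightarrow> 'k, 'y + (nat \<Rightarrow> 'k) + 'u) four_seq set)"
    "equivclp (four_seq_arrow l2 Y) S (zero_seq l2 Y)"
    using assms by (auto simp: ext2_trivial_def ext2_rel_def)
  from *(1) have "liftable (zero_seq l2 Y :: ('k, 'y, nat \<Rightarrow> 'k, 'y + (nat \<Rightarrow> 'k) + 'u) four_seq)"
    by (intro liftable_zero_seq) (auto simp: four_term_seqs_def)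
  with *(2) show ?thesis
  proof (induction rule: equivclp_induct)
    case (step y z)
    then show ?case using liftable_forward liftable_backward by blast
  qed
qed

subsection \<open>Spliced sequences\<close>

lemma inj_emb_Z1: "inj emb_Z1" and inj_emb_Z2: "inj emb_Z2"
  by (auto simp: inj_def emb_Z1_def emb_Z2_def)

locale splice = K1: quasilinear Y E E0 \<Phi> + K2: quasilinear E X X0 \<Psi>
  for Y :: "('k::real_normed_field, 'y) qspace" and E :: "('k, 'e) qspace" and E0 \<Phi>
    and X :: "('k, 'x) qspace" and X0 \<Psi> +
  fixes S :: "('k, 'y, 'x, ('y, 'e, 'x, 'w) splice_univ) four_seq"
  assumes S: "S = yoneda_splice Y E E0 X X0 \<Phi> \<Psi>"
begin

lemma S_simps:
  "mid1 S = copy_space emb_Z1 K1.Z" "mid2 S = copy_space emb_Z2 K2.Z"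
  "arr1 S y = emb_Z1 (Z_incl Y E E0 \<Phi> y)"
  "arr2 S (emb_Z1 z) = emb_Z2 (Z_incl E X X0 \<Psi> (Z_quot E z))"
  "arr3 S (emb_Z2 z') = Z_quot X z'"
  by (simp_all add: S yoneda_splice_def the_inv_f_f inj_emb_Z1 inj_emb_Z2)

lemma inj1: "inj_on emb_Z1 (carrier K1.Z)" and inj2: "inj_on emb_Z2 (carrier K2.Z)"
  using inj_emb_Z1 inj_emb_Z2 by (auto intro: inj_on_subset)

lemma quasi_banach_mid: "quasi_banach (mid1 S)" "quasi_banach (mid2 S)"
  unfolding S_simps
  using quasi_banach_copy_space[OF K1.quasi_banach_Z inj1] quasi_banach_copy_space[OF K2.quasi_banach_Z inj2]
  by simp_all

sublocale M1: qbanach "mid1 S" by (rule quasi_banachD[OF quasi_banach_mid(1)])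
sublocale M2: qbanach "mid2 S" by (rule quasi_banachD[OF quasi_banach_mid(2)])

sublocale into1: qoperator K1.Z "mid1 S" emb_Z1
  by unfold_locales (use K1.Z.operator_into_copy[OF inj1] in \<open>simp add: S_simps\<close>)

sublocale into2: qoperator K2.Z "mid2 S" emb_Z2
  by unfold_locales (use K2.Z.operator_into_copy[OF inj2] in \<open>simp add: S_simps\<close>)

sublocale from1: qoperator "mid1 S" K1.Z "the_inv emb_Z1"
  by unfold_locales
    (use K1.Z.operator_from_copy[OF inj1, of "the_inv emb_Z1"] in \<open>simp add: S_simps the_inv_f_f inj_emb_Z1\<close>)

sublocale from2: qoperator "mid2 S" K2.Z "the_inv emb_Z2"
  by unfold_locales
    (use K2.Z.operator_from_copy[OF inj2, of "the_inv emb_Z2"] in \<open>simp add: S_simps the_inv_f_f inj_emb_Z2\<close>)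

sublocale incl1: qoperator Y K1.Z "Z_incl Y E E0 \<Phi>"
  by unfold_locales (rule K1.operator_Z_incl)

sublocale incl2: qoperator E K2.Z "Z_incl E X X0 \<Psi>"
  by unfold_locales (rule K2.operator_Z_incl)

lemma carrier_mid: "carrier (mid1 S) = emb_Z1 ` carrier K1.Z" "carrier (mid2 S) = emb_Z2 ` carrier K2.Z"
  by (simp_all add: S_simps K1.Z.copy_space_simps[OF inj1] K2.Z.copy_space_simps[OF inj2])

lemma zero_mid: "\<zero>\<^bsub>mid1 S\<^esub> = emb_Z1 \<zero>\<^bsub>K1.Z\<^esub>" "\<zero>\<^bsub>mid2 S\<^esub> = emb_Z2 \<zero>\<^bsub>K2.Z\<^esub>"
  by (simp_all add: into1.zero into2.zero)

text \<open>The middle arrow is a surjection onto E followed by an injection of E: its kernel is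
  that of the quotient map and its image that of the inclusion.\<close>

lemma splice_four_term: "S \<in> four_term_seqs X Y"
  unfolding four_term_seqs_def
proof (intro CollectI conjI)
  show "quasi_banach Y" "quasi_banach X"
    by (simp_all add: quasi_banach_iff_qbanach K1.Y.qbanach_axioms K2.X.qbanach_axioms)
  show "quasi_banach (mid1 S)" "quasi_banach (mid2 S)" by (rule quasi_banach_mid)+
  have "arr1 S = (\<lambda>y. emb_Z1 (Z_incl Y E E0 \<Phi> y))" by (rule ext) (simp add: S_simps)
  then show "operator Y (mid1 S) (arr1 S)"
    using operator_compose[OF incl1.qoperator_axioms into1.qoperator_axioms] by simp
  have "operator K1.Z K2.Z (\<lambda>z. Z_incl E X X0 \<Psi> (Z_quot E z))"
    by (rule operator_compose[OF K1.quot.qoperator_axioms incl2.qoperator_axioms])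
  then interpret m: qoperator K1.Z K2.Z "\<lambda>z. Z_incl E X X0 \<Psi> (Z_quot E z)" by unfold_locales
  have "operator (mid1 S) K2.Z (\<lambda>u. Z_incl E X X0 \<Psi> (Z_quot E (the_inv emb_Z1 u)))"
    by (rule operator_compose[OF from1.qoperator_axioms m.qoperator_axioms])
  then interpret m': qoperator "mid1 S" K2.Z "\<lambda>u. Z_incl E X X0 \<Psi> (Z_quot E (the_inv emb_Z1 u))" by unfold_locales
  have "arr2 S = (\<lambda>u. emb_Z2 (Z_incl E X X0 \<Psi> (Z_quot E (the_inv emb_Z1 u))))"
    by (simp add: S yoneda_splice_def)
  then show "operator (mid1 S) (mid2 S) (arr2 S)"
    using operator_compose[OF m'.qoperator_axioms into2.qoperator_axioms] by simp
  have "arr3 S = (\<lambda>u. Z_quot X (the_inv emb_Z2 u))" by (simp add: S yoneda_splice_def)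
  then show "operator (mid2 S) X (arr3 S)"
    using operator_compose[OF from2.qoperator_axioms K2.quot.qoperator_axioms] by simp
  have "op_kernel Y (mid1 S) (arr1 S) = op_kernel Y K1.Z (Z_incl Y E E0 \<Phi>)"
    by (simp add: op_kernel_def S_simps(3) zero_mid inj_eq[OF inj_emb_Z1] del: into1.zero)
  then show "op_kernel Y (mid1 S) (arr1 S) = {\<zero>\<^bsub>Y\<^esub>}" by (simp add: K1.Z_incl_kernel)
  have "Z_incl E X X0 \<Psi> e = \<zero>\<^bsub>K2.Z\<^esub> \<longleftrightarrow> e = \<zero>\<^bsub>E\<^esub>" if "e \<in> carrier E" for e
    using K2.Z_incl_kernel that by (auto simp: op_kernel_def)
  then have "op_kernel (mid1 S) (mid2 S) (arr2 S) = emb_Z1 ` op_kernel K1.Z E (Z_quot E)"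
    by (auto simp: op_kernel_def carrier_mid S_simps(4) zero_mid inj_eq[OF inj_emb_Z2] simp del: into2.zero)
  then show "op_kernel (mid1 S) (mid2 S) (arr2 S) = arr1 S ` carrier Y"
    by (simp add: K1.Z_quot_kernel image_image S_simps(3))
  have "op_kernel (mid2 S) X (arr3 S) = emb_Z2 ` op_kernel K2.Z X (Z_quot X)"
    by (auto simp: op_kernel_def carrier_mid S_simps(5))
  also have "\<dots> = emb_Z2 ` Z_incl E X X0 \<Psi> ` Z_quot E ` carrier K1.Z"
    by (simp add: K2.Z_quot_kernel K1.Z_quot_surj)
  also have "\<dots> = arr2 S ` carrier (mid1 S)"
    by (simp add: carrier_mid image_image S_simps(4))
  finally show "op_kernel (mid2 S) X (arr3 S) = arr2 S ` carrier (mid1 S)" .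
  show "carrier X = arr3 S ` carrier (mid2 S)"
    by (simp add: carrier_mid image_image S_simps(5) K2.Z_quot_surj)
qed

sublocale four_term X Y S by unfold_locales (rule splice_four_term)

text \<open>Elements of the middle spaces given by actual pairs instead of classes of Cauchy
  sequences; on them the arrows have explicit formulas.\<close>

definition pair1 where "pair1 v = emb_Z1 (K1.emb v)"
definition pair2 where "pair2 v = emb_Z2 (K2.emb v)"

sublocale pair1: qoperator K1.D "mid1 S" pair1
  using operator_compose[OF K1.emb.qoperator_axioms into1.qoperator_axioms]
  by unfold_locales (simp add: pair1_def[abs_def])

sublocale pair2: qoperator K2.D "mid2 S" pair2
  using operator_compose[OF K2.emb.qoperator_axioms into2.qoperator_axioms]
  by unfold_locales (simp add: pair2_def[abs_def])

lemma arr1_pair1: "arr1 S y = pair1 (y, \<zero>\<^bsub>E\<^esub>)"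
  by (simp add: S_simps(3) pair1_def K1.Z_incl_eq_emb)

lemma arr2_pair1: "y \<in> carrier Y \<Longrightarrow> e \<in> E0 \<Longrightarrow> arr2 S (pair1 (y, e)) = pair2 (e, \<zero>\<^bsub>X\<^esub>)"
  by (simp add: S_simps(4) pair1_def pair2_def K1.Z_quot_emb K2.Z_incl_eq_emb)

lemma arr3_pair2: "e \<in> carrier E \<Longrightarrow> x \<in> X0 \<Longrightarrow> arr3 S (pair2 (e, x)) = x"
  by (simp add: S_simps(5) pair2_def K2.Z_quot_emb)

lemma qnorm_pair1: "v \<in> carrier K1.D \<Longrightarrow> qnorm K1.D v \<le> 2 * K1.D.qmod * qnorm (mid1 S) (pair1 v)"
  using K1.qnorm_le_qnorm_emb[of v] unfolding pair1_def S_simps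
  by (simp add: K1.Z.copy_space_simps[OF inj1] del: K1.D_simps)

lemma qnorm_pair2: "v \<in> carrier K2.D \<Longrightarrow> qnorm (mid2 S) (pair2 v) \<le> qnorm K2.D v"
  using K2.qnorm_emb_le[of v] unfolding pair2_def S_simps
  by (simp add: K2.Z.copy_space_simps[OF inj2] del: K2.D_simps)

end

text \<open>Corrected by a bounded and a linear map, \<Lambda> takes at x a value that lies over
  \<Psi> x, hence is a pair (\<open>\<Theta>\<close> x, \<Psi> x). The quasinorm of the twisted sum
  then compares the Cauchy difference of \<open>\<Theta>\<close> with \<Phi> at that of
  \<Psi>.\<close>

lemma liftable_splice_correction:
  fixes Y :: "('k::{real_normed_field,banach}, 'y) qspace"
    and S :: "('k, 'y, nat \<Rightarrow> 'k, ('y, nat \<Rightarrow> 'k, nat \<Rightarrow> 'k, 'w) splice_univ) four_seq"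
  assumes sp: "splice Y l2 l2_fin \<Phi> l2 l2_fin \<Psi> S" and lift: "liftable S"
    and \<Psi>: "\<And>x. x \<in> l2_fin \<Longrightarrow> \<Psi> x \<in> l2_fin"
  obtains \<Theta> Q where "\<And>x. x \<in> l2_fin \<Longrightarrow> \<Theta> x \<in> carrier Y" "0 \<le> Q"
    "\<And>x y. x \<in> l2_fin \<Longrightarrow> y \<in> l2_fin \<Longrightarrow>
      qnorm Y (cauchy_diff Y \<Theta> x y \<ominus>\<^bsub>Y\<^esub> \<Phi> (cauchy_diff l2 \<Psi> x y)) \<le> Q * (norm2 x + norm2 y)"
proof -
  interpret splice Y l2 l2_fin \<Phi> l2 l2_fin \<Psi> S by (rule sp)
  obtain \<Lambda> L where L: "quasi_additive (mid1 S) \<Lambda>" "fin_linear (mid2 S) L"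
     "\<And>x. x\<in>l2_fin \<Longrightarrow> arr3 S (L x) = x" "fin_bounded (mid2 S) (\<lambda>x. arr2 S (\<Lambda> x) \<oplus>\<^bsub>mid2 S\<^esub> L x)"
    using lift unfolding liftable_def by blast
  note Lc = quasi_additive_closed[OF L(1)] fin_linearD(1)[OF L(2)]
  have fc: "x \<in> carrier l2" if "x \<in> l2_fin" for x :: "nat \<Rightarrow> 'k" using that by (simp add: l2_fin_carrier)
  have p\<Psi>: "pair2 (\<Psi> x, x) \<in> carrier (mid2 S)" "pair2 (\<zero>\<^bsub>l2\<^esub>, x) \<in> carrier (mid2 S)"
    "pair2 (\<Psi> x, \<zero>\<^bsub>l2\<^esub>) \<in> carrier (mid2 S)" "pair1 (\<zero>\<^bsub>Y\<^esub>, \<Psi> x) \<in> carrier (mid1 S)" if "x \<in> l2_fin" for x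
    using that \<Psi>[OF that] fc[OF \<Psi>[OF that]] K2.X0_zero by (auto simp del: l2_simps intro!: pair2.closed pair1.closed)
  \<comment> \<open>In Z(\<Psi>) the pair (\<Psi> x, x) is a bounded lift of x and (0, x) a linear
    one. Their difference (\<Psi> x, 0) is the image of the pair (0, \<Psi> x) of the first middle
    space.\<close>
  have bp: "fin_bounded (mid2 S) (\<lambda>x. pair2 (\<Psi> x, x))"
  proof -
    have "qnorm (mid2 S) (pair2 (\<Psi> x, x)) \<le> 1 * norm2 x" if "x \<in> l2_fin" for x
      using qnorm_pair2[of "(\<Psi> x, x)"] that fc[OF \<Psi>[OF that]] by (simp del: l2_simps(1) add: l2.minus_self) (simp add: norm2_def[of "\<lambda>_. 0"])
    then show ?thesis unfolding fin_bounded_def using p\<Psi> zero_le_one by blast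
  qed
  define d where "d x = (arr2 S (\<Lambda> x) \<oplus>\<^bsub>mid2 S\<^esub> L x) \<ominus>\<^bsub>mid2 S\<^esub> pair2 (\<Psi> x, x)" for x
  have dc: "d x \<in> carrier (mid2 S)" if "x \<in> l2_fin" for x using Lc p\<Psi> that by (simp add: d_def)
  have db: "fin_bounded (mid2 S) d" unfolding d_def by (rule M2.fin_bounded_minus[OF L(4) bp])
  have di: "d x \<in> arr2 S ` carrier (mid1 S)" if x: "x \<in> l2_fin" for x
    by (rule arr3_eq_zeroD[OF dc[OF x]])
      (use Lc(1)[OF x] Lc(2)[OF x] p\<Psi>[OF x] L(3)[OF x] x fc[OF x] fc[OF \<Psi>[OF x]] in
        \<open>simp add: d_def arr3.minus arr3.add arr3_arr2 arr3_pair2\<close>)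
  obtain C2 where C2: "0 < C2" "\<And>w. w \<in> arr2 S ` carrier (mid1 S) \<Longrightarrow>
     \<exists>v\<in>carrier (mid1 S). arr2 S v = w \<and> qnorm (mid1 S) v \<le> C2 * qnorm (mid2 S) w" using arr2_open by metis
  obtain \<beta> where \<beta>: "fin_bounded (mid1 S) \<beta>" "\<And>x. x \<in> l2_fin \<Longrightarrow> arr2 S (\<beta> x) = d x"
    using fin_bounded_lift[OF C2 db di] by metis
  note \<beta>c = fin_bounded_closed[OF \<beta>(1)]
  have lp: "fin_linear (mid2 S) (\<lambda>x. pair2 (\<zero>\<^bsub>l2\<^esub>, x))"
    unfolding fin_linear_def
  proof (intro conjI ballI allI)
    fix x y :: "nat \<Rightarrow> 'k" and c assume x: "x \<in> l2_fin"
    show "pair2 (\<zero>\<^bsub>l2\<^esub>, x) \<in> carrier (mid2 S)" by (rule p\<Psi>[OF x])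
    show "pair2 (\<zero>\<^bsub>l2\<^esub>, \<lambda>n. c * x n) = c \<odot>\<^bsub>mid2 S\<^esub> pair2 (\<zero>\<^bsub>l2\<^esub>, x)"
      using pair2.smult[of "(\<zero>\<^bsub>l2\<^esub>, x)" c] x by simp
    assume y: "y \<in> l2_fin"
    show "pair2 (\<zero>\<^bsub>l2\<^esub>, \<lambda>n. x n + y n) = pair2 (\<zero>\<^bsub>l2\<^esub>, x) \<oplus>\<^bsub>mid2 S\<^esub> pair2 (\<zero>\<^bsub>l2\<^esub>, y)"
      using pair2.add[of "(\<zero>\<^bsub>l2\<^esub>, x)" "(\<zero>\<^bsub>l2\<^esub>, y)"] x y by simp
  qed
  have "L x \<ominus>\<^bsub>mid2 S\<^esub> pair2 (\<zero>\<^bsub>l2\<^esub>, x) \<in> arr2 S ` carrier (mid1 S)" if x: "x \<in> l2_fin" for x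
    by (rule arr3_eq_zeroD)
      (use Lc(2)[OF x] p\<Psi>(2)[OF x] L(3)[OF x] x fc[OF x] in \<open>simp_all add: arr3.minus arr3_pair2\<close>)
  then obtain M where M: "fin_linear (mid1 S) M"
    "\<And>x. x \<in> l2_fin \<Longrightarrow> arr2 S (M x) = L x \<ominus>\<^bsub>mid2 S\<^esub> pair2 (\<zero>\<^bsub>l2\<^esub>, x)"
    using arr2.fin_linear_lift[OF M2.fin_linear_minus[OF L(2) lp]] by metis
  note Mc = fin_linearD(1)[OF M(1)]
  \<comment> \<open>Subtracting \<beta> replaces the bounded lift arr2 \<Lambda> + L by (\<Psi> x,
    x), and adding M replaces L by (0, x); hence \<open>G x\<close> has the same image as (0, \<Psi>
    x).\<close>
  define G where "G x = (\<Lambda> x \<ominus>\<^bsub>mid1 S\<^esub> \<beta> x) \<oplus>\<^bsub>mid1 S\<^esub> M x" for x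
  have Gc: "G x \<in> carrier (mid1 S)" if "x \<in> l2_fin" for x using Lc \<beta>c Mc that by (simp add: G_def)
  have qG: "quasi_additive (mid1 S) G" unfolding G_def
    by (rule M1.quasi_additive_add[OF
          M1.quasi_additive_minus[OF L(1) M1.fin_bounded_imp_quasi_additive[OF \<beta>(1)]]
          M1.fin_linear_imp_quasi_additive[OF M(1)]])
  have arr2G: "arr2 S (G x) = arr2 S (pair1 (\<zero>\<^bsub>Y\<^esub>, \<Psi> x))" if x: "x \<in> l2_fin" for x
  proof -
    note c [simp] = Lc(1)[OF x] Lc(2)[OF x] p\<Psi>[OF x] dc[OF x] \<beta>c[OF x] Mc[OF x]
    let ?p = "pair2 (\<Psi> x, x)" and ?r = "pair2 (\<zero>\<^bsub>l2\<^esub>, x)"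
    have "arr2 S (G x) = (arr2 S (\<Lambda> x) \<ominus>\<^bsub>mid2 S\<^esub> d x) \<oplus>\<^bsub>mid2 S\<^esub> (L x \<ominus>\<^bsub>mid2 S\<^esub> ?r)"
      by (simp add: G_def arr2.add arr2.minus \<beta>(2)[OF x] M(2)[OF x] del: l2_simps)
    also have "\<dots> = (arr2 S (\<Lambda> x) \<oplus>\<^bsub>mid2 S\<^esub> L x) \<ominus>\<^bsub>mid2 S\<^esub> (d x \<oplus>\<^bsub>mid2 S\<^esub> ?r)"
      by (rule M2.add_minus_add[symmetric]) (auto simp del: l2_simps)
    also have "arr2 S (\<Lambda> x) \<oplus>\<^bsub>mid2 S\<^esub> L x = d x \<oplus>\<^bsub>mid2 S\<^esub> ?p"
      unfolding d_def by (rule M2.minus_add_cancel[symmetric]) auto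
    also have "(d x \<oplus>\<^bsub>mid2 S\<^esub> ?p) \<ominus>\<^bsub>mid2 S\<^esub> (d x \<oplus>\<^bsub>mid2 S\<^esub> ?r) = ?p \<ominus>\<^bsub>mid2 S\<^esub> ?r"
      by (simp add: M2.add_minus_add del: l2_simps)
    also have "\<dots> = pair2 ((\<Psi> x, x) \<ominus>\<^bsub>K2.D\<^esub> (\<zero>\<^bsub>l2\<^esub>, x))"
      by (rule pair2.minus[symmetric]) (use x fc[OF \<Psi>[OF x]] in auto)
    also have "(\<Psi> x, x) \<ominus>\<^bsub>K2.D\<^esub> (\<zero>\<^bsub>l2\<^esub>, x) = (\<Psi> x, \<zero>\<^bsub>l2\<^esub>)"
      using x fc[OF x] fc[OF \<Psi>[OF x]] by (subst K2.D_minus) (auto simp del: l2_simps simp: l2.minus_self l2.minus_zero)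
    also have "pair2 (\<Psi> x, \<zero>\<^bsub>l2\<^esub>) = arr2 S (pair1 (\<zero>\<^bsub>Y\<^esub>, \<Psi> x))"
      by (rule arr2_pair1[symmetric]) (use \<Psi>[OF x] in auto)
    finally show ?thesis .
  qed
  have "\<exists>y\<in>carrier Y. G x = pair1 (y, \<Psi> x)" if x: "x \<in> l2_fin" for x
  proof -
    have "arr2 S (G x \<ominus>\<^bsub>mid1 S\<^esub> pair1 (\<zero>\<^bsub>Y\<^esub>, \<Psi> x)) = \<zero>\<^bsub>mid2 S\<^esub>"
      using arr2G[OF x] Gc[OF x] p\<Psi>(4)[OF x] by (simp add: arr2.minus)
    then obtain y where y: "y \<in> carrier Y" "G x \<ominus>\<^bsub>mid1 S\<^esub> pair1 (\<zero>\<^bsub>Y\<^esub>, \<Psi> x) = arr1 S y"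
      using arr2_eq_zeroD[of "G x \<ominus>\<^bsub>mid1 S\<^esub> pair1 (\<zero>\<^bsub>Y\<^esub>, \<Psi> x)"] Gc[OF x] p\<Psi>(4)[OF x] by auto
    have "G x = pair1 (y, \<zero>\<^bsub>l2\<^esub>) \<oplus>\<^bsub>mid1 S\<^esub> pair1 (\<zero>\<^bsub>Y\<^esub>, \<Psi> x)"
      using Gc[OF x] p\<Psi>(4)[OF x] unfolding arr1_pair1[symmetric] y(2)[symmetric] by (simp add: M1.minus_add_cancel)
    also have "\<dots> = pair1 ((y, \<zero>\<^bsub>l2\<^esub>) \<oplus>\<^bsub>K1.D\<^esub> (\<zero>\<^bsub>Y\<^esub>, \<Psi> x))"
      by (rule pair1.add[symmetric]) (use y \<Psi>[OF x] K1.X0_zero in \<open>auto simp del: l2_simps\<close>)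
    also have "(y, \<zero>\<^bsub>l2\<^esub>) \<oplus>\<^bsub>K1.D\<^esub> (\<zero>\<^bsub>Y\<^esub>, \<Psi> x) = (y, \<Psi> x)" using y by simp
    finally show ?thesis using y(1) by blast
  qed
  then obtain \<Theta> where \<Theta>: "\<And>x. x \<in> l2_fin \<Longrightarrow> \<Theta> x \<in> carrier Y" "\<And>x. x \<in> l2_fin \<Longrightarrow> G x = pair1 (\<Theta> x, \<Psi> x)" by metis
  obtain Q where Q: "0 \<le> Q" "\<And>x y. x \<in> l2_fin \<Longrightarrow> y \<in> l2_fin \<Longrightarrow>
     qnorm (mid1 S) (cauchy_diff (mid1 S) G x y) \<le> Q * (norm2 x + norm2 y)"
    by (rule quasi_additiveE[OF qG]) (rule that, assumption, blast)
  have "qnorm Y (cauchy_diff Y \<Theta> x y \<ominus>\<^bsub>Y\<^esub> \<Phi> (cauchy_diff l2 \<Psi> x y)) \<le> (2 * K1.D.qmod * Q) * (norm2 x + norm2 y)"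
    if xy: "x \<in> l2_fin" "y \<in> l2_fin" for x y
  proof -
    let ?z = "\<lambda>n. x n + y n"
    have z: "?z \<in> l2_fin" using xy by (rule l2_fin_add)
    \<comment> \<open>Since \<Psi> preserves \<open>l2_fin\<close>, this pair lies in the
      uncompleted twisted sum, where the quasinorm is explicit.\<close>
    let ?v = "(cauchy_diff Y \<Theta> x y, cauchy_diff l2 \<Psi> x y)"
    have D: "(\<Theta> x, \<Psi> x) \<in> carrier K1.D" "(\<Theta> y, \<Psi> y) \<in> carrier K1.D" "(\<Theta> ?z, \<Psi> ?z) \<in> carrier K1.D"
      using \<Theta>(1) \<Psi> xy z by auto
    have v: "?v = (\<Theta> ?z, \<Psi> ?z) \<ominus>\<^bsub>K1.D\<^esub> ((\<Theta> x, \<Psi> x) \<oplus>\<^bsub>K1.D\<^esub> (\<Theta> y, \<Psi> y))"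
      using \<Theta>(1) \<Psi> xy z K1.X0_add by (simp only: K1.D_simps) (subst K1.D_minus; simp del: l2_simps)
    have vc: "?v \<in> carrier K1.D" unfolding v using D by (intro K1.D.minus_closed K1.D.a_closed)
    have "pair1 ?v = cauchy_diff (mid1 S) G x y"
      unfolding v \<Theta>(2)[OF z] \<Theta>(2)[OF xy(1)] \<Theta>(2)[OF xy(2)]
      using D by (simp only: pair1.minus pair1.add K1.D.a_closed)
    then have "qnorm K1.D ?v \<le> 2 * K1.D.qmod * qnorm (mid1 S) (cauchy_diff (mid1 S) G x y)"
      using qnorm_pair1[OF vc] by simp
    also have "\<dots> \<le> 2 * K1.D.qmod * (Q * (norm2 x + norm2 y))"
      using Q(2)[OF xy] by (intro mult_left_mono) (auto simp: less_imp_le)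
    finally have "qnorm K1.D ?v \<le> (2 * K1.D.qmod * Q) * (norm2 x + norm2 y)" by (simp only: mult.assoc)
    moreover have "0 \<le> qnorm l2 (cauchy_diff l2 \<Psi> x y)"
      using \<Psi>[OF xy(1)] \<Psi>[OF xy(2)] \<Psi>[OF z] fc
      by (intro l2.qnorm_nonneg l2.minus_closed l2.a_closed)
    ultimately show ?thesis unfolding K1.D_simps by linarith
  qed
  then show ?thesis using that[of \<Theta> "2 * K1.D.qmod * Q"] \<Theta>(1) Q(1) K1.D.qmod_pos by (simp add: less_imp_le)
qed

lemma kalton_peck_splice_nontrivial:
  fixes P :: "nat set set" and S :: "('k::{real_normed_field,banach}, 'w) l2_four_seq"
  assumes P: "partition_on UNIV P"
    and blocks: "\<forall>n::nat. \<exists>Q\<subseteq>P. finite Q \<and> card Q = n \<and> (\<forall>B\<in>Q. infinite B \<or> n \<le> card B)"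
    and S: "S = yoneda_splice l2 l2 l2_fin l2 l2_fin (kalton_peck_blocks P) kalton_peck"
  shows "S \<in> four_term_seqs l2 l2" "\<not> ext2_trivial l2 l2 S"
    "(Ext2 l2 l2 :: ('k, 'w) l2_four_seq set set) \<noteq> {ext2_zero l2 l2}"
proof -
  have sp: "splice l2 l2 l2_fin (kalton_peck_blocks P) l2 l2_fin kalton_peck S"
    by (rule splice.intro[OF quasilinear_kalton_peck_blocks[OF P] quasilinear_kalton_peck splice_axioms.intro[OF S]])
  show S4: "S \<in> four_term_seqs l2 l2" using sp by (rule splice.splice_four_term)
  show nt: "\<not> ext2_trivial l2 l2 S"
  proof
    assume "ext2_trivial l2 l2 S"
    then have lift: "liftable S" by (rule ext2_trivial_imp_liftable)
    show False
    proof (rule liftable_splice_correction[OF sp lift])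
      show "kalton_peck x \<in> l2_fin" if "x \<in> l2_fin" for x :: "nat \<Rightarrow> 'k"
        using that by (rule kalton_peck_l2_fin)
      fix \<Theta> :: "(nat \<Rightarrow> 'k) \<Rightarrow> nat \<Rightarrow> 'k" and Q :: real
      assume \<Theta>: "\<And>x. x \<in> l2_fin \<Longrightarrow> \<Theta> x \<in> carrier l2" and Q0: "0 \<le> Q" and
        Q: "\<And>x y. x \<in> l2_fin \<Longrightarrow> y \<in> l2_fin \<Longrightarrow>
          qnorm l2 (cauchy_diff l2 \<Theta> x y \<ominus>\<^bsub>l2\<^esub> kalton_peck_blocks P (cauchy_diff l2 kalton_peck x y))
            \<le> Q * (norm2 x + norm2 y)"
      show False
      proof (rule no_quasi_additive_correction[OF P blocks \<Theta> _ Q0])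
        fix x y :: "nat \<Rightarrow> 'k" assume xy: "x \<in> l2_fin" "y \<in> l2_fin"
        note kc = kalton_peck_l2_fin[OF xy(1)] kalton_peck_l2_fin[OF xy(2)] kalton_peck_l2_fin[OF l2_fin_add[OF xy]]
        have 1: "cauchy_diff l2 kalton_peck x y =
            (\<lambda>n. kalton_peck (\<lambda>n. x n + y n) n - (kalton_peck x n + kalton_peck y n))"
          using kc by (simp add: l2_fin_carrier l2_fin_add)
        \<comment> \<open>Membership is recorded because \<open>l2_minus\<close> turns subtraction
          in the record into pointwise subtraction only when the subtrahend is square
          summable.\<close>
        have "(\<lambda>n. kalton_peck (\<lambda>n. x n + y n) n - (kalton_peck x n + kalton_peck y n)) \<in> l2_fin"
          using l2_fin_add[OF kc(3) l2_fin_smult[OF l2_fin_add[OF kc(1,2)], of "- 1"]] by (simp add: algebra_simps)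
        then have 2: "summable (\<lambda>n. (norm (kalton_peck_blocks P
            (\<lambda>n. kalton_peck (\<lambda>n. x n + y n) n - (kalton_peck x n + kalton_peck y n)) n))\<^sup>2)"
          using kalton_peck_blocks_l2_fin[OF P] l2_fin_carrier by blast
        have 3: "summable (\<lambda>n. (norm (\<Theta> x n + \<Theta> y n))\<^sup>2)"
          using \<Theta>[OF xy(1)] \<Theta>[OF xy(2)] norm2_triangle(1) by simp
        show "norm2 (\<lambda>n. \<Theta> (\<lambda>n. x n + y n) n - (\<Theta> x n + \<Theta> y n) -
          kalton_peck_blocks P (\<lambda>n. kalton_peck (\<lambda>n. x n + y n) n - (kalton_peck x n + kalton_peck y n)) n)
          \<le> Q * (norm2 x + norm2 y)"
          using Q[OF xy] unfolding 1 by (simp add: 2 3)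
      qed
    qed
  qed
  show "(Ext2 l2 l2 :: ('k, 'w) l2_four_seq set set) \<noteq> {ext2_zero l2 l2}"
  proof
    assume "(Ext2 l2 l2 :: ('k, 'w) l2_four_seq set set) = {ext2_zero l2 l2}"
    moreover have "ext2_rel l2 l2 `` {S} \<in> Ext2 l2 l2" unfolding Ext2_def using S4 by (rule quotientI)
    ultimately have "ext2_rel l2 l2 `` {S} = ext2_zero l2 l2" by auto
    moreover have "S \<in> ext2_rel l2 l2 `` {S}" using S4 by (simp add: ext2_rel_def)
    ultimately have "(zero_seq l2 l2, S) \<in> ext2_rel l2 l2" by (simp add: ext2_zero_def)
    then have "ext2_trivial l2 l2 S" unfolding ext2_trivial_def ext2_rel_def by (auto intro: equivclp_sym)
    with nt show False by contradiction
  qed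
qed

theorem theorem4p6:
  fixes P :: "nat set set"
  assumes "partition_on UNIV P"
    and "\<forall>n::nat. \<exists>Q\<subseteq>P. finite Q \<and> card Q = n \<and> (\<forall>B\<in>Q. infinite B \<or> n \<le> card B)"
  shows
    "(let S = yoneda_splice l2 l2 l2_fin l2 l2_fin (kalton_peck_blocks P) kalton_peck
            :: (real, 'w) l2_four_seq
      in S \<in> four_term_seqs l2 l2 \<and> \<not> ext2_trivial l2 l2 S) \<and>
     (Ext2 l2 l2 :: (real, 'w) l2_four_seq set set) \<noteq> {ext2_zero l2 l2} \<and>
     (let S = yoneda_splice l2 l2 l2_fin l2 l2_fin (kalton_peck_blocks P) kalton_peck
            :: (complex, 'w) l2_four_seq
      in S \<in> four_term_seqs l2 l2 \<and> \<not> ext2_trivial l2 l2 S) \<and>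
     (Ext2 l2 l2 :: (complex, 'w) l2_four_seq set set) \<noteq> {ext2_zero l2 l2}"
  using kalton_peck_splice_nontrivial[OF assms refl, where 'k = real and 'w = 'w]
    kalton_peck_splice_nontrivial[OF assms refl, where 'k = complex and 'w = 'w]
  unfolding Let_def by blast

end
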